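(* Let $G$ be a character on $\mathbf{k}\langle\mathbf{a},\mathbf{b}\rangle$ and let $g$ be the associated chain map of the first kind, regarded as a linear map on $\mathrm{BQSym}$. Then $g$ is an algebra homomorphism on the type $B$ quasisymmetric functions $\mathrm{BQSym}$.
   Context: Let $\mathbf{k}$ be a field and $\mathbf{k}\langle\mathbf{a},\mathbf{b}\rangle$ the algebra of polynomials in noncommuting variables $\mathbf{a},\mathbf{b}$ of degree $1$. For a finite graded poset $P$ (with $\widehat 0$, $\widehat 1$, rank function $\rho$, $\rho(x,y)=\rho(y)-\rho(x)$) of rank at least $1$, the $\mathbf{ab}$-index is $\Psi(P)=\sum_c (\mathbf{a}-\mathbf{b})^{\rho(x_0,x_1)-1}\cdot\mathbf{b}\cdot(\mathbf{a}-\mathbf{b})^{\rho(x_1,x_2)-1}\cdot\mathbf{b}\cdots\mathbf{b}\cdot(\mathbf{a}-\mathbf{b})^{\rho(x_{k-1},x_k)-1}$, summed over all chains $c=\{\widehat 0=x_0<\cdots<x_k=\widehat 1\}$. A character $G$ on $\mathbf{k}\langle\mathbf{a},\mathbf{b}\rangle$ is a linear functional $G:\mathbf{k}\langle\mathbf{a},\mathbf{b}\rangle\to\mathbf{k}$ with $G(\Psi(P\times Q))=G(\Psi(P))\cdot G(\Psi(Q))$ for all graded posets $P,Q$ of rank at least $1$, where $P\times Q$ is the Cartesian product. Coproduct: for a monomial $u_1\cdots u_n$, $\Delta(u_1\cdots u_n)=\sum_{i=1}^n u_1\cdots u_{i-1}\otimes u_{i+1}\cdots u_n$ (so $\Delta(1)=0$),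 extended linearly; it is coassociative. $\Delta^1=\mathrm{id}$, $\Delta^{k+1}=(\mathrm{id}\otimes\Delta^k)\circ\Delta$, with Sweedler notation $\Delta^k(u)=\sum_u u_{(1)}\otimes\cdots\otimes u_{(k)}$. For homogeneous $u$ let $\widehat g(u)=G(u)(\mathbf{a}-\mathbf{b})^{\deg u}$ and $\kappa(u)=A(u)(\mathbf{a}-\mathbf{b})^{\deg u}$, extended linearly, where $A$ is the algebra map to $\mathbf{k}$ with $A(\mathbf{a})=1$, $A(\mathbf{b})=0$. The chain map of the first kind is $g(u)=\sum_{k\ge1}\sum_u\kappa(u_{(1)})\cdot\mathbf{b}\cdot\widehat g(u_{(2)})\cdot\mathbf{b}\cdots\mathbf{b}\cdot\widehat g(u_{(k)})$ (coproduct into $k$ parts). $\mathrm{QSym}$ is the algebra (over $\mathbf{k}$) of quasisymmetric functions in $t_1,t_2,\ldots$, with linear basis $M_{(p_1,\ldots,p_k)}=\sum_{i_1<\cdots<i_k}t_{i_1}^{p_1}\cdots t_{i_k}^{p_k}$ (all $p_i\ge1$, $k\ge0$; the empty one is $1$). $\mathrm{BQSym}=\mathbf{k}[s]\otimes\mathrm{QSym}$ as an algebra. The map $\gamma_B:\mathbf{k}\langle\mathbf{a},\mathbf{b}\rangle\to\mathrm{BQSym}$ is the linear isomorphism with $\gamma_B((\mathbf{a}-\mathbf{b})^{p}\cdot\mathbf{b}\cdot(\mathbf{a}-\mathbf{b})^{p_1-1}\cdot\mathbf{b}\cdots\mathbf{b}\cdot(\mathbf{a}-\mathbf{b})^{p_k-1})=s^p\cdot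 M_{(p_1,\ldots,p_k)}$ for $p\ge0$, $k\ge0$, $p_i\ge1$ (for $k=0$: $(\mathbf{a}-\mathbf{b})^p\mapsto s^p$). On $\mathrm{BQSym}$, $g$ is defined by $g(f)=\gamma_B(g(\gamma_B^{-1}(f)))$. *)

theory Defs
  imports "HOL-Library.Poly_Mapping" "HOL-Computational_Algebra.Polynomial"
begin

section \<open>The free algebra on two letters\<close>

datatype letter = La | Lb

instantiation list :: (type) monoid_add
begin
definition zero_list :: "'a list" where "zero_list = []"
definition plus_list :: "'a list \<Rightarrow> 'a list \<Rightarrow> 'a list" where "plus_list = (@)"
instance by standard (simp_all add: zero_list_def plus_list_def)
end

text \<open>The monoid algebra of the free monoid of words.\<close>

type_synonym 'k ncpoly = "letter list \<Rightarrow>\<^sub>0 'k"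

definition word :: "'x \<Rightarrow> 'x \<Rightarrow>\<^sub>0 'k::field"
  where "word w = Poly_Mapping.single w 1"

definition var_a :: "'k::field ncpoly" where "var_a = word [La]"
definition var_b :: "'k::field ncpoly" where "var_b = word [Lb]"

definition pm_scale :: "'k::field \<Rightarrow> ('x \<Rightarrow>\<^sub>0 'k) \<Rightarrow> ('x \<Rightarrow>\<^sub>0 'k)"
  where "pm_scale c u = Poly_Mapping.map ((*) c) u"

lemma lookup_pm_scale [simp]: "Poly_Mapping.lookup (pm_scale c u) x = c * Poly_Mapping.lookup u x"
  by (simp add: pm_scale_def Poly_Mapping.map.rep_eq when_def)

interpretation pm: vector_space pm_scale
  by standard (auto intro!: poly_mapping_eqI simp: lookup_add algebra_simps)

lemma pm_expand: "u = (\<Sum>x\<in>Poly_Mapping.keys u. pm_scale (Poly_Mapping.lookup u x) (word x))"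
proof (rule poly_mapping_eqI)
  fix y
  have "(\<Sum>x\<in>Poly_Mapping.keys u. Poly_Mapping.lookup u x * (1 when x = y)) =
      (\<Sum>x\<in>Poly_Mapping.keys u. if x = y then Poly_Mapping.lookup u y else 0)"
    by (rule sum.cong) (auto simp: when_def)
  then show "Poly_Mapping.lookup u y = Poly_Mapping.lookup
      (\<Sum>x\<in>Poly_Mapping.keys u. pm_scale (Poly_Mapping.lookup u x) (word x)) y"
    by (simp add: lookup_sum word_def lookup_single in_keys_iff)
qed

text \<open>Linear extension of a map given on basis elements; the first argument is the scalar
  multiplication of the target.\<close>

definition lin_ext :: "('k::field \<Rightarrow> 'v \<Rightarrow> 'v) \<Rightarrow> ('x \<Rightarrow> 'v) \<Rightarrow> ('x \<Rightarrow>\<^sub>0 'k) \<Rightarrow> 'v::ab_group_add"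
  where "lin_ext sc f u = (\<Sum>x\<in>Poly_Mapping.keys u. sc (Poly_Mapping.lookup u x) (f x))"

lemma lin_ext_linear:
  fixes sc :: "'k::field \<Rightarrow> 'v \<Rightarrow> 'v::ab_group_add"
  assumes "vector_space sc"
  shows "Vector_Spaces.linear pm_scale sc (lin_ext sc f)"
proof -
  interpret v: vector_space sc by fact
  have supset: "lin_ext sc f u = (\<Sum>x\<in>S. sc (Poly_Mapping.lookup u x) (f x))"
    if "finite S" "Poly_Mapping.keys u \<subseteq> S" for u S
    unfolding lin_ext_def
    by (rule sum.mono_neutral_left) (use that in \<open>auto simp: in_keys_iff\<close>)
  show ?thesis
  proof (intro Vector_Spaces.linear.intro module_hom.intro pm.vector_space_axioms assms
      module_hom_axioms.intro pm.module_axioms v.module_axioms)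
    fix u w :: "'a \<Rightarrow>\<^sub>0 'k"
    let ?S = "Poly_Mapping.keys u \<union> Poly_Mapping.keys w"
    show "lin_ext sc f (u + w) = lin_ext sc f u + lin_ext sc f w"
      using Poly_Mapping.keys_add[of u w]
      by (subst (1 2 3) supset[where S = ?S])
        (auto simp: lookup_add v.scale_left_distrib sum.distrib)
  next
    fix c :: 'k and u :: "'a \<Rightarrow>\<^sub>0 'k"
    show "lin_ext sc f (pm_scale c u) = sc c (lin_ext sc f u)"
      by (subst (1 2) supset[where S = "Poly_Mapping.keys u"])
        (auto simp: in_keys_iff v.scale_sum_right)
  qed
qed

lemma lin_ext_word:
  assumes "vector_space sc"
  shows "lin_ext sc f (word x) = f x"
proof -
  interpret v: vector_space sc by fact
  show ?thesis by (simp add: lin_ext_def word_def)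
qed

section \<open>Graded posets and the ab-index\<close>

text \<open>A poset is given by its reflexive order relation; its elements form the field of the
  relation.\<close>

definition is_bot :: "'p rel \<Rightarrow> 'p \<Rightarrow> bool"
  where "is_bot P x \<longleftrightarrow> x \<in> Field P \<and> (\<forall>y\<in>Field P. (x, y) \<in> P)"

definition is_top :: "'p rel \<Rightarrow> 'p \<Rightarrow> bool"
  where "is_top P x \<longleftrightarrow> x \<in> Field P \<and> (\<forall>y\<in>Field P. (y, x) \<in> P)"

definition bot_el :: "'p rel \<Rightarrow> 'p" where "bot_el P = (THE x. is_bot P x)"
definition top_el :: "'p rel \<Rightarrow> 'p" where "top_el P = (THE x. is_top P x)"

definition lt :: "'p rel \<Rightarrow> 'p \<Rightarrow> 'p \<Rightarrow> bool"
  where "lt P x y \<longleftrightarrow> (x, y) \<in> P \<and> x \<noteq> y"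

definition covers :: "'p rel \<Rightarrow> 'p \<Rightarrow> 'p \<Rightarrow> bool"
  where "covers P y x \<longleftrightarrow> lt P x y \<and> \<not> (\<exists>z. lt P x z \<and> lt P z y)"

definition is_rank_function :: "'p rel \<Rightarrow> ('p \<Rightarrow> nat) \<Rightarrow> bool"
  where "is_rank_function P \<rho> \<longleftrightarrow>
    \<rho> (bot_el P) = 0 \<and> (\<forall>x y. covers P y x \<longrightarrow> \<rho> y = \<rho> x + 1)"

definition graded_poset :: "'p rel \<Rightarrow> bool"
  where "graded_poset P \<longleftrightarrow> finite (Field P) \<and> Partial_order P \<and>
    (\<exists>x. is_bot P x) \<and> (\<exists>x. is_top P x) \<and> (\<exists>\<rho>. is_rank_function P \<rho>)"

text \<open>The rank function is determined on the elements of the poset; its values elsewhere are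
  irrelevant.\<close>

definition rank_fun :: "'p rel \<Rightarrow> 'p \<Rightarrow> nat"
  where "rank_fun P = (SOME \<rho>. is_rank_function P \<rho>)"

definition rank_diff :: "'p rel \<Rightarrow> 'p \<Rightarrow> 'p \<Rightarrow> nat"
  where "rank_diff P x y = rank_fun P y - rank_fun P x"

definition poset_rank :: "'p rel \<Rightarrow> nat"
  where "poset_rank P = rank_fun P (top_el P)"

definition poset_prod :: "'p rel \<Rightarrow> 'q rel \<Rightarrow> ('p \<times> 'q) rel"
  where "poset_prod P Q = {((x, y), (x', y')). (x, x') \<in> P \<and> (y, y') \<in> Q}"

text \<open>Chains are represented by their strictly increasing enumerations.\<close>

definition bounded_chains :: "'p rel \<Rightarrow> 'p list set"
  where "bounded_chains P = {xs. xs \<noteq> [] \<and> set xs \<subseteq> Field P \<and> sorted_wrt (lt P) xs \<and>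
    hd xs = bot_el P \<and> last xs = top_el P}"

fun chain_weight :: "'p rel \<Rightarrow> 'p list \<Rightarrow> 'k::field ncpoly" where
  "chain_weight P (x # y # z # zs) =
     (var_a - var_b) ^ (rank_diff P x y - 1) * var_b * chain_weight P (y # z # zs)"
| "chain_weight P [x, y] = (var_a - var_b) ^ (rank_diff P x y - 1)"
| "chain_weight P _ = 1"

definition ab_index :: "'p rel \<Rightarrow> 'k::field ncpoly"
  where "ab_index P = (\<Sum>xs\<in>bounded_chains P. chain_weight P xs)"

text \<open>Every finite poset is isomorphic to one whose elements are natural numbers, so it suffices
  to quantify over those.\<close>

definition is_character :: "('k::field ncpoly \<Rightarrow> 'k) \<Rightarrow> bool"
  where "is_character G \<longleftrightarrow> Vector_Spaces.linear pm_scale (*) G \<and>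
    (\<forall>(P :: nat rel) (Q :: nat rel).
       graded_poset P \<and> graded_poset Q \<and> 1 \<le> poset_rank P \<and> 1 \<le> poset_rank Q \<longrightarrow>
       G (ab_index (poset_prod P Q)) = G (ab_index P) * G (ab_index Q))"

section \<open>Coproduct and chain maps of the first kind\<close>

text \<open>The tensor algebra over the vector space \<open>'k ncpoly\<close>, with basis the
  pure tensors of words: the list \<open>[w\<^sub>1, \<dots>, w\<^sub>k]\<close> stands for
  \<open>w\<^sub>1 \<otimes> \<dots> \<otimes> w\<^sub>k\<close>, and the tensor product of tensors is the product of the monoid algebra.\<close>

type_synonym 'k tensor = "letter list list \<Rightarrow>\<^sub>0 'k"

definition one_tensor :: "'k::field ncpoly \<Rightarrow> 'k tensor"
  where "one_tensor = lin_ext pm_scale (\<lambda>w. word [w])"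

definition coproduct :: "'k::field ncpoly \<Rightarrow> 'k tensor"
  where "coproduct = lin_ext pm_scale (\<lambda>w. \<Sum>i<length w. word [take i w, drop (Suc i) w])"

text \<open>The map \<open>id \<otimes> F\<close> on two-fold tensors.\<close>

definition id_tensor :: "('k::field ncpoly \<Rightarrow> 'k tensor) \<Rightarrow> 'k tensor \<Rightarrow> 'k tensor"
  where "id_tensor F = lin_ext pm_scale (\<lambda>ws. word [ws ! 0] * F (word (ws ! 1)))"

text \<open>\<open>iter_coproduct n\<close> is the coproduct \<open>\<Delta>\<close> to the exponent \<open>n + 1\<close>, with values in the
  \<open>(n + 1)\<close>-fold tensors.\<close>

primrec iter_coproduct :: "nat \<Rightarrow> 'k::field ncpoly \<Rightarrow> 'k tensor" where
  "iter_coproduct 0 = one_tensor"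
| "iter_coproduct (Suc n) = id_tensor (iter_coproduct n) \<circ> coproduct"

definition aug :: "'k::field ncpoly \<Rightarrow> 'k"
  where "aug = lin_ext (*) (\<lambda>w. \<Prod>x\<leftarrow>w. (case x of La \<Rightarrow> 1 | Lb \<Rightarrow> 0))"

text \<open>For a linear functional \<open>L\<close>, the linear extension of
  \<open>u \<mapsto> L(u) (a - b)\<^bsup>deg u\<^esup>\<close> for homogeneous \<open>u\<close>.\<close>

definition deg_twist :: "('k::field ncpoly \<Rightarrow> 'k) \<Rightarrow> 'k ncpoly \<Rightarrow> 'k ncpoly"
  where "deg_twist L =
    lin_ext pm_scale (\<lambda>w. pm_scale (L (word w)) ((var_a - var_b) ^ length w))"

definition ghat :: "('k::field ncpoly \<Rightarrow> 'k) \<Rightarrow> 'k ncpoly \<Rightarrow> 'k ncpoly"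
  where "ghat G = deg_twist G"

definition kappa :: "'k::field ncpoly \<Rightarrow> 'k ncpoly"
  where "kappa = deg_twist aug"

text \<open>The linear map with
  \<open>u\<^sub>1 \<otimes> \<dots> \<otimes> u\<^sub>k \<mapsto> \<kappa>(u\<^sub>1) \<cdot> b \<cdot> ghat(u\<^sub>2) \<cdot> b \<cdots> b \<cdot> ghat(u\<^sub>k)\<close>.\<close>

definition chain_product :: "('k::field ncpoly \<Rightarrow> 'k) \<Rightarrow> 'k tensor \<Rightarrow> 'k ncpoly"
  where "chain_product G = lin_ext pm_scale
    (\<lambda>ws. kappa (word (hd ws)) * (\<Prod>w\<leftarrow>tl ws. var_b * ghat G (word w)))"

text \<open>For each argument only finitely many summands are nonzero, see
  \<open>iter_coproduct_eq_0\<close> below.\<close>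

definition chain_map :: "('k::field ncpoly \<Rightarrow> 'k) \<Rightarrow> 'k ncpoly \<Rightarrow> 'k ncpoly"
  where "chain_map G u = Sum_any (\<lambda>n. chain_product G (iter_coproduct n u))"

lemma deg_twist_homogeneous:
  assumes "Vector_Spaces.linear pm_scale (*) L" "\<And>w. w \<in> Poly_Mapping.keys u \<Longrightarrow> length w = n"
  shows "deg_twist L u = pm_scale (L u) ((var_a - var_b) ^ n)"
proof -
  interpret L: Vector_Spaces.linear pm_scale "(*)" L by fact
  have "pm_scale (L u) ((var_a - var_b) ^ n) =
      (\<Sum>w\<in>Poly_Mapping.keys u.
         pm_scale (Poly_Mapping.lookup u w * L (word w)) ((var_a - var_b) ^ n))"
    by (subst pm_expand[of u]) (simp add: L.sum L.scale pm.scale_sum_left)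
  then show ?thesis by (simp add: deg_twist_def lin_ext_def assms(2))
qed

lemma iter_coproduct_linear:
  "Vector_Spaces.linear pm_scale pm_scale (iter_coproduct n :: 'k::field ncpoly \<Rightarrow> _)"
proof (induction n)
  case 0
  show ?case unfolding iter_coproduct.simps one_tensor_def
    by (rule lin_ext_linear) (rule pm.vector_space_axioms)
next
  case (Suc n)
  show ?case unfolding iter_coproduct.simps id_tensor_def coproduct_def
    by (rule Vector_Spaces.linear_compose[OF lin_ext_linear lin_ext_linear])
      (rule pm.vector_space_axioms)+
qed

lemma iter_coproduct_word_eq_0:
  "length w < n \<Longrightarrow> iter_coproduct n (word w) = (0 :: 'k::field tensor)"
proof (induction n arbitrary: w)
  case (Suc n)
  let ?F = "iter_coproduct n :: 'k ncpoly \<Rightarrow> _"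
  interpret l: Vector_Spaces.linear pm_scale pm_scale "id_tensor ?F"
    unfolding id_tensor_def by (rule lin_ext_linear) (rule pm.vector_space_axioms)
  have "id_tensor ?F (word [take i w, drop (Suc i) w]) = 0" if "i < length w" for i
    using Suc that by (simp add: id_tensor_def lin_ext_word[OF pm.vector_space_axioms])
  then show ?case
    by (simp add: coproduct_def lin_ext_word[OF pm.vector_space_axioms] l.sum)
qed simp

lemma iter_coproduct_eq_0:
  fixes u :: "'k::field ncpoly"
  assumes "\<And>w. w \<in> Poly_Mapping.keys u \<Longrightarrow> length w < n"
  shows "iter_coproduct n u = 0"
proof -
  interpret l: Vector_Spaces.linear pm_scale pm_scale "iter_coproduct n :: 'k ncpoly \<Rightarrow> _"
    by (rule iter_coproduct_linear)
  show ?thesis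
    by (subst pm_expand) (simp add: l.sum l.scale iter_coproduct_word_eq_0 assms)
qed

section \<open>Quasisymmetric functions\<close>

text \<open>A formal power series in \<open>t\<^sub>0, t\<^sub>1, \<dots>\<close> is its coefficient function on exponent
  vectors (the variables are numbered from 0). The vector of
  \<open>t\<^bsub>i\<^sub>1\<^esub>\<^bsup>p\<^sub>1\<^esup> \<cdots> t\<^bsub>i\<^sub>k\<^esub>\<^bsup>p\<^sub>k\<^esup>\<close> is given by the lists of the indices
  and of the exponents.\<close>

definition expo :: "nat list \<Rightarrow> nat list \<Rightarrow> (nat \<Rightarrow>\<^sub>0 nat)"
  where "expo is ps = (\<Sum>(i, p)\<leftarrow>zip is ps. Poly_Mapping.single i p)"

definition total_degree :: "(nat \<Rightarrow>\<^sub>0 nat) \<Rightarrow> nat"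
  where "total_degree m = (\<Sum>i\<in>Poly_Mapping.keys m. Poly_Mapping.lookup m i)"

definition pos_list :: "nat list \<Rightarrow> bool"
  where "pos_list ps \<longleftrightarrow> (\<forall>p\<in>set ps. 1 \<le> p)"

definition is_qsym :: "((nat \<Rightarrow>\<^sub>0 nat) \<Rightarrow> 'k::zero) \<Rightarrow> bool"
  where "is_qsym f \<longleftrightarrow>
    (\<exists>d. \<forall>m. f m \<noteq> 0 \<longrightarrow> total_degree m \<le> d) \<and>
    (\<forall>is js ps. sorted_wrt (<) is \<and> sorted_wrt (<) js \<and>
       length is = length ps \<and> length js = length ps \<and> pos_list ps \<longrightarrow>
       f (expo is ps) = f (expo js ps))"

definition ps_mult :: "((nat \<Rightarrow>\<^sub>0 nat) \<Rightarrow> 'k::comm_ring_1) \<Rightarrow> ((nat \<Rightarrow>\<^sub>0 nat) \<Rightarrow> 'k) \<Rightarrow> (nat \<Rightarrow>\<^sub>0 nat) \<Rightarrow> 'k"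
  where "ps_mult f h m = (\<Sum>(x, y)\<in>{(x, y). x + y = m}. f x * h y)"

subsection \<open>Closure properties\<close>

lemma total_degree_superset:
  assumes "finite S" "Poly_Mapping.keys m \<subseteq> S"
  shows "total_degree m = (\<Sum>i\<in>S. Poly_Mapping.lookup m i)"
  unfolding total_degree_def by (rule sum.mono_neutral_left) (use assms in \<open>auto simp: in_keys_iff\<close>)

lemma total_degree_add: "total_degree (x + y) = total_degree x + total_degree y"
proof -
  let ?S = "Poly_Mapping.keys x \<union> Poly_Mapping.keys y"
  show ?thesis
    using Poly_Mapping.keys_add[of x y]
    by (subst (1 2 3) total_degree_superset[where S = ?S]) (auto simp: lookup_add sum.distrib)
qed

lemma total_degree_single [simp]: "total_degree (Poly_Mapping.single i p) = p"
  by (subst total_degree_superset[where S = "{i}"]) auto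

lemma total_degree_0 [simp]: "total_degree 0 = 0"
  by (simp add: total_degree_def)

lemma expo_Nil [simp]: "expo [] ps = 0"
  by (simp add: expo_def)

lemma expo_Nil2 [simp]: "expo is [] = 0"
  by (simp add: expo_def)

lemma expo_Cons [simp]: "expo (i # is) (p # ps) = Poly_Mapping.single i p + expo is ps"
  by (simp add: expo_def)

lemma total_degree_expo:
  "length is = length ps \<Longrightarrow> total_degree (expo is ps) = sum_list ps"
  by (induction "is" ps rule: list_induct2) (auto simp: total_degree_add)

lemma lookup_expo_notin:
  "length is = length ps \<Longrightarrow> i \<notin> set is \<Longrightarrow> Poly_Mapping.lookup (expo is ps) i = 0"
  by (induction "is" ps rule: list_induct2) (auto simp: lookup_add lookup_single when_def)

lemma map_lookup_expo:
  "length is = length ps \<Longrightarrow> distinct is \<Longrightarrow> map (Poly_Mapping.lookup (expo is ps)) is = ps"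
proof (induction "is" ps rule: list_induct2)
  case (Cons i "is" p ps)
  from Cons have "map (Poly_Mapping.lookup (expo (i # is) (p # ps))) is = map (Poly_Mapping.lookup (expo is ps)) is"
    by (intro map_cong) (auto simp: lookup_add lookup_single when_def)
  also have "\<dots> = ps" using Cons by simp
  finally have "map (Poly_Mapping.lookup (expo (i # is) (p # ps))) is = ps" .
  moreover from Cons have "Poly_Mapping.lookup (expo (i # is) (p # ps)) i = p"
    by (simp add: lookup_add lookup_expo_notin)
  ultimately show ?case by (simp del: expo_Cons)
qed simp

lemma expo_add:
  "length is = length ps \<Longrightarrow> length ps = length qs \<Longrightarrow>
    expo is (map2 (+) ps qs) = expo is ps + expo is qs"
  by (induction "is" ps qs rule: list_induct3) (auto simp: single_add algebra_simps)

lemma lookup_expo_map: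
  "distinct is \<Longrightarrow> i \<in> set is \<Longrightarrow> Poly_Mapping.lookup (expo is (map g is)) i = g i"
  using map_lookup_expo[of "is" "map g is"] by (auto dest: map_eq_conv[THEN iffD1])

lemma expo_map_lookup:
  assumes "distinct is" "Poly_Mapping.keys m \<subseteq> set is"
  shows "expo is (map (Poly_Mapping.lookup m) is) = m"
proof (rule poly_mapping_eqI)
  fix i show "Poly_Mapping.lookup (expo is (map (Poly_Mapping.lookup m) is)) i =
      Poly_Mapping.lookup m i"
    using assms by (cases "i \<in> set is")
      (auto simp: lookup_expo_map lookup_expo_notin in_keys_iff)
qed

lemma sorted_wrt_less_distinct: "sorted_wrt (<) (is :: nat list) \<Longrightarrow> distinct is"
  by (simp add: strict_sorted_iff)

lemma expo_exhaust:
  obtains "is" ps where "sorted_wrt (<) is" "length is = length ps" "pos_list ps" "m = expo is ps"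
proof -
  let ?is = "sorted_list_of_set (Poly_Mapping.keys m)"
  show ?thesis
    by (rule that[of ?is "map (Poly_Mapping.lookup m) ?is"])
      (auto simp: expo_map_lookup pos_list_def in_keys_iff Suc_le_eq)
qed

lemma keys_expo_pos:
  assumes "length is = length ps" "distinct is" "pos_list ps"
  shows "Poly_Mapping.keys (expo is ps) = set is"
proof
  show "Poly_Mapping.keys (expo is ps) \<subseteq> set is"
    using lookup_expo_notin[OF assms(1)] by (auto simp: in_keys_iff)
  show "set is \<subseteq> Poly_Mapping.keys (expo is ps)"
  proof
    fix i assume "i \<in> set is"
    then have "Poly_Mapping.lookup (expo is ps) i \<in> set ps"
      using map_lookup_expo[OF assms(1,2)] by (metis imageI list.set_map)
    then show "i \<in> Poly_Mapping.keys (expo is ps)"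
      using assms(3) by (auto simp: pos_list_def in_keys_iff)
  qed
qed

lemma expo_inject:
  assumes "sorted_wrt (<) is" "length is = length ps" "pos_list ps"
    and "sorted_wrt (<) js" "length js = length qs" "pos_list qs"
    and "expo is ps = expo js qs"
  shows "is = js \<and> ps = qs"
proof -
  have "set is = set js"
    using assms keys_expo_pos sorted_wrt_less_distinct by metis
  then have "is = js"
    using assms(1,4) by (simp add: strict_sorted_equal)
  then show ?thesis
    using assms map_lookup_expo sorted_wrt_less_distinct by metis
qed

lemma finite_decomp: "finite {(x, y). x + y = (m :: nat \<Rightarrow>\<^sub>0 nat)}"
proof -
  let ?F = "{f. \<forall>i. (i \<in> Poly_Mapping.keys m \<longrightarrow> f i \<in> {..Max (insert 0 (Poly_Mapping.lookup m ` Poly_Mapping.keys m))})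
    \<and> (i \<notin> Poly_Mapping.keys m \<longrightarrow> f i = (0::nat))}"
  let ?X = "{x. \<forall>i. Poly_Mapping.lookup x i \<le> Poly_Mapping.lookup m i}"
  have fF: "finite ?F" by (rule finite_set_of_finite_funs) auto
  have "Poly_Mapping.lookup ` ?X \<subseteq> ?F"
  proof (clarify, intro conjI impI)
    fix x i assume *: "\<forall>i. Poly_Mapping.lookup x i \<le> Poly_Mapping.lookup m i"
    { assume "i \<in> Poly_Mapping.keys m"
      then have "Poly_Mapping.lookup m i \<le> Max (insert 0 (Poly_Mapping.lookup m ` Poly_Mapping.keys m))"
        by (intro Max_ge) auto
      then show "Poly_Mapping.lookup x i \<in> {..Max (insert 0 (Poly_Mapping.lookup m ` Poly_Mapping.keys m))}"
        using *[rule_format, of i] by simp }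
    { assume "i \<notin> Poly_Mapping.keys m"
      then show "Poly_Mapping.lookup x i = 0"
        using *[rule_format, of i] by (simp add: in_keys_iff) }
  qed
  then have "finite (Poly_Mapping.lookup ` ?X)"
    using fF by (rule finite_subset)
  then have "finite ?X"
    by (rule finite_imageD) (auto simp: inj_on_def intro: poly_mapping_eqI)
  then have "finite (?X \<times> ?X)" by simp
  then show ?thesis
    by (rule rev_finite_subset) (auto simp: lookup_add)
qed

lemma ps_mult_expo:
  assumes d: "distinct is" and len: "length is = length ps"
  shows "ps_mult f h (expo is ps) =
    (\<Sum>(qs, rs)\<in>{(qs, rs). length qs = length ps \<and> length rs = length ps \<and> map2 (+) qs rs = ps}.
       f (expo is qs) * h (expo is rs))"
  unfolding ps_mult_def
proof (rule sum.reindex_bij_witness[where i = "\<lambda>(qs, rs). (expo is qs, expo is rs)"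
      and j = "\<lambda>(x, y). (map (Poly_Mapping.lookup x) is, map (Poly_Mapping.lookup y) is)"], goal_cases)
  case (1 a)
  obtain x y where a: "a = (x, y)" by force
  with 1 have xy: "x + y = expo is ps" by simp
  have "Poly_Mapping.lookup x i = 0 \<and> Poly_Mapping.lookup y i = 0" if "i \<notin> set is" for i
    using lookup_expo_notin[OF len that] by (simp add: xy[symmetric] lookup_add)
  then have "Poly_Mapping.keys x \<subseteq> set is" "Poly_Mapping.keys y \<subseteq> set is"
    by (auto simp: in_keys_iff)
  then show ?case using d by (simp add: a expo_map_lookup)
next
  case (2 a)
  obtain x y where a: "a = (x, y)" by force
  with 2 have xy: "x + y = expo is ps" by simp
  have "map2 (+) (map (Poly_Mapping.lookup x) is) (map (Poly_Mapping.lookup y) is) =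
      map (Poly_Mapping.lookup (x + y)) is"
    by (simp add: lookup_add zip_map_map zip_same_conv_map)
  also have "\<dots> = ps" unfolding xy by (rule map_lookup_expo[OF len d])
  finally show ?case using len by (simp add: a)
next
  case (3 b)
  obtain qs rs where b: "b = (qs, rs)" by force
  with 3 have "length qs = length ps" "length rs = length ps" by auto
  then show ?case using d len by (simp add: b map_lookup_expo)
next
  case (4 b)
  obtain qs rs where b: "b = (qs, rs)" by force
  with 4 have "length qs = length ps" "length rs = length ps" "map2 (+) qs rs = ps" by auto
  then show ?case using expo_add[of "is" qs rs] len by (simp add: b)
next
  case (5 a)
  obtain x y where a: "a = (x, y)" by force
  with 5 have xy: "x + y = expo is ps" by simp
  have "Poly_Mapping.lookup x i = 0 \<and> Poly_Mapping.lookup y i = 0" if "i \<notin> set is" for i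
    using lookup_expo_notin[OF len that] by (simp add: xy[symmetric] lookup_add)
  then have "Poly_Mapping.keys x \<subseteq> set is" "Poly_Mapping.keys y \<subseteq> set is"
    by (auto simp: in_keys_iff)
  then show ?case using d by (simp add: a expo_map_lookup)
qed

text \<open>Zero exponents may be dropped.\<close>

lemma expo_filter:
  "length is = length ps \<Longrightarrow>
    expo is ps = expo (map fst (filter (\<lambda>z. 1 \<le> snd z) (zip is ps))) (filter (\<lambda>p. 1 \<le> p) ps)"
  by (induction "is" ps rule: list_induct2) (auto simp: Suc_le_eq)

lemma is_qsym_eq:
  assumes "is_qsym f" "sorted_wrt (<) is" "sorted_wrt (<) js"
    "length is = length ps" "length js = length ps"
  shows "f (expo is ps) = f (expo js ps)"
proof -
  let ?z = "\<lambda>is. filter (\<lambda>z. 1 \<le> snd z) (zip is ps)"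
  have srt: "sorted_wrt (<) (map fst (?z is))" if "sorted_wrt (<) is" "length is = length ps" for "is" :: "nat list"
  proof -
    have "sorted_wrt (\<lambda>x y. fst x < fst y) (zip is ps)"
      using that by (subst sorted_wrt_map[symmetric]) simp
    then show ?thesis by (simp add: sorted_wrt_map sorted_wrt_filter)
  qed
  have len: "length (?z is) = length (filter (\<lambda>p. 1 \<le> p) ps)" if "length is = length ps" for "is" :: "nat list"
    using that by (induction "is" ps rule: list_induct2) auto
  have "pos_list (filter (\<lambda>p. 1 \<le> p) ps)" by (simp add: pos_list_def)
  then show ?thesis
    using assms(1) srt[OF assms(2,4)] srt[OF assms(3,5)] len[OF assms(4)] len[OF assms(5)]
    unfolding is_qsym_def expo_filter[OF assms(4)] expo_filter[OF assms(5)] by simp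
qed

lemma is_qsym_mult:
  fixes f h :: "(nat \<Rightarrow>\<^sub>0 nat) \<Rightarrow> 'k::comm_ring_1"
  assumes "is_qsym f" "is_qsym h"
  shows "is_qsym (ps_mult f h)"
  unfolding is_qsym_def
proof (intro conjI allI impI)
  obtain d e where de: "\<And>m. f m \<noteq> 0 \<Longrightarrow> total_degree m \<le> d" "\<And>m. h m \<noteq> 0 \<Longrightarrow> total_degree m \<le> e"
    using assms unfolding is_qsym_def by metis
  show "\<exists>d. \<forall>m. ps_mult f h m \<noteq> 0 \<longrightarrow> total_degree m \<le> d"
  proof (intro exI allI impI)
    fix m assume "ps_mult f h m \<noteq> 0"
    then obtain a where "a \<in> {(x, y). x + y = m}" "(case a of (x, y) \<Rightarrow> f x * h y) \<noteq> 0"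
      unfolding ps_mult_def by (rule sum.not_neutral_contains_not_neutral)
    then obtain x y where "x + y = m" "f x * h y \<noteq> 0" by auto
    moreover from this have "f x \<noteq> 0" "h y \<noteq> 0" by auto
    ultimately show "total_degree m \<le> d + e"
      using de(1)[of x] de(2)[of y] by (auto simp: total_degree_add)
  qed
next
  fix "is" js ps :: "nat list"
  assume *: "sorted_wrt (<) is \<and> sorted_wrt (<) js \<and>
       length is = length ps \<and> length js = length ps \<and> pos_list ps"
  then have "distinct is" "distinct js" by (auto intro: sorted_wrt_less_distinct)
  then have E: "ps_mult f h (expo ks ps) = (\<Sum>(qs, rs)\<in>{(qs, rs). length qs = length ps \<and>
      length rs = length ps \<and> map2 (+) qs rs = ps}. f (expo ks qs) * h (expo ks rs))"
    if "ks = is \<or> ks = js" for ks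
    using that * by (intro ps_mult_expo) auto
  have "f (expo is qs) = f (expo js qs) \<and> h (expo is qs) = h (expo js qs)"
    if "length qs = length ps" for qs
    using that * by (intro conjI is_qsym_eq[OF assms(1)] is_qsym_eq[OF assms(2)]) simp_all
  then show "ps_mult f h (expo is ps) = ps_mult f h (expo js ps)"
    unfolding E[OF disjI1[OF refl]] E[OF disjI2[OF refl]]
    by (intro sum.cong refl) (clarsimp split: prod.splits)
qed

lemma is_qsym_add: "is_qsym f \<Longrightarrow> is_qsym h \<Longrightarrow> is_qsym (\<lambda>m. f m + h m :: 'k::comm_ring_1)"
proof -
  assume a: "is_qsym f" "is_qsym h"
  obtain d e where de: "\<And>m. f m \<noteq> 0 \<Longrightarrow> total_degree m \<le> d" "\<And>m. h m \<noteq> 0 \<Longrightarrow> total_degree m \<le> e"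
    using a unfolding is_qsym_def by metis
  have "f m + h m \<noteq> 0 \<longrightarrow> total_degree m \<le> max d e" for m
    using de[of m] by (cases "f m = 0") (auto simp: max_def intro: order_trans)
  then show ?thesis using a unfolding is_qsym_def by metis
qed

lemma is_qsym_uminus: "is_qsym f \<Longrightarrow> is_qsym (\<lambda>m. - f m :: 'k::comm_ring_1)"
  unfolding is_qsym_def by (metis neg_equal_0_iff_equal)

lemma is_qsym_const: "is_qsym (\<lambda>m. if m = 0 then c else (0::'k::zero))"
  unfolding is_qsym_def
proof (intro conjI allI impI)
  show "\<exists>d. \<forall>m. (if m = 0 then c else 0) \<noteq> 0 \<longrightarrow> total_degree m \<le> d"
    by (rule exI[of _ 0]) (auto split: if_splits)
  fix "is" js ps :: "nat list"
  assume *: "sorted_wrt (<) is \<and> sorted_wrt (<) js \<and>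
       length is = length ps \<and> length js = length ps \<and> pos_list ps"
  have "expo is ps = 0 \<longleftrightarrow> ps = []" if "sorted_wrt (<) is" "length is = length ps" for "is"
    using expo_inject[OF that, of "[]" "[]"] * by (auto simp: pos_list_def)
  with * show "(if expo is ps = 0 then c else 0) = (if expo js ps = 0 then c else 0)"
    by simp
qed

subsection \<open>The algebra\<close>

typedef (overloaded) 'k qsym = "{f :: (nat \<Rightarrow>\<^sub>0 nat) \<Rightarrow> 'k::zero. is_qsym f}"
  morphisms qcoeff Abs_qsym
  using is_qsym_const by auto

setup_lifting type_definition_qsym

lift_definition qconst :: "'k::comm_ring_1 \<Rightarrow> 'k qsym" is "\<lambda>c m. if m = 0 then c else 0"
  by (rule is_qsym_const)

lemma ps_mult_assoc: "ps_mult (ps_mult f g) h m = ps_mult f (ps_mult g h) m"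
proof -
  have "ps_mult (ps_mult f g) h m =
    (\<Sum>p\<in>{(x, y). x + y = m}. \<Sum>q\<in>{(u, v). u + v = fst p}. f (fst q) * g (snd q) * h (snd p))"
    by (simp add: ps_mult_def sum_distrib_right case_prod_unfold)
  also have "\<dots> = (\<Sum>(p, q)\<in>(SIGMA p:{(x, y). x + y = m}. {(u, v). u + v = fst p}). f (fst q) * g (snd q) * h (snd p))"
    by (rule sum.Sigma) (auto intro: finite_decomp)
  also have "\<dots> = (\<Sum>(p, q)\<in>(SIGMA p:{(x, y). x + y = m}. {(u, v). u + v = snd p}). f (fst p) * (g (fst q) * h (snd q)))"
    by (rule sum.reindex_bij_witness[where
          i = "\<lambda>(p, q). ((fst p + fst q, snd q), (fst p, fst q))" and
          j = "\<lambda>(p, q). ((fst q, snd q + snd p), (snd q, snd p))"]) (auto simp: algebra_simps)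
  also have "\<dots> = (\<Sum>p\<in>{(x, y). x + y = m}. \<Sum>q\<in>{(u, v). u + v = snd p}. f (fst p) * (g (fst q) * h (snd q)))"
    by (rule sum.Sigma[symmetric]) (auto intro: finite_decomp)
  also have "\<dots> = ps_mult f (ps_mult g h) m"
    by (simp add: ps_mult_def sum_distrib_left case_prod_unfold)
  finally show ?thesis .
qed

lemma ps_mult_commute: "ps_mult f g m = ps_mult g f m"
  unfolding ps_mult_def
  by (rule sum.reindex_bij_witness[where i = "\<lambda>(x, y). (y, x)" and j = "\<lambda>(x, y). (y, x)"])
    (auto simp: algebra_simps)

lemma ps_mult_const: "ps_mult (\<lambda>m. if m = 0 then c else 0) f m = c * f m"
proof -
  have "ps_mult (\<lambda>m. if m = 0 then c else 0) f m =
    (\<Sum>(x, y)\<in>{(0 :: nat \<Rightarrow>\<^sub>0 nat, m)}. (if x = 0 then c else 0) * f y)"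
    unfolding ps_mult_def
    by (intro sum.mono_neutral_right finite_decomp) (auto split: if_splits)
  then show ?thesis by simp
qed

instantiation qsym :: (comm_ring_1) comm_ring_1
begin

lift_definition zero_qsym :: "'a qsym" is "\<lambda>m. 0"
  using is_qsym_const[of "0::'a"] by simp
lift_definition one_qsym :: "'a qsym" is "\<lambda>m. if m = 0 then 1 else 0" by (rule is_qsym_const)
lift_definition plus_qsym :: "'a qsym \<Rightarrow> 'a qsym \<Rightarrow> 'a qsym" is "\<lambda>f h m. f m + h m"
  by (rule is_qsym_add)
lift_definition uminus_qsym :: "'a qsym \<Rightarrow> 'a qsym" is "\<lambda>f m. - f m" by (rule is_qsym_uminus)
lift_definition minus_qsym :: "'a qsym \<Rightarrow> 'a qsym \<Rightarrow> 'a qsym" is "\<lambda>f h m. f m - h m"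
proof -
  fix f h :: "(nat \<Rightarrow>\<^sub>0 nat) \<Rightarrow> 'a" assume "is_qsym f" "is_qsym h"
  then show "is_qsym (\<lambda>m. f m - h m)"
    using is_qsym_add[OF _ is_qsym_uminus, of f h] by simp
qed
lift_definition times_qsym :: "'a qsym \<Rightarrow> 'a qsym \<Rightarrow> 'a qsym" is ps_mult by (rule is_qsym_mult)

instance
proof
  fix a b c :: "'a qsym"
  show "a * b * c = a * (b * c)" by transfer (simp add: fun_eq_iff ps_mult_assoc)
  show "a * b = b * a" by transfer (simp add: fun_eq_iff ps_mult_commute)
  show "1 * a = a" by transfer (simp add: fun_eq_iff ps_mult_const)
  show "(a + b) * c = a * c + b * c"
    by transfer (simp add: fun_eq_iff ps_mult_def case_prod_unfold sum.distrib distrib_right)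
  show "(0 :: 'a qsym) \<noteq> 1" by transfer (auto simp: fun_eq_iff)
qed (transfer; simp add: fun_eq_iff algebra_simps)+

end

text \<open>The basis element \<open>M\<^bsub>ps\<^esub>\<close>; only meaningful for \<open>pos_list ps\<close>, when distinct index lists
  give distinct monomials, see \<open>qcoeff_qmonomial\<close>.\<close>

definition qmonomial :: "nat list \<Rightarrow> 'k::comm_ring_1 qsym"
  where "qmonomial ps = Abs_qsym (\<lambda>m.
    if \<exists>is. sorted_wrt (<) is \<and> length is = length ps \<and> m = expo is ps then 1 else 0)"

lemma qcoeff_qmonomial:
  assumes "pos_list ps"
  shows "qcoeff (qmonomial ps :: 'k::comm_ring_1 qsym) m =
    (if \<exists>is. sorted_wrt (<) is \<and> length is = length ps \<and> m = expo is ps then 1 else 0)"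
proof -
  let ?f = "\<lambda>m. if \<exists>is. sorted_wrt (<) is \<and> length is = length ps \<and> m = expo is ps then 1 else (0::'k)"
  have "is_qsym ?f"
    unfolding is_qsym_def
  proof (intro conjI allI impI)
    show "\<exists>d. \<forall>m. ?f m \<noteq> 0 \<longrightarrow> total_degree m \<le> d"
      by (rule exI[of _ "sum_list ps"]) (auto simp: total_degree_expo)
    fix "is" js qs :: "nat list"
    assume *: "sorted_wrt (<) is \<and> sorted_wrt (<) js \<and>
       length is = length qs \<and> length js = length qs \<and> pos_list qs"
    have "(\<exists>is'. sorted_wrt (<) is' \<and> length is' = length ps \<and> expo is qs = expo is' ps) \<longleftrightarrow> qs = ps"
      if "sorted_wrt (<) is" "length is = length qs" for "is"
      using that * assms expo_inject by metis
    with * show "?f (expo is qs) = ?f (expo js qs)" by simp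
  qed
  then show ?thesis by (simp add: qmonomial_def Abs_qsym_inverse)
qed

lemma qcoeff_qmonomial_expo:
  assumes "pos_list ps" "pos_list qs" "sorted_wrt (<) is" "length is = length qs"
  shows "qcoeff (qmonomial ps :: 'k::comm_ring_1 qsym) (expo is qs) = (if ps = qs then 1 else 0)"
  using assms expo_inject by (auto simp: qcoeff_qmonomial)

section \<open>Type B quasisymmetric functions\<close>

text \<open>\<open>k[s] \<otimes> QSym\<close> is the algebra of polynomials in \<open>s\<close> with coefficients in \<open>QSym\<close>.\<close>

type_synonym 'k bqsym = "'k qsym poly"

definition bq_scale :: "'k::field \<Rightarrow> 'k bqsym \<Rightarrow> 'k bqsym"
  where "bq_scale c f = smult (qconst c) f"

lemma qconst_add: "qconst (a + b) = qconst a + qconst b"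
  by transfer (simp add: fun_eq_iff)

lemma qconst_mult: "qconst (a * b) = qconst a * qconst b"
  by transfer (simp add: fun_eq_iff ps_mult_const)

lemma qconst_1: "qconst 1 = 1"
  by transfer simp

lemma qcoeff_qconst_mult: "qcoeff (qconst c * f) m = c * qcoeff f m"
  by transfer (simp add: ps_mult_const)

interpretation bq: vector_space bq_scale
  by standard (simp_all add: bq_scale_def qconst_add qconst_mult qconst_1 smult_add_left smult_add_right)

definition s_qmonomial :: "nat \<Rightarrow> nat list \<Rightarrow> 'k::field bqsym"
  where "s_qmonomial p ps = monom (qmonomial ps) p"

definition ab_basis :: "nat \<Rightarrow> nat list \<Rightarrow> 'k::field ncpoly"
  where "ab_basis p ps =
    (var_a - var_b) ^ p * (\<Prod>q\<leftarrow>ps. var_b * (var_a - var_b) ^ (q - 1))"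

definition is_gamma_B :: "('k::field ncpoly \<Rightarrow> 'k bqsym) \<Rightarrow> bool"
  where "is_gamma_B \<gamma> \<longleftrightarrow> Vector_Spaces.linear pm_scale bq_scale \<gamma> \<and>
    (\<forall>p ps. pos_list ps \<longrightarrow> \<gamma> (ab_basis p ps) = s_qmonomial p ps)"

text \<open>Existence, uniqueness and bijectivity are shown in \<open>is_gamma_B_gamma_B\<close> and
  \<open>bij_gamma_B\<close>.\<close>

definition gamma_B :: "'k::field ncpoly \<Rightarrow> 'k bqsym"
  where "gamma_B = (THE \<gamma>. is_gamma_B \<gamma>)"

subsection \<open>Existence, uniqueness and bijectivity\<close>

text \<open>In the free generators \<open>a - b\<close> and \<open>b\<close>, the elements \<open>ab_basis p ps\<close> are the words.\<close>

primrec decode :: "letter list \<Rightarrow> nat \<times> nat list" where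
  "decode [] = (0, [])"
| "decode (x # w) = (case x of La \<Rightarrow> (Suc (fst (decode w)), snd (decode w))
     | Lb \<Rightarrow> (0, Suc (fst (decode w)) # snd (decode w)))"

definition encode :: "nat \<Rightarrow> nat list \<Rightarrow> letter list" where
  "encode p ps = replicate p La @ concat (map (\<lambda>q. Lb # replicate (q - 1) La) ps)"

lemma pos_list_decode: "pos_list (snd (decode w))"
  by (induction w) (auto simp: pos_list_def split: letter.split)

lemma encode_decode: "encode (fst (decode w)) (snd (decode w)) = w"
  by (induction w) (auto simp: encode_def split: letter.split)

lemma decode_replicate: "decode (replicate p La @ w) = (p + fst (decode w), snd (decode w))"
  by (induction p) auto

lemma decode_encode: "pos_list ps \<Longrightarrow> decode (encode p ps) = (p, ps)"
proof (induction ps arbitrary: p)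
  case Nil
  then show ?case using decode_replicate[of p "[]"] by (simp add: encode_def)
next
  case (Cons q ps)
  then have "decode (encode (q - 1) ps) = (q - 1, ps)" "1 \<le> q" by (auto simp: pos_list_def)
  then show ?case by (simp add: encode_def decode_replicate)
qed

definition subst :: "'k::field ncpoly \<Rightarrow> 'k ncpoly \<Rightarrow> 'k ncpoly \<Rightarrow> 'k ncpoly"
  where "subst x y = lin_ext pm_scale (\<lambda>w. \<Prod>l\<leftarrow>w. (case l of La \<Rightarrow> x | Lb \<Rightarrow> y))"

lemma linear_subst: "Vector_Spaces.linear pm_scale pm_scale (subst x y)"
  unfolding subst_def by (rule lin_ext_linear) (rule pm.vector_space_axioms)

lemma subst_word: "subst x y (word w) = (\<Prod>l\<leftarrow>w. (case l of La \<Rightarrow> x | Lb \<Rightarrow> y))"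
  unfolding subst_def by (rule lin_ext_word) (rule pm.vector_space_axioms)

lemma word_append: "word (v @ w) = (word v * word w :: 'k::field ncpoly)"
  by (simp add: word_def mult_single plus_list_def)

lemma word_Nil: "word [] = (1 :: 'k::field ncpoly)"
  by (simp add: word_def single_one[symmetric] zero_list_def del: single_one)

lemma pm_scale_eq: "pm_scale c u = Poly_Mapping.single 0 c * (u :: 'k::field ncpoly)"
proof -
  have "pm_scale c u = (\<Sum>x\<in>Poly_Mapping.keys u. Poly_Mapping.single x (c * Poly_Mapping.lookup u x))"
    by (rule poly_mapping_eqI)
      (auto simp: lookup_sum lookup_single when_def in_keys_iff if_distrib cong: if_cong)
  also have "\<dots> = Poly_Mapping.single 0 c * (\<Sum>x\<in>Poly_Mapping.keys u. pm_scale (Poly_Mapping.lookup u x) (word x))"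
    unfolding sum_distrib_left
    by (rule sum.cong)
      (auto simp: pm_scale_def word_def map_single mult_single)
  finally show ?thesis by (simp flip: pm_expand)
qed

lemma pm_scale_mult_left: "pm_scale c u * v = pm_scale c (u * v :: 'k::field ncpoly)"
  by (simp add: pm_scale_eq mult.assoc)

lemma pm_scale_mult_right: "u * pm_scale c v = pm_scale c (u * v :: 'k::field ncpoly)"
proof -
  have "Poly_Mapping.single 0 c * u = u * Poly_Mapping.single 0 c" for u :: "'k ncpoly"
    by (subst (1 2) pm_expand)
      (auto simp: sum_distrib_left sum_distrib_right pm_scale_def word_def map_single mult_single mult.commute)
  then have "u * (Poly_Mapping.single 0 c * v) = Poly_Mapping.single 0 c * (u * v)"
    by (metis mult.assoc)
  then show ?thesis by (simp add: pm_scale_eq)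
qed

lemma subst_mult: "subst x y (u * v) = subst x y u * subst x y v"
proof -
  interpret l: Vector_Spaces.linear pm_scale pm_scale "subst x y" by (rule linear_subst)
  let ?L = "Poly_Mapping.lookup"
  have "u * v = (\<Sum>i\<in>Poly_Mapping.keys u. \<Sum>j\<in>Poly_Mapping.keys v.
      pm_scale (?L u i * ?L v j) (word (i @ j)))"
    by (subst (1) pm_expand[of u], subst (1) pm_expand[of v])
      (simp add: sum_product pm_scale_mult_left pm_scale_mult_right word_append mult.commute)
  moreover have "subst x y u * subst x y v = (\<Sum>i\<in>Poly_Mapping.keys u. \<Sum>j\<in>Poly_Mapping.keys v.
      pm_scale (?L u i * ?L v j) (subst x y (word i) * subst x y (word j)))"
    by (subst (1) pm_expand[of u], subst (1) pm_expand[of v])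
      (simp add: l.sum l.scale sum_product pm_scale_mult_left pm_scale_mult_right mult.commute)
  ultimately show ?thesis
    by (simp add: l.sum l.scale subst_word)
qed

lemma subst_1: "subst x y 1 = 1"
  by (simp flip: word_Nil add: subst_word)

lemma subst_var [simp]: "subst x y var_a = x" "subst x y var_b = y"
  by (simp_all add: var_a_def var_b_def subst_word)

lemma subst_diff: "subst x y (u - v) = subst x y u - subst x y v"
proof -
  interpret l: Vector_Spaces.linear pm_scale pm_scale "subst x y" by (rule linear_subst)
  show ?thesis by (rule l.diff)
qed

lemma subst_add: "subst x y (u + v) = subst x y u + subst x y v"
proof -
  interpret l: Vector_Spaces.linear pm_scale pm_scale "subst x y" by (rule linear_subst)
  show ?thesis by (rule l.add)
qed

lemma subst_power: "subst x y (u ^ n) = subst x y u ^ n"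
  by (induction n) (auto simp: subst_1 subst_mult)

lemma subst_prod_list: "subst x y (prod_list us) = prod_list (map (subst x y) us)"
  by (induction us) (auto simp: subst_1 subst_mult)

lemma subst_subst:
  "subst x y (subst x' y' u) = subst (subst x y x') (subst x y y') u"
proof -
  interpret l: Vector_Spaces.linear pm_scale pm_scale "subst x y" by (rule linear_subst)
  interpret l': Vector_Spaces.linear pm_scale pm_scale "subst x' y'" by (rule linear_subst)
  interpret l'': Vector_Spaces.linear pm_scale pm_scale "subst (subst x y x') (subst x y y')"
    by (rule linear_subst)
  have "subst x y (subst x' y' (word w)) = subst (subst x y x') (subst x y y') (word w)" for w
    by (auto simp: subst_word subst_prod_list o_def intro!: arg_cong[where f = prod_list] split: letter.split)
  then show ?thesis
    by (subst (1 2) pm_expand[of u]) (simp add: l.sum l'.sum l''.sum l.scale l'.scale l''.scale)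
qed

lemma subst_id: "subst var_a var_b u = u"
proof -
  interpret l: Vector_Spaces.linear pm_scale pm_scale "subst var_a var_b :: 'a ncpoly \<Rightarrow> _"
    by (rule linear_subst)
  have "subst var_a var_b (word w) = (word w :: 'a ncpoly)" for w
  proof (induction w)
    case (Cons x w)
    then show ?case
      using word_append[of "[x]" w, where ?'k = 'a]
      unfolding var_a_def var_b_def subst_word by (cases x) simp_all
  qed (simp add: word_Nil subst_1)
  then show ?thesis
    by (subst (1 2) pm_expand[of u]) (simp add: l.sum l.scale)
qed

lemma word_replicate_La: "word (replicate n La) = (var_a ^ n :: 'k::field ncpoly)"
proof (induction n)
  case (Suc n)
  then show ?case using word_append[of "[La]" "replicate n La", where ?'k = 'k] by (simp add: var_a_def)
qed (simp add: word_Nil)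

lemma word_encode:
  "word (encode p ps) = (var_a ^ p * (\<Prod>q\<leftarrow>ps. var_b * var_a ^ (q - 1)) :: 'k::field ncpoly)"
proof -
  have "word (concat (map (\<lambda>q. Lb # replicate (q - 1) La) ps)) =
      (\<Prod>q\<leftarrow>ps. var_b * var_a ^ (q - 1) :: 'k ncpoly)"
  proof (induction ps)
    case (Cons q ps)
    have "word (Lb # replicate (q - Suc 0) La) = (var_b * var_a ^ (q - 1) :: 'k ncpoly)"
      using word_append[of "[Lb]" "replicate (q - 1) La", where ?'k = 'k] by (simp add: var_b_def word_replicate_La)
    then show ?case using Cons
      using word_append[of "Lb # replicate (q - Suc 0) La"
          "concat (map (\<lambda>q. Lb # replicate (q - 1) La) ps)", where ?'k = 'k] by simp
  qed (simp add: word_Nil)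
  then show ?thesis by (simp add: encode_def word_append word_replicate_La)
qed

abbreviation (input) "to_cb \<equiv> subst (var_a + var_b) var_b"
abbreviation (input) "from_cb \<equiv> subst (var_a - var_b) var_b"

lemma to_from: "to_cb (from_cb u) = u" "from_cb (to_cb u) = u"
  by (simp_all add: subst_subst subst_add subst_diff subst_id)

lemma from_cb_encode: "from_cb (word (encode p ps)) = ab_basis p ps"
  by (simp add: word_encode ab_basis_def subst_mult subst_power subst_prod_list o_def)

lemma to_cb_ab_basis: "to_cb (ab_basis p ps) = word (encode p ps)"
  by (simp flip: from_cb_encode add: to_from)

definition word_map :: "'k::field ncpoly \<Rightarrow> 'k bqsym"
  where "word_map = lin_ext bq_scale (\<lambda>w. s_qmonomial (fst (decode w)) (snd (decode w)))"

lemma linear_word_map: "Vector_Spaces.linear pm_scale bq_scale word_map"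
  unfolding word_map_def by (rule lin_ext_linear) (rule bq.vector_space_axioms)

lemma word_map_word: "word_map (word w) = s_qmonomial (fst (decode w)) (snd (decode w))"
  unfolding word_map_def by (rule lin_ext_word) (rule bq.vector_space_axioms)

lemma is_gamma_B_word_map: "is_gamma_B (word_map \<circ> to_cb)"
  unfolding is_gamma_B_def
  by (auto simp: to_cb_ab_basis word_map_word decode_encode
      intro!: Vector_Spaces.linear_compose linear_subst linear_word_map)

lemma is_gamma_B_unique:
  assumes "is_gamma_B \<gamma>"
  shows "\<gamma> = word_map \<circ> to_cb"
proof
  fix u
  interpret l: Vector_Spaces.linear pm_scale bq_scale \<gamma>
    using assms by (simp add: is_gamma_B_def)
  interpret f: Vector_Spaces.linear pm_scale pm_scale "from_cb :: 'a ncpoly \<Rightarrow> _" by (rule linear_subst)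
  interpret m: Vector_Spaces.linear pm_scale bq_scale "word_map :: 'a ncpoly \<Rightarrow> _" by (rule linear_word_map)
  have w: "\<gamma> (from_cb (word w)) = word_map (word w)" for w
    using assms from_cb_encode[of "fst (decode w)" "snd (decode w)", where ?'a = 'a]
    by (simp add: encode_decode is_gamma_B_def word_map_word pos_list_decode del: One_nat_def)
  have "\<gamma> (from_cb v) = word_map v" for v
    by (subst (1 2) pm_expand[of v]) (simp add: l.sum l.scale f.sum f.scale m.sum m.scale w)
  from this[of "to_cb u"] show "\<gamma> u = (word_map \<circ> to_cb) u" by (simp add: to_from)
qed

lemma gamma_B_eq: "gamma_B = word_map \<circ> to_cb"
  unfolding gamma_B_def using is_gamma_B_word_map is_gamma_B_unique by (rule the_equality)

lemma is_gamma_B_gamma_B: "is_gamma_B gamma_B"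
  by (simp add: gamma_B_eq is_gamma_B_word_map)

lemma qcoeff_0 [simp]: "qcoeff 0 m = 0" by transfer simp
lemma qcoeff_add [simp]: "qcoeff (f + h) m = qcoeff f m + qcoeff h m" by transfer simp
lemma qcoeff_sum: "qcoeff (\<Sum>x\<in>S. f x) m = (\<Sum>x\<in>S. qcoeff (f x) m)"
  by (induction S rule: infinite_finite_induct) auto

lemma qsym_eqI:
  assumes "\<And>ps. pos_list ps \<Longrightarrow> qcoeff f (expo [0..<length ps] ps) = qcoeff h (expo [0..<length ps] ps)"
  shows "f = h"
proof (rule qcoeff_inject[THEN iffD1], rule ext)
  fix m
  obtain "is" ps where *: "sorted_wrt (<) is" "length is = length ps" "pos_list ps" "m = expo is ps"
    by (rule expo_exhaust)
  have "qcoeff f m = qcoeff f (expo [0..<length ps] ps)" for f :: "'a qsym"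
    unfolding *(4) by (rule is_qsym_eq) (use qcoeff[of f] * in auto)
  with assms[OF *(3)] show "qcoeff f m = qcoeff h m" by simp
qed

lemma qsym_expand:
  fixes f :: "'k::field qsym"
  obtains S where "finite S" "\<forall>ps\<in>S. pos_list ps"
    "f = (\<Sum>ps\<in>S. qconst (qcoeff f (expo [0..<length ps] ps)) * qmonomial ps)"
proof -
  obtain d where d: "\<And>m. qcoeff f m \<noteq> 0 \<Longrightarrow> total_degree m \<le> d"
    using qcoeff[of f] by (auto simp: is_qsym_def)
  define S where "S = {ps. pos_list ps \<and> sum_list ps \<le> d}"
  have len: "length ps \<le> sum_list ps" if "pos_list ps" for ps
    using that by (induction ps) (auto simp: pos_list_def)
  have "S \<subseteq> {ps. set ps \<subseteq> {..d} \<and> length ps \<le> d}"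
    using len by (auto simp: S_def dest: member_le_sum_list intro: order_trans)
  then have fin: "finite S"
    by (rule finite_subset) (simp add: finite_lists_length_le)
  have "f = (\<Sum>ps\<in>S. qconst (qcoeff f (expo [0..<length ps] ps)) * qmonomial ps)"
  proof (rule qsym_eqI)
    fix qs assume q: "pos_list qs"
    have "qcoeff (\<Sum>ps\<in>S. qconst (qcoeff f (expo [0..<length ps] ps)) * qmonomial ps) (expo [0..<length qs] qs)
      = (\<Sum>ps\<in>S. if ps = qs then qcoeff f (expo [0..<length qs] qs) else 0)"
      unfolding qcoeff_sum qcoeff_qconst_mult
      by (rule sum.cong) (auto simp: qcoeff_qmonomial_expo q S_def)
    also have "\<dots> = qcoeff f (expo [0..<length qs] qs)"
      using d[of "expo [0..<length qs] qs"] q fin by (auto simp: S_def total_degree_expo)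
    finally show "qcoeff f (expo [0..<length qs] qs) = qcoeff (\<Sum>ps\<in>S. qconst (qcoeff f (expo [0..<length ps] ps)) * qmonomial ps) (expo [0..<length qs] qs)" ..
  qed
  then show ?thesis using fin by (intro that[of S]) (auto simp: S_def)
qed

lemma bij_word_map: "bij (word_map :: 'k::field ncpoly \<Rightarrow> _)"
proof -
  interpret m: Vector_Spaces.linear pm_scale bq_scale "word_map :: 'k ncpoly \<Rightarrow> _" by (rule linear_word_map)
  have coord: "qcoeff (coeff (word_map u) p) (expo [0..<length ps] ps) =
      Poly_Mapping.lookup u (encode p ps)" if ps: "pos_list ps" for u :: "'k ncpoly" and p ps
  proof -
    have w: "qcoeff (coeff (word_map (word w :: 'k ncpoly)) p) (expo [0..<length ps] ps) =
        (if w = encode p ps then 1 else 0)" for w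
    proof -
      have "w = encode p ps \<longleftrightarrow> fst (decode w) = p \<and> snd (decode w) = ps"
        using ps encode_decode[of w] decode_encode[of ps p] by auto
      then show ?thesis
        by (auto simp: word_map_word s_qmonomial_def qcoeff_qmonomial_expo ps pos_list_decode)
    qed
    have "qcoeff (coeff (word_map u) p) (expo [0..<length ps] ps) =
      (\<Sum>w\<in>Poly_Mapping.keys u. if w = encode p ps then Poly_Mapping.lookup u w else 0)"
      by (subst pm_expand[of u])
        (simp add: m.sum m.scale coeff_sum qcoeff_sum bq_scale_def qcoeff_qconst_mult w if_distrib cong: if_cong)
    also have "\<dots> = Poly_Mapping.lookup u (encode p ps)"
      by (simp add: in_keys_iff)
    finally show ?thesis .
  qed
  have "inj (word_map :: 'k ncpoly \<Rightarrow> _)"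
  proof (rule injI, rule poly_mapping_eqI)
    fix u v :: "'k ncpoly" and w assume "word_map u = word_map v"
    then show "Poly_Mapping.lookup u w = Poly_Mapping.lookup v w"
      using coord[OF pos_list_decode[of w], of u "fst (decode w)"]
        coord[OF pos_list_decode[of w], of v "fst (decode w)"] by (simp add: encode_decode)
  qed
  moreover have "f \<in> range word_map" for f :: "'k bqsym"
  proof -
    have rng: "bq.subspace (range (word_map :: 'k ncpoly \<Rightarrow> _))"
      by (rule m.subspace_image[OF pm.subspace_UNIV])
    have 1: "monom (qmonomial ps) p \<in> range (word_map :: 'k ncpoly \<Rightarrow> _)" if "pos_list ps" for p ps
      using word_map_word[of "encode p ps", where ?'a = 'k] that
      by (auto simp: decode_encode s_qmonomial_def intro!: range_eqI[OF sym])
    have 2: "monom h p \<in> range (word_map :: 'k ncpoly \<Rightarrow> _)" for h p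
    proof -
      obtain S where S: "finite S" "\<forall>ps\<in>S. pos_list ps"
        "h = (\<Sum>ps\<in>S. qconst (qcoeff h (expo [0..<length ps] ps)) * qmonomial ps)"
        by (rule qsym_expand)
      have "monom h p = (\<Sum>ps\<in>S. bq_scale (qcoeff h (expo [0..<length ps] ps)) (monom (qmonomial ps) p))"
        by (subst S(3)) (simp add: monom_sum bq_scale_def smult_monom)
      then show ?thesis
        using S(2) by (auto intro!: bq.subspace_sum[OF rng] bq.subspace_scale[OF rng] 1)
    qed
    have "f = (\<Sum>p\<le>Polynomial.degree f. monom (coeff f p) p)"
      by (simp add: poly_as_sum_of_monoms)
    then show ?thesis
      using bq.subspace_sum[OF rng, of "{..Polynomial.degree f}" "\<lambda>p. monom (coeff f p) p"] 2 by metis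
  qed
  ultimately show ?thesis by (auto simp: bij_def)
qed

lemma bij_gamma_B: "bij gamma_B"
proof -
  have "bij to_cb" by (rule o_bij[of from_cb]) (auto simp: to_from)
  then show ?thesis unfolding gamma_B_eq using bij_word_map by (rule bij_comp)
qed

section \<open>The chain map on type B quasisymmetric functions\<close>

definition bq_chain_map :: "('k::field ncpoly \<Rightarrow> 'k) \<Rightarrow> 'k bqsym \<Rightarrow> 'k bqsym"
  where "bq_chain_map G f = gamma_B (chain_map G (inv gamma_B f))"

definition algebra_hom ::
    "('k::field \<Rightarrow> 'a \<Rightarrow> 'a) \<Rightarrow> ('k \<Rightarrow> 'b \<Rightarrow> 'b) \<Rightarrow> ('a::ring_1 \<Rightarrow> 'b::ring_1) \<Rightarrow> bool"
  where "algebra_hom s1 s2 f \<longleftrightarrow>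
    Vector_Spaces.linear s1 s2 f \<and> f 1 = 1 \<and> (\<forall>x y. f (x * y) = f x * f y)"

end

theory Submission
  imports Defs
begin

text \<open>
  Write \<open>c = a - b\<close>. Since \<open>\<Delta>(c) = 0\<close> and \<open>\<Delta>(b) = 1 \<otimes> 1\<close>, the coproduct of a monomial in \<open>c\<close> and
  \<open>b\<close> cuts it at its letters \<open>b\<close>. In \<open>\<Delta>\<^sup>k\<close>, the factor \<open>\<kappa>\<close> kills every first part that contains a \<open>b\<close>.
  So \<open>g\<close> fixes the initial power of \<open>c\<close>, that is the power of \<open>s\<close>, and it acts on the remaining
  composition \<open>\<alpha>\<close> by cutting it in all ways into consecutive nonempty blocks, weighting each block
  by its value under \<open>G\<close> and replacing it by its sum (\<open>chain_product_ab_basis\<close>). On \<open>k[s] \<otimes> QSym\<close> it is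
  therefore \<open>id \<otimes> h\<close>, and the coefficient of \<open>h(F)\<close> at the exponents \<open>q\<^sub>1, \<dots>, q\<^sub>l\<close> is obtained from \<open>F\<close> by
  applying \<open>\<phi>\<^sub>q\<^sub>1 \<otimes> \<dots> \<otimes> \<phi>\<^sub>q\<^sub>l\<close> to its deconcatenation, where \<open>\<phi>\<^sub>q\<close> is the functional that \<open>G\<close>
  induces on the part of degree \<open>q\<close> (\<open>qcoeffs_coeff_bq_chain_map\<close>).

  Quasisymmetric functions are handled through their coefficients, indexed by lists of exponents in
  which zeros are allowed and have no effect. With zeros allowed, the coefficient of a product at a
  list \<open>q\<close> is the sum over all entrywise splittings \<open>q = x + y\<close>, and no quasi-shuffles appear. This
  rule also makes \<open>h\<close> multiplicative as soon as \<open>\<phi>\<close> is: splitting a concatenation means splitting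
  both pieces, so one block after the other can be peeled off (\<open>block_sum_conv\<close>).

  It remains to see that \<open>\<phi>\<close> is multiplicative (\<open>graded_value_conv\<close>). As a quasisymmetric function,
  the ab-index of \<open>P\<close> has as its coefficient at \<open>q\<close> the number of multichains from bottom to top with
  rank steps \<open>q\<close>. A multichain in \<open>P \<times> Q\<close> is a pair of multichains whose rank steps add up to \<open>q\<close>, so the
  Cartesian product of posets becomes the product of quasisymmetric functions, and the hypothesis on
  \<open>G\<close> is multiplicativity of \<open>\<phi>\<close> on ab-indices. These span everything, over every field: a poset
  consisting of levels of one or two elements, in which lower levels lie entirely below higher ones,
  has as its ab-index a product of factors \<open>a\<close> and \<open>a + b\<close>, and \<open>b = (a + b) - a\<close>.
\<close>

section \<open>Entrywise splittings of exponent lists\<close>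

text \<open>The sum of \<open>F xs ys\<close> over all entrywise decompositions \<open>qs = xs + ys\<close>. The recursive form makes
  the compatibility with concatenation immediate; the explicit form is \<open>split_sum_eq\<close>.\<close>

primrec split_sum :: "(nat list \<Rightarrow> nat list \<Rightarrow> 'v::comm_monoid_add) \<Rightarrow> nat list \<Rightarrow> 'v" where
  "split_sum F [] = F [] []"
| "split_sum F (q # qs) = (\<Sum>i\<le>q. split_sum (\<lambda>xs ys. F (i # xs) ((q - i) # ys)) qs)"

definition conv :: "(nat list \<Rightarrow> 'k::comm_ring_1) \<Rightarrow> (nat list \<Rightarrow> 'k) \<Rightarrow> nat list \<Rightarrow> 'k"
  where "conv f g qs = split_sum (\<lambda>xs ys. f xs * g ys) qs"

lemma split_sum_cong:
  assumes "\<And>xs ys. length xs = length qs \<Longrightarrow> length ys = length qs \<Longrightarrow>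
    sum_list xs + sum_list ys = sum_list qs \<Longrightarrow> F xs ys = F' xs ys"
  shows "split_sum F qs = split_sum F' qs"
  using assms
proof (induction qs arbitrary: F F')
  case (Cons q qs)
  have "split_sum (\<lambda>xs ys. F (i # xs) ((q - i) # ys)) qs =
      split_sum (\<lambda>xs ys. F' (i # xs) ((q - i) # ys)) qs" if "i \<le> q" for i
    by (rule Cons.IH, rule Cons.prems) (use that in simp_all)
  then show ?case by simp
qed simp

lemma split_sum_0: "split_sum (\<lambda>xs ys. 0) qs = 0"
  by (induction qs) simp_all

lemma split_sum_sum:
  "split_sum (\<lambda>xs ys. \<Sum>i\<in>I. F i xs ys) qs = (\<Sum>i\<in>I. split_sum (F i) qs)"
proof (induction qs arbitrary: F)
  case (Cons q qs)
  have "split_sum (\<lambda>xs ys. \<Sum>i\<in>I. F i xs ys) (q # qs) =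
      (\<Sum>j\<le>q. \<Sum>i\<in>I. split_sum (\<lambda>xs ys. F i (j # xs) ((q - j) # ys)) qs)"
    by (simp add: Cons)
  also have "\<dots> = (\<Sum>i\<in>I. split_sum (F i) (q # qs))"
    by (subst sum.swap) simp
  finally show ?case .
qed simp

lemma split_sum_mult_left:
  "split_sum (\<lambda>xs ys. (c::'k::comm_ring_1) * F xs ys) qs = c * split_sum F qs"
  by (induction qs arbitrary: F) (simp_all add: sum_distrib_left)

text \<open>A splitting of a concatenation is a pair of splittings. This is all that remains of the
  compatibility of product and deconcatenation in \<open>QSym\<close>.\<close>

lemma split_sum_append:
  "split_sum F (qs @ rs) = split_sum (\<lambda>xs ys. split_sum (\<lambda>xs' ys'. F (xs @ xs') (ys @ ys')) rs) qs"
  by (induction qs arbitrary: F) simp_all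

lemma split_sum_swap:
  "split_sum (\<lambda>xs ys. split_sum (\<lambda>xs' ys'. F xs ys xs' ys') rs) qs =
   split_sum (\<lambda>xs' ys'. split_sum (\<lambda>xs ys. F xs ys xs' ys') qs) rs"
  by (induction qs arbitrary: F) (simp_all add: split_sum_sum)

lemma split_sum_eq:
  "split_sum F qs = (\<Sum>(xs, ys)\<in>{(xs, ys). length xs = length qs \<and> length ys = length qs \<and>
     map2 (+) xs ys = qs}. F xs ys)"
proof (induction qs arbitrary: F)
  case Nil
  have *: "{(xs, ys). length xs = length [] \<and> length ys = length [] \<and> map2 (+) xs ys = []} = {([], [])}"
    by auto
  show ?case unfolding * by simp
next
  case (Cons q qs)
  let ?S = "\<lambda>qs. {(xs, ys). length xs = length qs \<and> length ys = length qs \<and> map2 (+) xs ys = qs}"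
  have fin: "finite (?S qs)"
  proof (rule finite_subset)
    have le: "set xs \<subseteq> {..sum_list qs}" if "sum_list xs \<le> sum_list qs" for xs :: "nat list"
      using that member_le_sum_list[of _ xs] by fastforce
    have "set xs \<subseteq> {..sum_list qs} \<and> set ys \<subseteq> {..sum_list qs}"
      if "length xs = length qs" "length ys = length qs" "map2 (+) xs ys = qs" for xs ys
    proof -
      have "sum_list (map2 (+) xs ys) = sum_list xs + sum_list ys" if "length xs = length ys"
        using that by (induction xs ys rule: list_induct2) auto
      with that have "sum_list xs \<le> sum_list qs" "sum_list ys \<le> sum_list qs" by auto
      then show ?thesis using le by simp
    qed
    then show "?S qs \<subseteq> {xs. set xs \<subseteq> {..sum_list qs} \<and> length xs = length qs} \<times>
        {xs. set xs \<subseteq> {..sum_list qs} \<and> length xs = length qs}" by blast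
  qed (simp add: finite_lists_length_eq)
  have "split_sum F (q # qs) = (\<Sum>i\<le>q. \<Sum>z\<in>?S qs. F (i # fst z) ((q - i) # snd z))"
    by (simp add: Cons case_prod_unfold)
  also have "\<dots> = (\<Sum>(i, z)\<in>{..q} \<times> ?S qs. F (i # fst z) ((q - i) # snd z))"
    by (rule sum.cartesian_product)
  also have "\<dots> = (\<Sum>(xs, ys)\<in>?S (q # qs). F xs ys)"
  proof (rule sum.reindex_bij_witness[where j = "\<lambda>(i, z). (i # fst z, (q - i) # snd z)"
          and i = "\<lambda>(xs, ys). (hd xs, tl xs, tl ys)"], goal_cases)
    case (2 a)
    then show ?case by (simp add: case_prod_unfold mem_Times_iff)
  next
    case (3 b)
    obtain xs ys where b: "b = (xs, ys)" by force
    show ?case using 3 by (cases xs; cases ys) (simp_all add: b, linarith)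
  next
    case (4 b)
    obtain xs ys where b: "b = (xs, ys)" by force
    show ?case using 4 by (cases xs; cases ys) (simp_all add: b)
  qed (simp_all add: case_prod_unfold)
  finally show ?case .
qed

section \<open>Coefficients of quasisymmetric functions\<close>

definition drop_zeros :: "nat list \<Rightarrow> nat list"
  where "drop_zeros = filter (\<lambda>p. 0 < p)"

lemma drop_zeros_simps [simp]: "drop_zeros [] = []" "drop_zeros (0 # qs) = drop_zeros qs" "0 < q \<Longrightarrow> drop_zeros (q # qs) = q # drop_zeros qs"
  "drop_zeros (qs @ rs) = drop_zeros qs @ drop_zeros rs" "drop_zeros (drop_zeros qs) = drop_zeros qs"
  by (simp_all add: drop_zeros_def)

lemma pos_list_simps [simp]: "pos_list []" "pos_list (p # ps) \<longleftrightarrow> 0 < p \<and> pos_list ps"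
  "pos_list (ps @ qs) \<longleftrightarrow> pos_list ps \<and> pos_list qs"
  by (auto simp: pos_list_def)

lemma pos_list_drop_zeros [simp]: "pos_list (drop_zeros qs)"
  by (auto simp: drop_zeros_def pos_list_def)

lemma drop_zeros_pos: "pos_list qs \<Longrightarrow> drop_zeros qs = qs"
  by (induction qs) auto

lemma sum_list_drop_zeros [simp]: "sum_list (drop_zeros qs) = sum_list qs"
  by (induction qs) (auto simp: drop_zeros_def)

lemma pos_list_take: "pos_list ps \<Longrightarrow> pos_list (take n ps)"
  and pos_list_drop: "pos_list ps \<Longrightarrow> pos_list (drop n ps)"
  by (auto simp: pos_list_def dest: in_set_takeD in_set_dropD)

lemma length_le_sum_list: "pos_list ps \<Longrightarrow> length ps \<le> sum_list ps"
  by (induction ps) auto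

definition zero_invariant :: "(nat list \<Rightarrow> 'k) \<Rightarrow> bool"
  where "zero_invariant f \<longleftrightarrow> (\<forall>qs. f (drop_zeros qs) = f qs)"

lemma zero_invariantD: "zero_invariant f \<Longrightarrow> f (drop_zeros qs) = f qs"
  by (simp add: zero_invariant_def)

text \<open>Reading off coefficients at the first variables, with zero exponents allowed, determines a
  quasisymmetric function and turns its product into \<open>conv\<close>.\<close>

definition qcoeffs :: "'k::zero qsym \<Rightarrow> nat list \<Rightarrow> 'k"
  where "qcoeffs F qs = qcoeff F (expo [0..<length qs] qs)"

lemma qcoeffs_eqI: "(\<And>qs. pos_list qs \<Longrightarrow> qcoeffs F qs = qcoeffs H qs) \<Longrightarrow> F = H"
  for F H :: "'k::field qsym"
  by (rule qsym_eqI) (simp add: qcoeffs_def)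

lemma zero_invariant_qcoeffs: "zero_invariant (qcoeffs F)"
  unfolding zero_invariant_def
proof
  fix qs :: "nat list"
  let ?z = "filter (\<lambda>z. 1 \<le> snd z) (zip [0..<length qs] qs)"
  have "sorted_wrt (\<lambda>x y. fst x < fst y) (zip [0..<length qs] qs)"
    by (subst sorted_wrt_map[symmetric]) simp
  then have 1: "sorted_wrt (<) (map fst ?z)" by (simp add: sorted_wrt_map sorted_wrt_filter)
  have "length (filter (\<lambda>z. 1 \<le> snd z) (zip is qs)) = length (filter (\<lambda>p. 1 \<le> p) qs)"
    if "length is = length qs" for "is" :: "nat list"
    using that by (induction "is" qs rule: list_induct2) auto
  then have 2: "length (map fst ?z) = length (drop_zeros qs)" by (simp add: drop_zeros_def Suc_le_eq)
  have "qcoeff F (expo [0..<length qs] qs) = qcoeff F (expo (map fst ?z) (drop_zeros qs))"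
    using arg_cong[OF expo_filter[of "[0..<length qs]" qs], of "qcoeff F"]
    by (simp add: drop_zeros_def Suc_le_eq)
  also have "\<dots> = qcoeff F (expo [0..<length (drop_zeros qs)] (drop_zeros qs))"
    by (rule is_qsym_eq) (use qcoeff[of F] 1 2 in auto)
  finally show "qcoeffs F (drop_zeros qs) = qcoeffs F qs" by (simp add: qcoeffs_def)
qed

lemma qcoeffs_mult: "qcoeffs (F * H) qs = conv (qcoeffs F) (qcoeffs H) qs"
  unfolding qcoeffs_def conv_def split_sum_eq times_qsym.rep_eq
  using ps_mult_expo[of "[0..<length qs]" qs "qcoeff F" "qcoeff H"]
  by (auto intro!: sum.cong simp: case_prod_unfold)

lemma qcoeffs_sum: "qcoeffs (\<Sum>i\<in>I. F i) qs = (\<Sum>i\<in>I. qcoeffs (F i) qs)" for F :: "_ \<Rightarrow> 'k::field qsym"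
  by (simp add: qcoeffs_def qcoeff_sum)

definition monomial_coeffs :: "nat list \<Rightarrow> nat list \<Rightarrow> 'k::comm_ring_1"
  where "monomial_coeffs ps qs = (if drop_zeros qs = ps then 1 else 0)"

lemma qcoeffs_qmonomial:
  assumes "pos_list ps" shows "qcoeffs (qmonomial ps :: 'k::field qsym) = monomial_coeffs ps"
proof
  fix qs
  have "qcoeffs (qmonomial ps :: 'k qsym) (drop_zeros qs) = monomial_coeffs ps qs"
    using assms by (auto simp: qcoeffs_def qcoeff_qmonomial_expo monomial_coeffs_def)
  then show "qcoeffs (qmonomial ps :: 'k qsym) qs = monomial_coeffs ps qs"
    by (simp add: zero_invariantD[OF zero_invariant_qcoeffs])
qed

lemma qmonomial_Nil: "qmonomial [] = (1 :: 'k::field qsym)"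
proof (rule qsym_eqI)
  fix ps assume p: "pos_list ps"
  have "expo [0..<length ps] ps = 0 \<longleftrightarrow> ps = []"
    using expo_inject[of "[0..<length ps]" ps "[]" "[]"] p by auto
  then show "qcoeff (qmonomial []) (expo [0..<length ps] ps) = qcoeff (1 :: 'k qsym) (expo [0..<length ps] ps)"
    using p by (simp add: qcoeff_qmonomial one_qsym.rep_eq)
qed

text \<open>The coefficients of the unit are supported on the lists of zeros, so only the splitting that
  gives every entry to the other factor contributes.\<close>

lemma conv_monomial_coeffs_Nil: "conv (monomial_coeffs []) f qs = f qs" "conv f (monomial_coeffs []) qs = f qs"
proof -
  have "monomial_coeffs [] (i # xs) = (if i = 0 then monomial_coeffs [] xs else (0::'a))" for i xs
    by (auto simp: monomial_coeffs_def drop_zeros_def)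
  then have *: "monomial_coeffs [] (i # xs) * (z::'a) = (if i = 0 then monomial_coeffs [] xs * z else 0)"
    "z * monomial_coeffs [] (i # xs) = (if i = 0 then z * monomial_coeffs [] xs else 0)" for i xs z
    by auto
  have if_split: "split_sum (\<lambda>xs ys. if P then F xs ys else (0::'a)) qs =
      (if P then split_sum F qs else 0)" for P F qs
    by (simp add: split_sum_0)
  show "conv (monomial_coeffs []) f qs = f qs"
  proof (induction qs arbitrary: f)
    case Nil show ?case by (simp add: conv_def monomial_coeffs_def)
  next
    case (Cons q qs)
    from Cons[of "\<lambda>xs. f (q # xs)"] show ?case
      by (simp add: conv_def * if_split)
  qed
  show "conv f (monomial_coeffs []) qs = f qs"
  proof (induction qs arbitrary: f)
    case Nil show ?case by (simp add: conv_def monomial_coeffs_def)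
  next
    case (Cons q qs)
    have "(q - i = 0) = (i = q)" if "i \<le> q" for i using that by auto
    then have "(\<Sum>i\<le>q. if q - i = 0 then split_sum (\<lambda>xs ys. f (i # xs) * monomial_coeffs [] ys) qs else 0)
      = (\<Sum>i\<le>q. if i = q then split_sum (\<lambda>xs ys. f (i # xs) * monomial_coeffs [] ys) qs else 0)"
      by (intro sum.cong) auto
    with Cons[of "\<lambda>xs. f (q # xs)"] show ?case
      by (simp add: conv_def * if_split del: diff_is_0_eq)
  qed
qed

section \<open>Graded posets and their products\<close>

lemma ltD: "lt P x y \<Longrightarrow> (x, y) \<in> P" "lt P x y \<Longrightarrow> x \<noteq> y"
    "lt P x y \<Longrightarrow> x \<in> Field P" "lt P x y \<Longrightarrow> y \<in> Field P"
  by (auto simp: lt_def intro: FieldI1 FieldI2)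

lemma partial_orderD:
  assumes "Partial_order P"
  shows "x \<in> Field P \<Longrightarrow> (x, x) \<in> P" "(x, y) \<in> P \<Longrightarrow> (y, z) \<in> P \<Longrightarrow> (x, z) \<in> P"
    "(x, y) \<in> P \<Longrightarrow> (y, x) \<in> P \<Longrightarrow> x = y"
  using assms unfolding partial_order_on_def preorder_on_def refl_on_def trans_def antisym_def by blast+

lemma lt_trans:
  assumes "Partial_order P" "lt P x y" "lt P y z"
  shows "lt P x z"
  using assms(2,3) partial_orderD[OF assms(1)] unfolding lt_def by metis

lemma lt_irrefl: "\<not> lt P x x"
  by (simp add: lt_def)

lemma bot_elI:
  assumes "Partial_order P" "is_bot P x" shows "bot_el P = x"
  unfolding bot_el_def using assms partial_orderD(3)[OF assms(1)] by (auto simp: is_bot_def)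

lemma top_elI:
  assumes "Partial_order P" "is_top P x" shows "top_el P = x"
  unfolding top_el_def using assms partial_orderD(3)[OF assms(1)] by (auto simp: is_top_def)

text \<open>Refining a strict relation at an intermediate element shrinks both intervals, so induction on
  the size of the open interval reduces to covering relations.\<close>

lemma rank_function_strict_mono:
  assumes fin: "finite (Field P)" and po: "Partial_order P" and r: "is_rank_function P \<rho>"
    and "lt P x y"
  shows "\<rho> x < \<rho> y"
  using \<open>lt P x y\<close>
proof (induction "card {z. lt P x z \<and> lt P z y}" arbitrary: x y rule: less_induct)
  case less
  have fin': "finite {z. lt P x z \<and> lt P z y}" for x y
    by (rule finite_subset[OF _ fin]) (auto dest: ltD)
  show ?case
  proof (cases "covers P y x")
    case True
    then show ?thesis using r by (auto simp: is_rank_function_def)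
  next
    case False
    then obtain z where z: "lt P x z" "lt P z y" using less.prems by (auto simp: covers_def)
    have sub: "{w. lt P x w \<and> lt P w z} \<subset> {w. lt P x w \<and> lt P w y}"
    proof
      show "{w. lt P x w \<and> lt P w z} \<subseteq> {w. lt P x w \<and> lt P w y}"
        using z(2) lt_trans[OF po] by blast
      show "{w. lt P x w \<and> lt P w z} \<noteq> {w. lt P x w \<and> lt P w y}"
        using z lt_irrefl[of P z] by blast
    qed
    have sub': "{w. lt P z w \<and> lt P w y} \<subset> {w. lt P x w \<and> lt P w y}"
    proof
      show "{w. lt P z w \<and> lt P w y} \<subseteq> {w. lt P x w \<and> lt P w y}"
        using z(1) lt_trans[OF po] by blast
      show "{w. lt P z w \<and> lt P w y} \<noteq> {w. lt P x w \<and> lt P w y}"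
        using z lt_irrefl[of P z] by blast
    qed
    have "\<rho> x < \<rho> z" "\<rho> z < \<rho> y"
      using less.hyps[OF psubset_card_mono[OF fin' sub]] less.hyps[OF psubset_card_mono[OF fin' sub']] z
      by blast+
    then show ?thesis by simp
  qed
qed

text \<open>Every element other than the bottom covers some element, namely one of maximal rank below it.
  This fixes the arbitrary choice in \<open>rank_fun\<close>.\<close>

lemma rank_function_unique:
  assumes fin: "finite (Field P)" and po: "Partial_order P" and "\<exists>x. is_bot P x"
    and r: "is_rank_function P \<rho>" and r': "is_rank_function P \<rho>'" and "y \<in> Field P"
  shows "\<rho> y = \<rho>' y"
  using \<open>y \<in> Field P\<close>
proof (induction "\<rho> y" arbitrary: y rule: less_induct)
  case less
  show ?case
  proof (cases "y = bot_el P")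
    case True
    then show ?thesis using r r' by (simp add: is_rank_function_def)
  next
    case False
    let ?S = "{z. lt P z y}"
    obtain x where x: "is_bot P x" using assms(3) by blast
    with False less.prems have "x \<in> ?S" by (auto simp: bot_elI[OF po x] is_bot_def lt_def)
    moreover have finS: "finite ?S" by (rule finite_subset[OF _ fin]) (auto dest: ltD)
    ultimately have "\<exists>z\<in>?S. \<forall>w\<in>?S. \<rho> w \<le> \<rho> z"
      using Max_in[of "\<rho> ` ?S"] Max_ge[of "\<rho> ` ?S"] by fastforce
    then obtain z where z: "lt P z y" "\<And>w. lt P w y \<Longrightarrow> \<rho> w \<le> \<rho> z" by blast
    then have "covers P y z"
      using rank_function_strict_mono[OF fin po r] by (fastforce simp: covers_def)
    moreover have "\<rho> z < \<rho> y" using z(1) by (rule rank_function_strict_mono[OF fin po r])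
    ultimately show ?thesis
      using less.hyps[of z] ltD(3)[OF z(1)] r r' by (auto simp: is_rank_function_def)
  qed
qed

lemma graded_posetD:
  assumes "graded_poset P"
  shows "finite (Field P)" "Partial_order P" "is_bot P (bot_el P)" "is_top P (top_el P)"
    "is_rank_function P (rank_fun P)"
proof -
  show "finite (Field P)" "Partial_order P" using assms by (auto simp: graded_poset_def)
  then show "is_bot P (bot_el P)" "is_top P (top_el P)"
    using assms bot_elI top_elI by (force simp: graded_poset_def)+
  show "is_rank_function P (rank_fun P)"
    unfolding rank_fun_def using assms by (metis graded_poset_def someI_ex)
qed

lemma rank_fun_eq:
  assumes "graded_poset P" "is_rank_function P \<rho>" "x \<in> Field P"
  shows "rank_fun P x = \<rho> x"
  using rank_function_unique[OF graded_posetD(1,2)[OF assms(1)] _ graded_posetD(5)[OF assms(1)] assms(2,3)]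
    graded_posetD(3)[OF assms(1)] by blast

lemma rank_fun_less:
  assumes "graded_poset P" "lt P x y" shows "rank_fun P x < rank_fun P y"
  using rank_function_strict_mono[OF graded_posetD(1,2,5)[OF assms(1)] assms(2)] .

lemma rank_fun_mono:
  assumes "graded_poset P" "(x, y) \<in> P" shows "rank_fun P x \<le> rank_fun P y"
  using rank_fun_less[OF assms(1), of x y] assms(2) by (cases "x = y") (auto simp: lt_def)

lemma bot_le_top:
  assumes "graded_poset P"
  shows "bot_el P \<in> Field P" "top_el P \<in> Field P" "x \<in> Field P \<Longrightarrow> (bot_el P, x) \<in> P"
    "x \<in> Field P \<Longrightarrow> (x, top_el P) \<in> P"
  using graded_posetD(3,4)[OF assms] by (auto simp: is_bot_def is_top_def)

lemma poset_rank_eq: "graded_poset P \<Longrightarrow> poset_rank P = rank_diff P (bot_el P) (top_el P)"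
  using graded_posetD(5)[of P] by (auto simp: poset_rank_def rank_diff_def is_rank_function_def)

lemma Field_poset_prod:
  assumes "Partial_order P" "Partial_order Q"
  shows "Field (poset_prod P Q) = Field P \<times> Field Q"
proof
  show "Field (poset_prod P Q) \<subseteq> Field P \<times> Field Q"
    by (auto simp: poset_prod_def Field_def)
  show "Field P \<times> Field Q \<subseteq> Field (poset_prod P Q)"
  proof clarify
    fix x y assume "x \<in> Field P" "y \<in> Field Q"
    then have "((x, y), (x, y)) \<in> poset_prod P Q"
      using assms by (auto simp: poset_prod_def partial_orderD)
    then show "(x, y) \<in> Field (poset_prod P Q)" by (rule FieldI1)
  qed
qed

text \<open>In a covering pair of the product only one coordinate changes, since otherwise the two
  coordinates could be raised one after the other. Hence the sum of the ranks is a rank function.\<close>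

lemma graded_poset_prod:
  assumes P: "graded_poset P" and Q: "graded_poset Q"
  shows "graded_poset (poset_prod P Q)"
    and "bot_el (poset_prod P Q) = (bot_el P, bot_el Q)"
    and "top_el (poset_prod P Q) = (top_el P, top_el Q)"
    and "x \<in> Field P \<Longrightarrow> y \<in> Field Q \<Longrightarrow>
      rank_fun (poset_prod P Q) (x, y) = rank_fun P x + rank_fun Q y"
proof -
  note p = graded_posetD[OF P] and q = graded_posetD[OF Q]
  note pp = partial_orderD[OF p(2)] and qq = partial_orderD[OF q(2)]
  let ?R = "poset_prod P Q" and ?\<rho> = "\<lambda>(x, y). rank_fun P x + rank_fun Q y"
  note F = Field_poset_prod[OF p(2) q(2)]
  have po: "Partial_order ?R"
    unfolding partial_order_on_def preorder_on_def
  proof (intro conjI)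
    show "Refl ?R" unfolding refl_on_def F by (auto simp: poset_prod_def pp qq)
    show "trans ?R" unfolding trans_def by (auto simp: poset_prod_def intro: pp(2) qq(2))
    show "antisym ?R" unfolding antisym_def by (auto simp: poset_prod_def intro: pp(3) qq(3))
    show "?R \<subseteq> Field ?R \<times> Field ?R" by (auto intro: FieldI1 FieldI2)
  qed
  have bot: "is_bot ?R (bot_el P, bot_el Q)"
    using p(3) q(3) unfolding is_bot_def F by (auto simp: poset_prod_def)
  have top: "is_top ?R (top_el P, top_el Q)"
    using p(4) q(4) unfolding is_top_def F by (auto simp: poset_prod_def)
  show b: "bot_el ?R = (bot_el P, bot_el Q)" and "top_el ?R = (top_el P, top_el Q)"
    using bot_elI[OF po bot] top_elI[OF po top] by simp_all
  have r: "is_rank_function ?R ?\<rho>"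
    unfolding is_rank_function_def b
  proof (intro conjI allI impI)
    show "?\<rho> (bot_el P, bot_el Q) = 0"
      using p(5) q(5) by (simp add: is_rank_function_def)
  next
    fix z z' assume c: "covers ?R z' z"
    obtain x y x' y' where z: "z = (x, y)" "z' = (x', y')" by force
    have le: "(x, x') \<in> P" "(y, y') \<in> Q" "x \<noteq> x' \<or> y \<noteq> y'"
      using c by (auto simp: z covers_def lt_def poset_prod_def)
    have fld: "x \<in> Field P" "x' \<in> Field P" "y \<in> Field Q" "y' \<in> Field Q"
      using le by (auto intro: FieldI1 FieldI2)
    have no: "\<not> (lt ?R (x, y) w \<and> lt ?R w (x', y'))" for w
      using c unfolding z covers_def by blast
    have "x = x' \<or> y = y'"
      using no[of "(x, y')"] le fld by (auto simp: lt_def poset_prod_def pp qq)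
    then show "?\<rho> z' = ?\<rho> z + 1"
    proof
      assume "x = x'"
      then have "covers Q y' y"
        using le no[of "(x, w)" for w] fld by (auto simp: covers_def lt_def poset_prod_def pp qq)
      then show ?thesis using q(5) \<open>x = x'\<close> by (simp add: z is_rank_function_def)
    next
      assume "y = y'"
      then have "covers P x' x"
        using le no[of "(w, y)" for w] fld by (auto simp: covers_def lt_def poset_prod_def pp qq)
      then show ?thesis using p(5) \<open>y = y'\<close> by (simp add: z is_rank_function_def)
    qed
  qed
  show g: "graded_poset ?R"
    unfolding graded_poset_def using finite_cartesian_product[OF p(1) q(1)] po bot top r
    unfolding F[symmetric] by blast
  show "rank_fun ?R (x, y) = rank_fun P x + rank_fun Q y" if "x \<in> Field P" "y \<in> Field Q"
    using rank_fun_eq[OF g r, of "(x, y)"] that by (simp add: F)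
qed

section \<open>Chains and multichains\<close>

definition chains_from :: "'p rel \<Rightarrow> 'p \<Rightarrow> 'p list set"
  where "chains_from P x = {xs. xs \<noteq> [] \<and> set xs \<subseteq> Field P \<and> sorted_wrt (lt P) xs \<and>
    hd xs = x \<and> last xs = top_el P}"

lemma bounded_chains_eq: "bounded_chains P = chains_from P (bot_el P)"
  by (simp add: bounded_chains_def chains_from_def)

fun rank_steps :: "'p rel \<Rightarrow> 'p list \<Rightarrow> nat list" where
  "rank_steps P (x # y # ys) = rank_diff P x y # rank_steps P (y # ys)"
| "rank_steps P _ = []"

context
  fixes P :: "'p rel"
  assumes P: "graded_poset P"
begin

lemma finite_chains_from: "finite (chains_from P x)"
proof -
  have "distinct xs" if "sorted_wrt (lt P) xs" for xs
    using that by (induction xs) (auto dest: ltD)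
  then have "chains_from P x \<subseteq> {xs. set xs \<subseteq> Field P \<and> distinct xs}"
    by (auto simp: chains_from_def)
  then show ?thesis
    by (rule finite_subset) (rule finite_subset_distinct[OF graded_posetD(1)[OF P]])
qed

lemma not_top_lt: "\<not> lt P (top_el P) y"
  using bot_le_top(4)[OF P, of y] partial_orderD(3)[OF graded_posetD(2)[OF P]]
  by (auto simp: lt_def intro: FieldI2)

lemma chains_from_top: "chains_from P (top_el P) = {[top_el P]}"
proof -
  have "xs = [top_el P]" if "xs \<in> chains_from P (top_el P)" for xs
    using that not_top_lt by (cases xs; cases "tl xs") (auto simp: chains_from_def)
  moreover have "[top_el P] \<in> chains_from P (top_el P)"
    using bot_le_top(2)[OF P] by (simp add: chains_from_def)
  ultimately show ?thesis by blast
qed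

lemma Cons_chains_from:
  "lt P x y \<Longrightarrow> ys \<in> chains_from P y \<Longrightarrow> x # ys \<in> chains_from P x"
  using lt_trans[OF graded_posetD(2)[OF P]] ltD(3)[of P x y]
  by (cases ys) (auto simp: chains_from_def)

lemma chains_from_cases:
  assumes "xs \<in> chains_from P x" "x \<noteq> top_el P"
  obtains y ys where "lt P x y" "ys \<in> chains_from P y" "xs = x # ys"
  using assms by (cases xs; cases "tl xs") (auto simp: chains_from_def intro!: that[of "hd (tl xs)" "tl xs"])

lemma sum_chains_from:
  assumes "x \<noteq> top_el P"
  shows "(\<Sum>xs\<in>chains_from P x. f xs) =
    (\<Sum>y | lt P x y. \<Sum>ys\<in>chains_from P y. f (x # ys))"
proof -
  have fin: "finite {y. lt P x y}"
    by (rule finite_subset[OF _ graded_posetD(1)[OF P]]) (auto dest: ltD)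
  have "(\<Sum>y | lt P x y. \<Sum>ys\<in>chains_from P y. f (x # ys)) =
      (\<Sum>(y, ys)\<in>(SIGMA y:{y. lt P x y}. chains_from P y). f (x # ys))"
    by (rule sum.Sigma) (use fin finite_chains_from in auto)
  also have "\<dots> = (\<Sum>xs\<in>chains_from P x. f xs)"
  proof -
    let ?S = "SIGMA y:{y. lt P x y}. chains_from P y"
    have "inj_on (\<lambda>(y, ys). x # ys) ?S"
      by (auto simp: inj_on_def chains_from_def)
    moreover have "(\<lambda>(y, ys). x # ys) ` ?S = chains_from P x"
      using assms Cons_chains_from[of x] chains_from_cases[of _ x] by (force simp: image_iff)
    ultimately show ?thesis
      using sum.reindex[of "\<lambda>(y, ys). x # ys" ?S f] by (simp add: case_prod_unfold)
  qed
  finally show ?thesis ..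
qed

lemma rank_steps_Cons: "ys \<in> chains_from P y \<Longrightarrow> rank_steps P (x # ys) = rank_diff P x y # rank_steps P ys"
  by (cases ys) (auto simp: chains_from_def)

end

text \<open>A step of rank \<open>0\<close> repeats an element. It has to be allowed because a step in a product may
  change one coordinate only.\<close>

primrec count_multichains :: "'p rel \<Rightarrow> nat list \<Rightarrow> 'p \<Rightarrow> 'k::comm_ring_1" where
  "count_multichains P [] x = (if x = top_el P then 1 else 0)"
| "count_multichains P (q # qs) x = (\<Sum>y | (x, y) \<in> P \<and> rank_diff P x y = q. count_multichains P qs y)"

text \<open>The first step of a multichain in the product is a pair of steps, and its rank is the sum of
  theirs.\<close>

lemma count_multichains_prod:
  assumes P: "graded_poset P" and Q: "graded_poset Q" and "x \<in> Field P" "y \<in> Field Q"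
  shows "(count_multichains (poset_prod P Q) qs (x, y) :: 'k::comm_ring_1) =
    conv (\<lambda>qs. count_multichains P qs x) (\<lambda>qs. count_multichains Q qs y) qs"
  using assms(3,4)
proof (induction qs arbitrary: x y)
  case Nil
  show ?case by (simp add: conv_def graded_poset_prod[OF P Q])
next
  case (Cons q qs)
  let ?R = "poset_prod P Q"
  let ?A = "\<lambda>i. {x'. (x, x') \<in> P \<and> rank_diff P x x' = i}"
  let ?B = "\<lambda>i. {y'. (y, y') \<in> Q \<and> rank_diff Q y y' = i}"
  have fin: "finite (?A i)" "finite (?B i)" for i
    by (rule finite_subset[OF _ graded_posetD(1)[OF P]], auto intro: FieldI2)
      (rule finite_subset[OF _ graded_posetD(1)[OF Q]], auto intro: FieldI2)
  have mem: "((x, y), (x', y')) \<in> ?R \<longleftrightarrow> (x, x') \<in> P \<and> (y, y') \<in> Q" for x' y'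
    by (simp add: poset_prod_def)
  have diff: "rank_diff ?R (x, y) (x', y') = rank_diff P x x' + rank_diff Q y y'"
    if "(x, x') \<in> P" "(y, y') \<in> Q" for x' y'
    using that Cons.prems rank_fun_mono[OF P that(1)] rank_fun_mono[OF Q that(2)]
    by (simp add: rank_diff_def graded_poset_prod(4)[OF P Q] FieldI2)
  have "(count_multichains ?R (q # qs) (x, y) :: 'k) =
      (\<Sum>z | ((x, y), z) \<in> ?R \<and> rank_diff ?R (x, y) z = q.
        conv (\<lambda>qs. count_multichains P qs (fst z)) (\<lambda>qs. count_multichains Q qs (snd z)) qs)"
    unfolding count_multichains.simps
  proof (rule sum.cong)
    fix z assume "z \<in> {z. ((x, y), z) \<in> ?R \<and> rank_diff ?R (x, y) z = q}"
    then have "fst z \<in> Field P" "snd z \<in> Field Q"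
      by (auto simp: poset_prod_def intro: FieldI2)
    from Cons.IH[OF this] show "(count_multichains ?R qs z :: 'k) =
        conv (\<lambda>qs. count_multichains P qs (fst z)) (\<lambda>qs. count_multichains Q qs (snd z)) qs"
      by simp
  qed simp
  also have "\<dots> = (\<Sum>(i, z)\<in>(SIGMA i:{..q}. ?A i \<times> ?B (q - i)).
        conv (\<lambda>qs. count_multichains P qs (fst z)) (\<lambda>qs. count_multichains Q qs (snd z)) qs)"
    by (rule sum.reindex_bij_witness[where j = "\<lambda>z. (rank_diff P x (fst z), z)" and i = snd])
      (auto simp: mem diff)
  also have "\<dots> = (\<Sum>i\<le>q. \<Sum>z\<in>?A i \<times> ?B (q - i).
        conv (\<lambda>qs. count_multichains P qs (fst z)) (\<lambda>qs. count_multichains Q qs (snd z)) qs)"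
    by (rule sum.Sigma[symmetric]) (use fin in auto)
  also have "\<dots> = (\<Sum>i\<le>q. split_sum (\<lambda>xs ys.
        (\<Sum>x'\<in>?A i. count_multichains P xs x') * (\<Sum>y'\<in>?B (q - i). count_multichains Q ys y')) qs)"
    by (simp only: sum_product sum.cartesian_product case_prod_unfold conv_def split_sum_sum)
  finally show ?case by (simp add: conv_def)
qed

lemma rank_steps_pos:
  assumes "graded_poset P" "sorted_wrt (lt P) xs"
  shows "pos_list (rank_steps P xs)"
  using assms(2)
proof (induction xs rule: induct_list012)
  case (3 x y zs)
  then have "rank_fun P x < rank_fun P y" using rank_fun_less[OF assms(1)] by simp
  with 3 show ?case by (simp add: rank_diff_def)
qed auto

lemma sum_rank_steps:
  assumes P: "graded_poset P" and "sorted_wrt (lt P) xs" "xs \<noteq> []"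
  shows "rank_fun P (hd xs) + sum_list (rank_steps P xs) = rank_fun P (last xs)"
  using assms(2,3) 
proof (induction xs rule: induct_list012)
  case (3 x y zs)
  then have "rank_fun P x < rank_fun P y" using rank_fun_less[OF P] by simp
  with 3 show ?case by (simp add: rank_diff_def)
qed auto

text \<open>Deleting repetitions from a multichain is deleting the zeros from its rank steps. Thus the
  coefficients of the sum of the monomial quasisymmetric functions of all chains count multichains.\<close>

lemma sum_chains_rank_steps:
  assumes P: "graded_poset P" and "x \<in> Field P"
  shows "(\<Sum>xs\<in>chains_from P x. monomial_coeffs (rank_steps P xs) qs) =
    (count_multichains P qs x :: 'k::comm_ring_1)"
  using assms(2)
proof (induction qs arbitrary: x)
  case Nil
  have "(\<Sum>ys\<in>chains_from P y. monomial_coeffs (rank_steps P (x # ys)) []) = (0::'k)" for y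
    by (rule sum.neutral) (auto simp: monomial_coeffs_def rank_steps_Cons[OF P])
  then show ?case
    using sum_chains_from[OF P, of x "\<lambda>xs. monomial_coeffs (rank_steps P xs) [] :: 'k"]
    by (cases "x = top_el P") (simp_all add: chains_from_top[OF P] monomial_coeffs_def)
next
  case (Cons q qs)
  note lt = rank_fun_less[OF P]
  show ?case
  proof (cases "q = 0")
    case True
    have "{y. (x, y) \<in> P \<and> rank_diff P x y = 0} = {x}"
      using lt[of x] Cons.prems partial_orderD(1)[OF graded_posetD(2)[OF P]]
      by (force simp: rank_diff_def lt_def)
    with True Cons show ?thesis by (simp add: monomial_coeffs_def)
  next
    case q: False
    show ?thesis
    proof (cases "x = top_el P")
      case True
      have none: "{y. (x, y) \<in> P \<and> rank_diff P x y = q} = {}"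
        using q not_top_lt[OF P] unfolding True lt_def rank_diff_def by fastforce
      show ?thesis
        unfolding count_multichains.simps none using q by (simp add: True chains_from_top[OF P] monomial_coeffs_def)
    next
      case False
      have "(\<Sum>ys\<in>chains_from P y. monomial_coeffs (rank_steps P (x # ys)) (q # qs)) =
          (if rank_diff P x y = q then count_multichains P qs y else 0 :: 'k)" if "lt P x y" for y
      proof -
        have "(\<Sum>ys\<in>chains_from P y. monomial_coeffs (rank_steps P (x # ys)) (q # qs)) =
            (\<Sum>ys\<in>chains_from P y. if rank_diff P x y = q then monomial_coeffs (rank_steps P ys) qs else 0 :: 'k)"
          using q by (intro sum.cong) (auto simp: rank_steps_Cons[OF P] monomial_coeffs_def)
        then show ?thesis using Cons.IH[OF ltD(4)[OF that]] by simp
      qed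
      then have "(\<Sum>xs\<in>chains_from P x. monomial_coeffs (rank_steps P xs) (q # qs)) =
          (\<Sum>y | lt P x y. if rank_diff P x y = q then count_multichains P qs y else 0 :: 'k)"
        by (simp add: sum_chains_from[OF P False])
      also have "\<dots> = (\<Sum>y | (x, y) \<in> P \<and> rank_diff P x y = q. count_multichains P qs y)"
      proof -
        have fin: "finite {y. lt P x y}"
          by (rule finite_subset[OF _ graded_posetD(1)[OF P]]) (auto dest: ltD)
        have eq: "{y. (x, y) \<in> P \<and> rank_diff P x y = q} = {y \<in> {y. lt P x y}. rank_diff P x y = q}"
          using q by (auto simp: lt_def rank_diff_def)
        show ?thesis unfolding eq by (rule sum.inter_filter[OF fin, symmetric])
      qed
      finally show ?thesis by simp
    qed
  qed
qed

lemma bot_ne_top: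
  assumes "graded_poset P" "1 \<le> poset_rank P" shows "bot_el P \<noteq> top_el P"
  using assms poset_rank_eq[OF assms(1)] by (auto simp: rank_diff_def)

section \<open>The monomials of the ab-index\<close>

text \<open>The monomial \<open>c\<^bsup>p\<^sub>1-1\<^esup> b c\<^bsup>p\<^sub>2-1\<^esup> b \<cdots>\<close> that a chain with rank steps
  \<open>p\<^sub>1, p\<^sub>2, \<dots>\<close> contributes. In contrast to \<open>ab_basis\<close>, all parts of the composition, the first one
  included, count from \<open>1\<close>.\<close>

definition ab_monomial :: "nat list \<Rightarrow> 'k::field ncpoly"
  where "ab_monomial ps = ab_basis (hd ps - 1) (tl ps)"

lemma ab_basis_simps:
  "ab_basis p [] = (var_a - var_b) ^ p"
  "ab_basis p (q # qs) = (var_a - var_b) ^ p * var_b * ab_basis (q - 1) qs"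
  by (simp_all add: ab_basis_def mult.assoc)

lemma chain_weight_eq:
  assumes "xs \<in> chains_from P x" "x \<noteq> top_el P"
  shows "chain_weight P xs = ab_monomial (rank_steps P xs)"
proof -
  have "chain_weight P xs = ab_monomial (rank_steps P xs)" if "2 \<le> length xs"
    using that
  proof (induction P xs rule: chain_weight.induct)
    case (1 P x y z zs)
    then show ?case by (simp add: ab_monomial_def ab_basis_simps)
  qed (simp_all add: ab_monomial_def ab_basis_simps)
  moreover have "2 \<le> length xs"
    using assms by (cases xs; cases "tl xs") (auto simp: chains_from_def)
  ultimately show ?thesis by blast
qed

lemma chain_weight_Cons:
  assumes "graded_poset P" "ys \<in> chains_from P y"
  shows "chain_weight P (x # ys) = (if y = top_el P then (var_a - var_b) ^ (rank_diff P x y - 1)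
    else (var_a - var_b) ^ (rank_diff P x y - 1) * var_b * chain_weight P ys)"
  using assms(2) not_top_lt[OF assms(1)]
  by (cases ys; cases "tl ys") (auto simp: chains_from_def)

section \<open>Posets with levels of one or two elements\<close>

text \<open>The number \<open>x\<close> stands for an element on level \<open>x div 2\<close>. Each level from \<open>0\<close> to
  \<open>length v + 1\<close> has its even element; level \<open>i\<close> also has its odd element if the \<open>i\<close>-th
  letter of \<open>v\<close> is \<open>b\<close>.\<close>

definition level_elems :: "letter list \<Rightarrow> nat set"
  where "level_elems v = {x. even x \<and> x div 2 \<le> Suc (length v) \<or>
    odd x \<and> 1 \<le> x div 2 \<and> x div 2 \<le> length v \<and> v ! (x div 2 - 1) = Lb}"

definition level_poset :: "letter list \<Rightarrow> nat rel"
  where "level_poset v = {(x, y). x \<in> level_elems v \<and> y \<in> level_elems v \<and> (x = y \<or> x div 2 < y div 2)}"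

lemma Field_level_poset: "Field (level_poset v) = level_elems v"
  by (auto simp: level_poset_def Field_def)

lemma lt_level_poset:
  "lt (level_poset v) x y \<longleftrightarrow> x \<in> level_elems v \<and> y \<in> level_elems v \<and> x div 2 < y div 2"
  by (auto simp: lt_def level_poset_def)

lemma even_level_elems: "2 * i \<in> level_elems v \<longleftrightarrow> i \<le> Suc (length v)"
  by (simp add: level_elems_def)

lemma level_elems_le: "x \<in> level_elems v \<Longrightarrow> x div 2 \<le> Suc (length v)"
  by (auto simp: level_elems_def)

lemma level_elems_ends:
  assumes "x \<in> level_elems v"
  shows "x = 0 \<or> 0 < x div 2" "x = 2 * Suc (length v) \<or> x div 2 < Suc (length v)"
  using assms by (auto simp: level_elems_def elim!: evenE)

lemma graded_level_poset:
  shows "graded_poset (level_poset v)"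
    and "bot_el (level_poset v) = 0" and "top_el (level_poset v) = 2 * Suc (length v)"
    and "x \<in> level_elems v \<Longrightarrow> rank_fun (level_poset v) x = x div 2"
proof -
  let ?P = "level_poset v"
  have po: "Partial_order ?P"
    unfolding partial_order_on_def preorder_on_def
  proof (intro conjI)
    show "Refl ?P" unfolding refl_on_def Field_level_poset by (auto simp: level_poset_def)
    show "trans ?P" unfolding trans_def by (auto simp: level_poset_def)
    show "antisym ?P" unfolding antisym_def by (auto simp: level_poset_def)
    show "?P \<subseteq> Field ?P \<times> Field ?P" by (auto intro: FieldI1 FieldI2)
  qed
  have bot: "is_bot ?P 0"
    unfolding is_bot_def Field_level_poset using even_level_elems[of 0 v] level_elems_ends(1)[of _ v]
    by (auto simp: level_poset_def)
  have top: "is_top ?P (2 * Suc (length v))"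
    unfolding is_top_def Field_level_poset
    using even_level_elems[of "Suc (length v)" v] level_elems_ends(2)[of _ v]
    by (auto simp: level_poset_def)
  show b: "bot_el ?P = 0" and "top_el ?P = 2 * Suc (length v)"
    using bot_elI[OF po bot] top_elI[OF po top] by simp_all
  have r: "is_rank_function ?P (\<lambda>x. x div 2)"
    unfolding is_rank_function_def b
  proof (intro conjI allI impI)
    fix x y assume c: "covers ?P y x"
    then have xy: "x \<in> level_elems v" "y \<in> level_elems v" "x div 2 < y div 2"
      by (auto simp: covers_def lt_level_poset)
    \<comment> \<open>The even element of the next level would lie strictly between, were that not the level of \<open>y\<close>.\<close>
    have "2 * Suc (x div 2) \<in> level_elems v"
      using level_elems_le[OF xy(2)] xy(3) by (simp only: even_level_elems)
    with c xy have "\<not> Suc (x div 2) < y div 2"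
      by (auto simp: covers_def lt_level_poset)
    with xy show "y div 2 = x div 2 + 1" by simp
  qed simp
  have "level_elems v \<subseteq> {..2 * Suc (length v) + 1}"
    using level_elems_le[of _ v] by fastforce
  then have "finite (level_elems v)" by (rule finite_subset) simp
  then show g: "graded_poset ?P"
    using po bot top r unfolding graded_poset_def Field_level_poset[symmetric] by blast
  show "rank_fun ?P x = x div 2" if "x \<in> level_elems v"
    using rank_fun_eq[OF g r] that by (simp add: Field_level_poset)
qed

definition level_prod :: "letter list \<Rightarrow> 'k::field ncpoly"
  where "level_prod v = (\<Prod>l\<leftarrow>v. case l of La \<Rightarrow> var_a | Lb \<Rightarrow> var_a + var_b)"

text \<open>Each factor is \<open>c + m b\<close>, where \<open>m\<close> is the size of the level. Expanding the product by the
  first factor from which the summand \<open>m b\<close> is taken matches the expansion of the chain sum by the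
  second element of the chain.\<close>

lemma level_prod_telescope:
  "level_prod v = (var_a - var_b) ^ length v + (\<Sum>j<length v. (case v ! j of La \<Rightarrow> 1 | Lb \<Rightarrow> 2) *
     ((var_a - var_b) ^ j * var_b * level_prod (drop (Suc j) v)) :: 'k::field ncpoly)"
proof (induction v)
  case Nil show ?case by (simp add: level_prod_def)
next
  case (Cons l v)
  let ?c = "var_a - var_b :: 'k ncpoly" and ?m = "\<lambda>l. (case l of La \<Rightarrow> 1 | Lb \<Rightarrow> 2) :: 'k ncpoly"
  have m: "?c * (?m l * u) = ?m l * (?c * u)" for l u
    by (cases l) (simp_all add: distrib_left mult_2)
  have "level_prod (l # v) = ?m l * (var_b * level_prod v) + ?c * level_prod v"
    by (cases l) (simp_all add: level_prod_def algebra_simps mult_2)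
  also have "?c * level_prod v = ?c ^ length (l # v) + (\<Sum>j<length v. ?m (v ! j) *
      (?c ^ Suc j * var_b * level_prod (drop (Suc j) v)))"
    by (subst Cons.IH) (simp add: distrib_left sum_distrib_left m mult.assoc)
  finally show ?case
    by (simp add: sum.lessThan_Suc_shift algebra_simps del: power_Suc sum.lessThan_Suc)
qed

text \<open>The chains are sorted by the level of their second element. All elements of a level have the
  same upper part, so the sum becomes that of \<open>level_prod_telescope\<close>.\<close>

lemma sum_chains_level_poset:
  assumes "x \<in> level_elems v" "x div 2 \<le> length v"
  shows "(\<Sum>xs\<in>chains_from (level_poset v) x. chain_weight (level_poset v) xs) =
    (level_prod (drop (x div 2) v) :: 'k::field ncpoly)"
  using assms
proof (induction "length v - x div 2" arbitrary: x rule: less_induct)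
  case less
  let ?P = "level_poset v" and ?c = "var_a - var_b :: 'k ncpoly" and ?top = "2 * Suc (length v)"
  note g = graded_level_poset[where v = v]
  define i where "i = x div 2"
  define W where "W y = (\<Sum>ys\<in>chains_from ?P y. chain_weight ?P (x # ys) :: 'k ncpoly)" for y
  have top: "x \<noteq> ?top" "lt ?P x ?top"
    using less.prems level_elems_le[of ?top v] even_level_elems[of "Suc (length v)" v]
    by (auto simp: lt_level_poset)
  have W_top: "W ?top = ?c ^ (length v - i)"
    unfolding W_def chains_from_top[OF g(1), unfolded g(3)]
    using less.prems even_level_elems[of "Suc (length v)" v]
    by (simp add: rank_diff_def g(4) i_def)
  have W: "W y = ?c ^ (y div 2 - Suc i) * var_b * level_prod (drop (y div 2) v)"
    if y: "lt ?P x y" "y \<noteq> ?top" for y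
  proof -
    have el: "y \<in> level_elems v" "y div 2 \<le> length v" "i < y div 2"
      using y level_elems_ends(2)[of y v] by (auto simp: lt_level_poset i_def)
    have "W y = (\<Sum>ys\<in>chains_from ?P y. ?c ^ (y div 2 - Suc i) * var_b * chain_weight ?P ys)"
      unfolding W_def
      by (rule sum.cong) (use y el less.prems in
          \<open>simp_all add: chain_weight_Cons[OF g(1)] g(3) rank_diff_def g(4) i_def\<close>)
    also have "\<dots> = ?c ^ (y div 2 - Suc i) * var_b * level_prod (drop (y div 2) v)"
      using less.hyps[of y] el by (simp add: i_def flip: sum_distrib_left)
    finally show ?thesis .
  qed
  let ?S = "{y. lt ?P x y \<and> y \<noteq> ?top}"
  have fin: "finite {y. lt ?P x y}"
    by (rule finite_subset[OF _ graded_posetD(1)[OF g(1)]]) (auto dest: ltD)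
  have lev: "{y \<in> ?S. y div 2 - Suc i = j} = (case v ! (i + j) of La \<Rightarrow> {2 * (i + j + 1)}
      | Lb \<Rightarrow> {2 * (i + j + 1), 2 * (i + j + 1) + 1})" if "j < length v - i" for j
  proof -
    have "y \<in> ?S \<and> y div 2 - Suc i = j \<longleftrightarrow> y \<in> level_elems v \<and> y div 2 = i + j + 1" for y
      using less.prems that by (auto simp: lt_level_poset i_def)
    moreover have "y \<in> level_elems v \<and> y div 2 = i + j + 1 \<longleftrightarrow>
        y = 2 * (i + j + 1) \<or> v ! (i + j) = Lb \<and> y = 2 * (i + j + 1) + 1" for y
    proof (cases "y div 2 = i + j + 1")
      case True
      then have "y = 2 * (i + j + 1) + y mod 2" using div_mult_mod_eq[of y 2] by simp
      then have "even y \<longleftrightarrow> y = 2 * (i + j + 1)" "odd y \<longleftrightarrow> y = 2 * (i + j + 1) + 1"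
        by presburger+
      with True that show ?thesis by (auto simp: level_elems_def)
    qed auto
    ultimately show ?thesis by (auto split: letter.split)
  qed
  have "(\<Sum>xs\<in>chains_from ?P x. chain_weight ?P xs) = (\<Sum>y | lt ?P x y. W y)"
    using sum_chains_from[OF g(1), of x "chain_weight ?P"] top by (simp add: W_def g(3))
  also have "\<dots> = ?c ^ (length v - i) + (\<Sum>y\<in>?S. W y)"
  proof -
    have "{y. lt ?P x y} - {?top} = ?S" by auto
    then show ?thesis unfolding W_top[symmetric] using sum.remove[OF fin, of ?top W] top by simp
  qed
  also have "(\<Sum>y\<in>?S. W y) = (\<Sum>j<length v - i. \<Sum>y | y \<in> ?S \<and> y div 2 - Suc i = j. W y)"
  proof (rule sum.group[symmetric])
    show "finite ?S" by (rule finite_subset[OF _ fin]) auto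
    show "(\<lambda>y. y div 2 - Suc i) ` ?S \<subseteq> {..<length v - i}"
      using level_elems_ends(2)[of _ v] by (fastforce simp: lt_level_poset i_def)
  qed simp
  also have "\<dots> = (\<Sum>j<length v - i. (case v ! (i + j) of La \<Rightarrow> 1 | Lb \<Rightarrow> 2) *
      (?c ^ j * var_b * level_prod (drop (Suc (i + j)) v)))"
  proof (rule sum.cong)
    fix j assume "j \<in> {..<length v - i}"
    then have j: "j < length v - i" by simp
    have "(\<Sum>y | y \<in> ?S \<and> y div 2 - Suc i = j. W y) =
        (\<Sum>y | y \<in> ?S \<and> y div 2 - Suc i = j. ?c ^ j * var_b * level_prod (drop (Suc (i + j)) v))"
    proof (rule sum.cong)
      fix y assume "y \<in> {y \<in> ?S. y div 2 - Suc i = j}"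
      then have "lt ?P x y" "y \<noteq> ?top" "y div 2 - Suc i = j" by auto
      moreover from this have "y div 2 = Suc (i + j)" by (auto simp: lt_level_poset i_def)
      ultimately show "W y = ?c ^ j * var_b * level_prod (drop (Suc (i + j)) v)"
        using W[of y] by simp
    qed simp
    then show "(\<Sum>y | y \<in> ?S \<and> y div 2 - Suc i = j. W y) = (case v ! (i + j) of La \<Rightarrow> 1 | Lb \<Rightarrow> 2) *
      (?c ^ j * var_b * level_prod (drop (Suc (i + j)) v))"
      unfolding lev[OF j] by (cases "v ! (i + j)") (simp_all add: mult_2)
  qed simp
  finally show ?case
    using level_prod_telescope[of "drop i v", where ?'k = 'k] less.prems
    by (simp add: i_def add.commute)
qed

lemma ab_index_level_poset:
  "ab_index (level_poset v) = (level_prod v :: 'k::field ncpoly)"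
  using sum_chains_level_poset[of 0 v] even_level_elems[of 0 v]
  by (simp add: ab_index_def bounded_chains_eq graded_level_poset)

lemma poset_rank_level_poset: "poset_rank (level_poset v) = Suc (length v)"
  using even_level_elems[of "Suc (length v)" v]
  by (simp add: poset_rank_def graded_level_poset)

lemma span_mult_left:
  assumes "u \<in> pm.span A" "\<And>v. v \<in> A \<Longrightarrow> z * v \<in> pm.span B"
  shows "z * u \<in> pm.span (B :: 'k::field ncpoly set)"
  using assms(1)
proof (rule pm.span_induct)
  show "pm.subspace {u. z * u \<in> pm.span B}"
    by (auto simp: pm.subspace_def distrib_left pm_scale_mult_right
        intro: pm.span_zero pm.span_add pm.span_scale)
qed (use assms(2) in auto)

text \<open>As \<open>b = (a + b) - a\<close>, the products of \<open>a\<close> and \<open>a + b\<close> of a given length span the words of that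
  length over every field.\<close>

lemma word_in_span_level_prod:
  "(word w :: 'k::field ncpoly) \<in> pm.span (level_prod ` {v. length v = length w})"
proof (induction w)
  case Nil
  have "word [] = (level_prod [] :: 'k ncpoly)" by (simp add: word_Nil level_prod_def)
  then show ?case by (auto intro: pm.span_base)
next
  case (Cons l w)
  let ?B = "level_prod ` {v. length v = length (l # w)} :: 'k ncpoly set"
  have "level_prod (l # v) \<in> ?B" if "length v = length w" for l v using that by auto
  then have base: "level_prod (l # v) \<in> pm.span ?B" if "length v = length w" for l v
    using that by (blast intro: pm.span_base)
  have a: "var_a * word w \<in> pm.span ?B"
    by (rule span_mult_left[OF Cons]) (use base[of _ La] in \<open>auto simp: level_prod_def\<close>)
  have ab: "(var_a + var_b) * word w \<in> pm.span ?B"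
    by (rule span_mult_left[OF Cons]) (use base[of _ Lb] in \<open>auto simp: level_prod_def\<close>)
  have "var_b * word w \<in> pm.span ?B"
    using pm.span_diff[OF ab a] by (simp add: distrib_right)
  moreover have "word (l # w) = (case l of La \<Rightarrow> var_a | Lb \<Rightarrow> var_b) * (word w :: 'k ncpoly)"
    using word_append[of "[l]" w, where ?'k = 'k] by (cases l) (simp_all add: var_a_def var_b_def)
  ultimately show ?case using a by (cases l) simp_all
qed

section \<open>The ab-index as a quasisymmetric function\<close>

text \<open>The coefficient function of the quasisymmetric function that corresponds to \<open>u\<close> when
  \<open>ab_monomial ps\<close> is sent to the monomial function of \<open>ps\<close>. It has no constant term, since the
  empty composition is not the step list of a chain.\<close>

definition ab_coeffs :: "'k::field ncpoly \<Rightarrow> nat list \<Rightarrow> 'k"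
  where "ab_coeffs u qs = (case drop_zeros qs of [] \<Rightarrow> 0
    | p # ps \<Rightarrow> Poly_Mapping.lookup (to_cb u) (encode (p - 1) ps))"

lemma linear_ab_coeffs: "Vector_Spaces.linear pm_scale (*) (\<lambda>u. ab_coeffs u qs)"
proof -
  interpret l: Vector_Spaces.linear pm_scale pm_scale "to_cb :: 'a ncpoly \<Rightarrow> _" by (rule linear_subst)
  show ?thesis
    by unfold_locales (auto simp: ab_coeffs_def l.add l.scale lookup_add algebra_simps split: list.split)
qed

lemma ab_coeffs_ab_monomial:
  assumes "pos_list ps" "ps \<noteq> []"
  shows "ab_coeffs (ab_monomial ps) = (monomial_coeffs ps :: nat list \<Rightarrow> 'k::field)"
proof
  fix qs
  obtain p ps' where ps: "ps = p # ps'" using assms by (cases ps) auto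
  show "ab_coeffs (ab_monomial ps) qs = (monomial_coeffs ps qs :: 'k)"
  proof (cases "drop_zeros qs")
    case (Cons q qs')
    have drop_zeros: "pos_list (drop_zeros qs)" by simp
    have *: "encode (p - 1) ps' = encode (q - 1) qs' \<longleftrightarrow> q # qs' = p # ps'"
    proof
      assume "encode (p - 1) ps' = encode (q - 1) qs'"
      then have "decode (encode (p - 1) ps') = decode (encode (q - 1) qs')" by (rule arg_cong)
      moreover have "pos_list ps'" "pos_list qs'" "0 < p" "0 < q"
        using assms(1) drop_zeros unfolding ps Cons by simp_all
      ultimately show "q # qs' = p # ps'" by (auto simp: decode_encode)
    qed simp
    have "ab_coeffs (ab_monomial ps) qs = (Poly_Mapping.lookup (word (encode (p - 1) ps')) (encode (q - 1) qs') :: 'k)"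
      by (simp add: ab_coeffs_def ab_monomial_def ps Cons to_cb_ab_basis)
    also have "\<dots> = monomial_coeffs ps qs"
      unfolding word_def lookup_single when_def * monomial_coeffs_def ps Cons by (rule refl)
    finally show ?thesis .
  qed (simp add: ab_coeffs_def monomial_coeffs_def ps)
qed

lemma ab_index_eq:
  assumes "graded_poset P" "1 \<le> poset_rank P"
  shows "ab_index P = (\<Sum>xs\<in>bounded_chains P. ab_monomial (rank_steps P xs) :: 'k::field ncpoly)"
  unfolding ab_index_def bounded_chains_eq
  by (intro sum.cong refl) (use bot_ne_top[OF assms] in \<open>auto intro!: chain_weight_eq\<close>)

lemma rank_steps_bounded_chain:
  assumes P: "graded_poset P" "1 \<le> poset_rank P" and xs: "xs \<in> bounded_chains P"
  shows "pos_list (rank_steps P xs)" "rank_steps P xs \<noteq> []"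
    "sum_list (rank_steps P xs) = poset_rank P"
proof -
  have *: "sorted_wrt (lt P) xs" "xs \<noteq> []" "hd xs = bot_el P" "last xs = top_el P"
    using xs by (auto simp: bounded_chains_def)
  show "pos_list (rank_steps P xs)" using rank_steps_pos[OF P(1) *(1)] .
  show s: "sum_list (rank_steps P xs) = poset_rank P"
    using sum_rank_steps[OF P(1) *(1,2)] *(3,4) graded_posetD(5)[OF P(1)]
    by (simp add: poset_rank_def is_rank_function_def)
  then show "rank_steps P xs \<noteq> []" using P(2) by auto
qed

lemma ab_coeffs_ab_index:
  assumes P: "graded_poset P" "1 \<le> poset_rank P"
  shows "ab_coeffs (ab_index P) = (\<lambda>qs. count_multichains P qs (bot_el P) :: 'k::field)"
proof
  fix qs
  interpret l: Vector_Spaces.linear pm_scale "(*)" "\<lambda>u :: 'k ncpoly. ab_coeffs u qs"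
    by (rule linear_ab_coeffs)
  have "ab_coeffs (ab_index P) qs = (\<Sum>xs\<in>bounded_chains P. monomial_coeffs (rank_steps P xs) qs :: 'k)"
    unfolding ab_index_eq[OF P] l.sum
    by (intro sum.cong refl) (simp add: ab_coeffs_ab_monomial rank_steps_bounded_chain[OF P])
  then show "ab_coeffs (ab_index P) qs = (count_multichains P qs (bot_el P) :: 'k)"
    using sum_chains_rank_steps[OF P(1) bot_le_top(1)[OF P(1)], of qs]
    by (simp add: bounded_chains_eq)
qed

text \<open>By \<open>count_multichains_prod\<close>. This is where the Cartesian product of posets meets the product of
  quasisymmetric functions.\<close>

lemma ab_coeffs_ab_index_prod:
  assumes P: "graded_poset P" "1 \<le> poset_rank P" and Q: "graded_poset Q" "1 \<le> poset_rank Q"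
  shows "ab_coeffs (ab_index (poset_prod P Q)) =
      (conv (ab_coeffs (ab_index P)) (ab_coeffs (ab_index Q)) :: _ \<Rightarrow> 'k::field)"
    and "poset_rank (poset_prod P Q) = poset_rank P + poset_rank Q"
proof -
  show r: "poset_rank (poset_prod P Q) = poset_rank P + poset_rank Q"
    by (simp add: poset_rank_def graded_poset_prod[OF P(1) Q(1)] bot_le_top P Q)
  show "ab_coeffs (ab_index (poset_prod P Q)) =
      (conv (ab_coeffs (ab_index P)) (ab_coeffs (ab_index Q)) :: _ \<Rightarrow> 'k)"
    using ab_coeffs_ab_index[OF graded_poset_prod(1)[OF P(1) Q(1)]] P(2) Q(2)
    by (simp add: r ab_coeffs_ab_index P Q graded_poset_prod(2)[OF P(1) Q(1)]
        count_multichains_prod[OF P(1) Q(1)] bot_le_top fun_eq_iff)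
qed

section \<open>The functional induced by the character\<close>

definition compositions :: "nat \<Rightarrow> nat list set"
  where "compositions q = {ps. pos_list ps \<and> sum_list ps = q}"

lemma finite_compositions [simp]: "finite (compositions q)"
proof (rule finite_subset)
  show "compositions q \<subseteq> {ps. set ps \<subseteq> {..q} \<and> length ps \<le> q}"
    using length_le_sum_list member_le_sum_list by (fastforce simp: compositions_def)
qed (simp add: finite_lists_length_le)

lemma compositions_0 [simp]: "compositions 0 = {[]}"
proof -
  have "ps = []" if "pos_list ps" "sum_list ps = 0" for ps
    using length_le_sum_list[OF that(1)] that(2) by simp
  then show ?thesis unfolding compositions_def by force
qed

text \<open>The value of the induced functional on a monomial quasisymmetric function. The empty
  composition is outside the image of the ab-index, and a multiplicative functional must be \<open>1\<close>
  there.\<close>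

definition monomial_value :: "('k::field ncpoly \<Rightarrow> 'k) \<Rightarrow> nat list \<Rightarrow> 'k"
  where "monomial_value G ps = (if ps = [] then 1 else G (ab_monomial ps))"

text \<open>The induced functional on the homogeneous part of degree \<open>q\<close>. Only finitely many
  compositions have sum \<open>q\<close>, so fixing the degree makes it defined and linear on all coefficient
  functions.\<close>

definition graded_value :: "('k::field ncpoly \<Rightarrow> 'k) \<Rightarrow> nat \<Rightarrow> (nat list \<Rightarrow> 'k) \<Rightarrow> 'k"
  where "graded_value G q f = (\<Sum>ps\<in>compositions q. monomial_value G ps * f ps)"

lemma graded_value_monomial_coeffs:
  assumes "pos_list ps"
  shows "graded_value G q (monomial_coeffs ps) = (if q = sum_list ps then monomial_value G ps else 0)"
proof -
  have "graded_value G q (monomial_coeffs ps) = (\<Sum>ps'\<in>compositions q. if ps' = ps then monomial_value G ps else 0)"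
    unfolding graded_value_def by (intro sum.cong refl) (auto simp: monomial_coeffs_def compositions_def drop_zeros_pos)
  moreover have "ps \<in> compositions q \<longleftrightarrow> q = sum_list ps" using assms by (auto simp: compositions_def)
  ultimately show ?thesis by simp
qed

lemma graded_value_sum: "graded_value G q (\<lambda>qs. \<Sum>i\<in>I. f i qs) = (\<Sum>i\<in>I. graded_value G q (f i))"
  unfolding graded_value_def sum_distrib_left by (rule sum.swap)

lemma graded_value_scale: "graded_value G q (\<lambda>qs. c * f qs) = c * graded_value G q f"
  by (simp add: graded_value_def sum_distrib_left mult.left_commute)

lemma graded_value_ab_coeffs_ab_index:
  assumes G: "Vector_Spaces.linear pm_scale (*) G" and P: "graded_poset P" "1 \<le> poset_rank P"
  shows "graded_value G (poset_rank P) (ab_coeffs (ab_index P)) = G (ab_index P)"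
proof -
  interpret G: Vector_Spaces.linear pm_scale "(*)" G by fact
  have "ab_coeffs (ab_index P) = (\<lambda>qs. \<Sum>xs\<in>bounded_chains P. monomial_coeffs (rank_steps P xs) qs :: 'a)"
  proof
    fix qs
    interpret l: Vector_Spaces.linear pm_scale "(*)" "\<lambda>u :: 'a ncpoly. ab_coeffs u qs"
      by (rule linear_ab_coeffs)
    show "ab_coeffs (ab_index P) qs = (\<Sum>xs\<in>bounded_chains P. monomial_coeffs (rank_steps P xs) qs :: 'a)"
      unfolding ab_index_eq[OF P] l.sum
      by (intro sum.cong refl) (simp add: ab_coeffs_ab_monomial rank_steps_bounded_chain[OF P])
  qed
  then have "graded_value G (poset_rank P) (ab_coeffs (ab_index P)) =
      (\<Sum>xs\<in>bounded_chains P. graded_value G (poset_rank P) (monomial_coeffs (rank_steps P xs)))"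
    by (simp add: graded_value_sum)
  also have "\<dots> = G (ab_index P)"
    unfolding ab_index_eq[OF P] G.sum
    by (intro sum.cong refl) (simp add: graded_value_monomial_coeffs monomial_value_def rank_steps_bounded_chain[OF P])
  finally show ?thesis .
qed

lemma conv_sum_left: "conv (\<lambda>qs. \<Sum>i\<in>I. c i * f i qs) h qs = (\<Sum>i\<in>I. c i * conv (f i) h qs)"
  unfolding conv_def sum_distrib_right split_sum_sum mult.assoc split_sum_mult_left by (rule refl)

lemma conv_sum_right: "conv h (\<lambda>qs. \<Sum>i\<in>I. c i * f i qs) qs = (\<Sum>i\<in>I. c i * conv h (f i) qs)"
  unfolding conv_def sum_distrib_left split_sum_sum mult.left_commute[of _ "c _"] split_sum_mult_left
  by (rule refl)

lemma keys_word_mult: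
  "Poly_Mapping.keys (u * v :: 'k::field ncpoly) \<subseteq> (\<lambda>(x, y). x @ y) ` (Poly_Mapping.keys u \<times> Poly_Mapping.keys v)"
  using keys_mult[of u v] by (auto simp: plus_list_def)

definition homogeneous :: "nat \<Rightarrow> 'k::field ncpoly \<Rightarrow> bool"
  where "homogeneous n u \<longleftrightarrow> (\<forall>w\<in>Poly_Mapping.keys u. length w = n)"

lemma homogeneous_mult: "homogeneous m u \<Longrightarrow> homogeneous n v \<Longrightarrow> homogeneous (m + n) (u * v)"
  using keys_word_mult[of u v] by (fastforce simp: homogeneous_def)

lemma homogeneous_simps: "homogeneous (Suc 0) (var_a - var_b)" "homogeneous (Suc 0) var_b" "homogeneous 0 1"
  using keys_diff[of "var_a :: 'a::field ncpoly" var_b]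
  by (auto simp: homogeneous_def var_a_def var_b_def word_def zero_list_def)

lemma homogeneous_power: "homogeneous 1 u \<Longrightarrow> homogeneous n (u ^ n)"
  using homogeneous_mult[of 1 u] by (induction n) (auto simp: homogeneous_simps)

lemma homogeneous_ab_basis: "pos_list ps \<Longrightarrow> homogeneous (p + sum_list ps) (ab_basis p ps)"
proof (induction ps arbitrary: p)
  case Nil
  then show ?case by (simp add: ab_basis_simps homogeneous_power homogeneous_simps)
next
  case (Cons q ps)
  have "homogeneous (p + 1 + (q - 1 + sum_list ps)) (ab_basis p (q # ps) :: 'a ncpoly)"
    unfolding ab_basis_simps
    by (intro homogeneous_mult homogeneous_power Cons.IH) (use Cons.prems in \<open>simp_all add: homogeneous_simps\<close>)
  then show ?case using Cons.prems by simp
qed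

lemma homogeneous_ab_monomial: "pos_list ps \<Longrightarrow> ps \<noteq> [] \<Longrightarrow> homogeneous (sum_list ps - 1) (ab_monomial ps)"
proof (cases ps)
  case (Cons p ps')
  assume "pos_list ps"
  then have "sum_list ps - 1 = p - 1 + sum_list ps'" "pos_list ps'" by (auto simp: Cons)
  then show ?thesis using homogeneous_ab_basis[of ps' "p - 1"] by (simp add: ab_monomial_def Cons)
qed simp

lemma homogeneous_span_level_prod:
  assumes "homogeneous n u"
  shows "u \<in> pm.span (level_prod ` {v. length v = n})"
proof -
  have "pm_scale (Poly_Mapping.lookup u w) (word w) \<in> pm.span (level_prod ` {v. length v = n})"
    if "w \<in> Poly_Mapping.keys u" for w
    using word_in_span_level_prod[of w] assms that by (auto simp: homogeneous_def intro: pm.span_scale)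
  then show ?thesis by (subst pm_expand) (rule pm.span_sum)
qed

context
  fixes G :: "'k::field ncpoly \<Rightarrow> 'k"
  assumes G: "is_character G"
begin

lemma linear_character: "Vector_Spaces.linear pm_scale (*) G"
  using G by (simp add: is_character_def)

text \<open>Both sides are bilinear in \<open>u\<close> and \<open>v\<close>, and in each degree the ab-indices of level posets
  span. For those the equation is the defining property of a character. The degree is raised by \<open>2\<close>
  because a poset of rank \<open>r\<close> has an ab-index of degree \<open>r - 1\<close>.\<close>

lemma graded_value_conv_ab_coeffs:
  assumes "homogeneous m u" "homogeneous n v"
  shows "graded_value G (m + n + 2) (conv (ab_coeffs u) (ab_coeffs v)) = G u * G v"
proof -
  interpret G: Vector_Spaces.linear pm_scale "(*)" G by (rule linear_character)
  have ab_coeffs_simps: "ab_coeffs (0 :: 'k ncpoly) = (\<lambda>qs. 0)"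
    "ab_coeffs (u + v) = (\<lambda>qs. ab_coeffs u qs + ab_coeffs v qs)"
    "ab_coeffs (pm_scale c u) = (\<lambda>qs. c * ab_coeffs u qs)" for u v :: "'k ncpoly" and c
  proof -
    interpret l: Vector_Spaces.linear pm_scale "(*)" "\<lambda>u :: 'k ncpoly. ab_coeffs u qs" for qs
      by (rule linear_ab_coeffs)
    show "ab_coeffs (0 :: 'k ncpoly) = (\<lambda>qs. 0)" "ab_coeffs (u + v) = (\<lambda>qs. ab_coeffs u qs + ab_coeffs v qs)"
      "ab_coeffs (pm_scale c u) = (\<lambda>qs. c * ab_coeffs u qs)"
      by (auto simp: fun_eq_iff l.zero l.add l.scale)
  qed
  have add: "conv (\<lambda>qs. f qs + f' qs) h = (\<lambda>qs. conv f h qs + conv f' h qs)"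
    "conv h (\<lambda>qs. f qs + f' qs) = (\<lambda>qs. conv h f qs + conv h f' qs)"
    "conv (\<lambda>qs. c * f qs) h = (\<lambda>qs. c * conv f h qs)"
    "conv h (\<lambda>qs. c * f qs) = (\<lambda>qs. c * conv h f qs)"
    "conv (\<lambda>qs. 0) h = (\<lambda>qs. 0)" "conv h (\<lambda>qs. 0) = (\<lambda>qs. 0)"
    for f f' h :: "nat list \<Rightarrow> 'k" and c
    \<comment> \<open>Additivity, homogeneity and vanishing at zero are the sums with two, one and no summands.\<close>
    using conv_sum_left[where I = "{True, False}" and c = "\<lambda>_. 1" and f = "\<lambda>i. if i then f else f'" and h = h]
      conv_sum_right[where I = "{True, False}" and c = "\<lambda>_. 1" and f = "\<lambda>i. if i then f else f'" and h = h]
      conv_sum_left[where I = "{()}" and c = "\<lambda>_. c" and f = "\<lambda>_. f" and h = h]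
      conv_sum_right[where I = "{()}" and c = "\<lambda>_. c" and f = "\<lambda>_. f" and h = h]
      conv_sum_left[where I = "{}" and c = "\<lambda>_. 1" and f = "\<lambda>_. f" and h = h]
      conv_sum_right[where I = "{}" and c = "\<lambda>_. 1" and f = "\<lambda>_. f" and h = h]
    by (auto simp: fun_eq_iff)
  have graded_value_add: "graded_value G q (\<lambda>qs. f qs + f' qs) = graded_value G q f + graded_value G q f'" "graded_value G q (\<lambda>qs. 0) = 0"
    for q f f' by (simp_all add: graded_value_def distrib_left sum.distrib)
  define B where "B u v = graded_value G (m + n + 2) (conv (ab_coeffs u) (ab_coeffs v))" for u v
  have B: "B 0 v = 0" "B v 0 = 0" "B (u + u') v = B u v + B u' v" "B v (u + u') = B v u + B v u'"
    "B (pm_scale c u) v = c * B u v" "B v (pm_scale c u) = c * B v u" for u u' v c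
    by (simp_all add: B_def ab_coeffs_simps add graded_value_add graded_value_scale)
  have base: "B (level_prod v) (level_prod w) = G (level_prod v) * G (level_prod w)"
    if "length v = m" "length w = n" for v w
  proof -
    let ?P = "level_poset v" and ?Q = "level_poset w"
    have P: "graded_poset ?P" "1 \<le> poset_rank ?P" and Q: "graded_poset ?Q" "1 \<le> poset_rank ?Q"
      by (simp_all add: graded_level_poset poset_rank_level_poset)
    note R = graded_poset_prod(1)[OF P(1) Q(1)] and R' = ab_coeffs_ab_index_prod[OF P Q]
    have "graded_value G (m + n + 2) (conv (ab_coeffs (ab_index ?P)) (ab_coeffs (ab_index ?Q))) =
        G (ab_index (poset_prod ?P ?Q))"
      using graded_value_ab_coeffs_ab_index[OF linear_character R] that by (simp add: R' poset_rank_level_poset)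
    also have "\<dots> = G (ab_index ?P) * G (ab_index ?Q)"
      using G P Q by (auto simp: is_character_def)
    finally show ?thesis by (simp add: ab_index_level_poset B_def)
  qed
  have right: "B (level_prod v') x = G (level_prod v') * G x"
    if "length v' = m" "x \<in> pm.span (level_prod ` {v. length v = n})" for v' x
    using that(2)
  proof (rule pm.span_induct)
    show "pm.subspace {x. B (level_prod v') x = G (level_prod v') * G x}"
      by (rule pm.subspaceI; simp only: mem_Collect_eq B G.add G.zero G.scale)
        (simp_all add: distrib_left distrib_right)
  qed (use base that(1) in auto)
  have "u \<in> pm.span (level_prod ` {v. length v = m})"
    using assms(1) by (rule homogeneous_span_level_prod)
  then have "B u v = G u * G v"
  proof (rule pm.span_induct)
    show "pm.subspace {u. B u v = G u * G v}"
      by (rule pm.subspaceI; simp only: mem_Collect_eq B G.add G.zero G.scale)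
        (simp_all add: distrib_left distrib_right)
  qed (use right homogeneous_span_level_prod[OF assms(2)] in auto)
  then show ?thesis by (simp add: B_def)
qed

lemma graded_value_conv_monomial_coeffs:
  assumes "pos_list ps" "pos_list rs"
  shows "graded_value G q (conv (monomial_coeffs ps) (monomial_coeffs rs)) =
    (if q = sum_list ps + sum_list rs then monomial_value G ps * monomial_value G rs else 0)"
proof (cases "ps = [] \<or> rs = []")
  case True
  have [simp]: "conv (monomial_coeffs []) f = f" "conv f (monomial_coeffs []) = f" for f :: "nat list \<Rightarrow> 'k"
    by (simp_all add: fun_eq_iff conv_monomial_coeffs_Nil)
  from True show ?thesis using assms by (auto simp: graded_value_monomial_coeffs monomial_value_def)
next
  case False
  show ?thesis
  proof (cases "q = sum_list ps + sum_list rs")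
    case True
    have "0 < sum_list ps" "0 < sum_list rs"
      using False assms length_le_sum_list[of ps] length_le_sum_list[of rs]
      by (auto simp: le_less_trans[OF _ less_le_trans] intro: less_le_trans)
    then have q: "sum_list ps - 1 + (sum_list rs - 1) + 2 = q" using True by simp
    show ?thesis
      using False assms True graded_value_conv_ab_coeffs[OF homogeneous_ab_monomial[of ps] homogeneous_ab_monomial[of rs], unfolded q]
      by (simp add: ab_coeffs_ab_monomial monomial_value_def)
  next
    case False
    \<comment> \<open>The two parts of a splitting that contributes have the sums of \<open>ps\<close> and of \<open>rs\<close>.\<close>
    have "conv (monomial_coeffs ps) (monomial_coeffs rs) qs = (0 :: 'k)" if "sum_list qs = q" for qs
    proof -
      have "monomial_coeffs ps xs * monomial_coeffs rs ys = (0 :: 'k)" if "sum_list xs + sum_list ys = sum_list qs" for xs ys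
      proof -
        have "\<not> (drop_zeros xs = ps \<and> drop_zeros ys = rs)"
          using that False \<open>sum_list qs = q\<close> sum_list_drop_zeros[of xs] sum_list_drop_zeros[of ys] by auto
        then show ?thesis by (auto simp: monomial_coeffs_def)
      qed
      then have "conv (monomial_coeffs ps) (monomial_coeffs rs) qs = split_sum (\<lambda>xs ys. 0 :: 'k) qs"
        unfolding conv_def by (intro split_sum_cong)
      then show ?thesis by (simp add: split_sum_0)
    qed
    with False show ?thesis by (simp add: graded_value_def compositions_def)
  qed
qed

text \<open>In degree at most \<open>q\<close> every zero-invariant function agrees with a finite combination of
  monomial ones, so \<open>graded_value_conv_monomial_coeffs\<close> extends by bilinearity.\<close>

lemma graded_value_conv:
  assumes f: "zero_invariant f" and h: "zero_invariant h"
  shows "graded_value G q (conv f h) = (\<Sum>i\<le>q. graded_value G i f * graded_value G (q - i) h)"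
proof -
  \<comment> \<open>Lists with sum at most \<open>q\<close> have their nonzero parts in \<open>A\<close>, and no others enter in degree \<open>q\<close>.\<close>
  define A where "A = (\<Union>i\<le>q. compositions i)"
  have A: "finite A" "\<And>ps. ps \<in> A \<Longrightarrow> pos_list ps" by (simp_all add: A_def) (auto simp: compositions_def)
  have expand: "f' qs = (\<Sum>ps\<in>A. f' ps * monomial_coeffs ps qs)" if "sum_list qs \<le> q" "zero_invariant f'"
    for f' :: "nat list \<Rightarrow> 'k" and qs
  proof -
    have "(\<Sum>ps\<in>A. f' ps * monomial_coeffs ps qs) = (\<Sum>ps\<in>A. if ps = drop_zeros qs then f' (drop_zeros qs) else 0)"
      by (intro sum.cong) (auto simp: monomial_coeffs_def)
    also have "\<dots> = f' qs" using that A(1) zero_invariantD[of f' qs] by (auto simp: A_def compositions_def)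
    finally show ?thesis ..
  qed
  have graded_value_expand: "graded_value G i f' = (\<Sum>ps\<in>A. f' ps * graded_value G i (monomial_coeffs ps))" if "i \<le> q" "zero_invariant f'" for f' i
  proof -
    have "graded_value G i f' = graded_value G i (\<lambda>qs. \<Sum>ps\<in>A. f' ps * monomial_coeffs ps qs)"
      unfolding graded_value_def using that by (intro sum.cong refl) (auto simp: compositions_def intro!: expand)
    then show ?thesis by (simp add: graded_value_sum graded_value_scale)
  qed
  have "graded_value G q (conv f h) =
      graded_value G q (conv (\<lambda>qs. \<Sum>ps\<in>A. f ps * monomial_coeffs ps qs) (\<lambda>qs. \<Sum>rs\<in>A. h rs * monomial_coeffs rs qs))"
    unfolding graded_value_def conv_def
    by (intro sum.cong refl arg_cong2[where f = "(*)"] split_sum_cong)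
      (auto simp: compositions_def intro!: expand f h)
  also have "\<dots> = (\<Sum>ps\<in>A. \<Sum>rs\<in>A. f ps * (h rs * graded_value G q (conv (monomial_coeffs ps) (monomial_coeffs rs))))"
  proof -
    have "conv (\<lambda>qs. \<Sum>ps\<in>A. f ps * monomial_coeffs ps qs) (\<lambda>qs. \<Sum>rs\<in>A. h rs * monomial_coeffs rs qs) =
        (\<lambda>qs. \<Sum>ps\<in>A. \<Sum>rs\<in>A. f ps * (h rs * conv (monomial_coeffs ps) (monomial_coeffs rs) qs))"
      by (simp add: fun_eq_iff conv_sum_left conv_sum_right sum_distrib_left)
    then show ?thesis by (simp add: graded_value_sum graded_value_scale)
  qed
  also have "\<dots> = (\<Sum>ps\<in>A. \<Sum>rs\<in>A. \<Sum>i\<le>q. f ps * (h rs * (graded_value G i (monomial_coeffs ps) * graded_value G (q - i) (monomial_coeffs rs))))"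
  proof (intro sum.cong refl)
    fix ps rs assume "ps \<in> A" "rs \<in> A"
    then have p: "pos_list ps" "pos_list rs" by (auto simp: A)
    have "(\<Sum>i\<le>q. f ps * (h rs * (graded_value G i (monomial_coeffs ps) * graded_value G (q - i) (monomial_coeffs rs)))) =
        (\<Sum>i\<le>q. if i = sum_list ps then
          if q = sum_list ps + sum_list rs then f ps * (h rs * (monomial_value G ps * monomial_value G rs)) else 0 else 0)"
      by (intro sum.cong refl) (auto simp: graded_value_monomial_coeffs p)
    also have "\<dots> = f ps * (h rs * graded_value G q (conv (monomial_coeffs ps) (monomial_coeffs rs)))"
      by (auto simp: graded_value_conv_monomial_coeffs p)
    finally show "f ps * (h rs * graded_value G q (conv (monomial_coeffs ps) (monomial_coeffs rs))) =
      (\<Sum>i\<le>q. f ps * (h rs * (graded_value G i (monomial_coeffs ps) * graded_value G (q - i) (monomial_coeffs rs))))" ..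
  qed
  also have "\<dots> = (\<Sum>ps\<in>A. \<Sum>i\<le>q. \<Sum>rs\<in>A. f ps * (h rs * (graded_value G i (monomial_coeffs ps) * graded_value G (q - i) (monomial_coeffs rs))))"
    by (rule sum.cong[OF refl sum.swap])
  also have "\<dots> = (\<Sum>i\<le>q. \<Sum>ps\<in>A. \<Sum>rs\<in>A. f ps * (h rs * (graded_value G i (monomial_coeffs ps) * graded_value G (q - i) (monomial_coeffs rs))))"
    by (rule sum.swap)
  also have "\<dots> = (\<Sum>i\<le>q. graded_value G i f * graded_value G (q - i) h)"
    by (intro sum.cong refl) (simp add: graded_value_expand f h sum_product algebra_simps)
  finally show ?thesis .
qed

end

section \<open>Peeling off blocks\<close>

text \<open>The map \<open>(\<phi>\<^sub>q \<otimes> id) \<circ> \<Delta>\<close> for the deconcatenation \<open>\<Delta>\<close> of \<open>QSym\<close>, on coefficient functions.\<close>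

definition peel :: "('k::field ncpoly \<Rightarrow> 'k) \<Rightarrow> nat \<Rightarrow> (nat list \<Rightarrow> 'k) \<Rightarrow> nat list \<Rightarrow> 'k"
  where "peel G q f rs = graded_value G q (\<lambda>qs. f (qs @ rs))"

text \<open>The functional \<open>\<phi>\<^sub>q\<^sub>1 \<otimes> \<dots> \<otimes> \<phi>\<^sub>q\<^sub>l\<close> applied to the iterated deconcatenation of \<open>f\<close>. As a
  function of \<open>q\<^sub>1, \<dots>, q\<^sub>l\<close> it gives the coefficients of the image of \<open>f\<close> under the chain map.\<close>

primrec block_sum :: "('k::field ncpoly \<Rightarrow> 'k) \<Rightarrow> nat list \<Rightarrow> (nat list \<Rightarrow> 'k) \<Rightarrow> 'k" where
  "block_sum G [] f = f []"
| "block_sum G (q # qs) f = block_sum G qs (peel G q f)"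

lemma zero_invariant_append:
  assumes "zero_invariant f" shows "zero_invariant (\<lambda>qs. f (qs @ rs))"
  unfolding zero_invariant_def
proof
  fix qs show "f (drop_zeros qs @ rs) = f (qs @ rs)"
    using zero_invariantD[OF assms, of "drop_zeros qs @ rs"] zero_invariantD[OF assms, of "qs @ rs"] by simp
qed

lemma zero_invariant_peel:
  assumes "zero_invariant f" shows "zero_invariant (peel G q f)"
  unfolding zero_invariant_def
proof
  fix rs
  have "f (qs @ drop_zeros rs) = f (qs @ rs)" for qs
    using zero_invariantD[OF assms, of "qs @ drop_zeros rs"] zero_invariantD[OF assms, of "qs @ rs"] by simp
  then show "peel G q f (drop_zeros rs) = peel G q f rs" by (simp add: peel_def)
qed

lemma peel_sum: "peel G q (\<lambda>qs. \<Sum>i\<in>I. f i qs) rs = (\<Sum>i\<in>I. peel G q (f i) rs)"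
  by (simp add: peel_def graded_value_sum)

lemma peel_scale: "peel G q (\<lambda>qs. c * f qs) rs = c * peel G q f rs"
  by (simp add: peel_def graded_value_scale)

lemma block_sum_sum: "block_sum G qs (\<lambda>rs. \<Sum>i\<in>I. f i rs) = (\<Sum>i\<in>I. block_sum G qs (f i))"
proof (induction qs arbitrary: f)
  case (Cons q qs)
  have "peel G q (\<lambda>rs. \<Sum>i\<in>I. f i rs) = (\<lambda>rs. \<Sum>i\<in>I. peel G q (f i) rs)"
    by (simp add: fun_eq_iff peel_sum)
  then show ?case by (simp add: Cons)
qed simp

lemma block_sum_scale: "block_sum G qs (\<lambda>rs. c * f rs) = c * block_sum G qs f"
proof (induction qs arbitrary: f)
  case (Cons q qs)
  have "peel G q (\<lambda>rs. c * f rs) = (\<lambda>rs. c * peel G q f rs)"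
    by (simp add: fun_eq_iff peel_scale)
  then show ?case by (simp add: Cons)
qed simp

text \<open>Only the empty composition has sum \<open>0\<close>, and its value is \<open>1\<close>, so peeling off a block of
  degree \<open>0\<close> does nothing.\<close>

lemma zero_invariant_block_sum:
  assumes "zero_invariant f" shows "zero_invariant (\<lambda>qs. block_sum G qs f)"
proof -
  have "block_sum G (drop_zeros qs) f = block_sum G qs f" for qs
  proof (induction qs arbitrary: f)
    case (Cons q qs)
    have "peel G 0 f = f" by (simp add: fun_eq_iff peel_def graded_value_def monomial_value_def)
    with Cons show ?case by (cases "q = 0") simp_all
  qed simp
  then show ?thesis by (simp add: zero_invariant_def)
qed

text \<open>By \<open>split_sum_append\<close> and the multiplicativity of \<open>graded_value\<close>, peeling a block of degree \<open>q\<close>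
  off a product amounts to peeling blocks of degrees \<open>i\<close> and \<open>q - i\<close> off the factors.\<close>

lemma block_sum_conv:
  assumes G: "is_character G" and "zero_invariant f" "zero_invariant h"
  shows "block_sum G qs (conv f h) = conv (\<lambda>qs. block_sum G qs f) (\<lambda>qs. block_sum G qs h) qs"
  using assms(2,3)
proof (induction qs arbitrary: f h)
  case Nil show ?case by (simp add: conv_def)
next
  case (Cons q qs)
  have "peel G q (conv f h) rs = (\<Sum>i\<le>q. conv (peel G i f) (peel G (q - i) h) rs)" for rs
  proof -
    have "peel G q (conv f h) rs = (\<Sum>ps\<in>compositions q. split_sum (\<lambda>xs' ys'. monomial_value G ps *
        conv (\<lambda>xs. f (xs @ xs')) (\<lambda>ys. h (ys @ ys')) ps) rs)"
      unfolding peel_def graded_value_def conv_def split_sum_append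
      by (subst split_sum_swap) (simp add: split_sum_mult_left)
    also have "\<dots> = split_sum (\<lambda>xs' ys'. graded_value G q (conv (\<lambda>xs. f (xs @ xs')) (\<lambda>ys. h (ys @ ys')))) rs"
      by (simp add: graded_value_def split_sum_sum)
    also have "\<dots> = split_sum (\<lambda>xs' ys'. \<Sum>i\<le>q. peel G i f xs' * peel G (q - i) h ys') rs"
      by (simp add: graded_value_conv[OF G zero_invariant_append[OF Cons.prems(1)] zero_invariant_append[OF Cons.prems(2)]] peel_def)
    finally show ?thesis by (simp add: conv_def split_sum_sum)
  qed
  then have "peel G q (conv f h) = (\<lambda>rs. \<Sum>i\<le>q. conv (peel G i f) (peel G (q - i) h) rs)" ..
  then show ?case
    by (simp add: block_sum_sum Cons.IH zero_invariant_peel Cons.prems) (simp add: conv_def)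
qed

section \<open>The coproduct on the monomials in \<open>a - b\<close> and \<open>b\<close>\<close>

lemma linear_eq_on_words:
  assumes "Vector_Spaces.linear pm_scale sc f" "Vector_Spaces.linear pm_scale sc h"
    and eq: "\<And>w. f (word w) = h (word w)"
  shows "f u = h u"
proof -
  interpret f: Vector_Spaces.linear pm_scale sc f by fact
  interpret h: Vector_Spaces.linear pm_scale sc h by fact
  show ?thesis by (subst (1 2) pm_expand) (simp add: f.sum f.scale h.sum h.scale eq)
qed

lemma linear_eq_on_ab_basis:
  fixes f h :: "'k::field ncpoly \<Rightarrow> 'v::ab_group_add"
  assumes "Vector_Spaces.linear pm_scale sc f" "Vector_Spaces.linear pm_scale sc h"
    and eq: "\<And>p ps. pos_list ps \<Longrightarrow> f (ab_basis p ps) = h (ab_basis p ps)"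
  shows "f u = h u"
proof -
  have "(f \<circ> from_cb) (to_cb u) = (h \<circ> from_cb) (to_cb u)"
  proof (rule linear_eq_on_words)
    show "Vector_Spaces.linear pm_scale sc (f \<circ> from_cb)" "Vector_Spaces.linear pm_scale sc (h \<circ> from_cb)"
      using assms(1,2) by (auto intro: Vector_Spaces.linear_compose linear_subst)
    fix w
    show "(f \<circ> from_cb) (word w) = (h \<circ> from_cb) (word w)"
      using eq[OF pos_list_decode, of "fst (decode w)" w]
        from_cb_encode[of "fst (decode w)" "snd (decode w)", where ?'a = 'k]
      by (simp add: encode_decode)
  qed
  then show ?thesis by (simp add: to_from)
qed

lemma linear_mult: "Vector_Spaces.linear pm_scale pm_scale (\<lambda>v. z * v :: 'k::field ncpoly)"
  by unfold_locales (simp_all add: distrib_left pm_scale_mult_right)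

lemma linear_comp_mult:
  "Vector_Spaces.linear pm_scale sc f \<Longrightarrow> Vector_Spaces.linear pm_scale sc (\<lambda>v. f (z * v :: 'k::field ncpoly))"
  using Vector_Spaces.linear_compose[OF linear_mult, of sc f z] by (simp add: o_def)

text \<open>The map \<open>u \<mapsto> \<Sum> f(u\<^sub>(\<^sub>1\<^sub>)) \<cdot> h(u\<^sub>(\<^sub>2\<^sub>))\<close> in Sweedler notation.\<close>

definition coproduct_prod :: "('k::field ncpoly \<Rightarrow> 'k ncpoly) \<Rightarrow> ('k ncpoly \<Rightarrow> 'k ncpoly) \<Rightarrow> 'k ncpoly \<Rightarrow> 'k ncpoly"
  where "coproduct_prod f h = lin_ext pm_scale
    (\<lambda>w. \<Sum>i<length w. f (word (take i w)) * h (word (drop (Suc i) w)))"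

lemma linear_coproduct_prod: "Vector_Spaces.linear pm_scale pm_scale (coproduct_prod f h)"
  unfolding coproduct_prod_def by (rule lin_ext_linear) (rule pm.vector_space_axioms)

lemma coproduct_prod_word: "coproduct_prod f h (word w) = (\<Sum>i<length w. f (word (take i w)) * h (word (drop (Suc i) w)))"
  unfolding coproduct_prod_def by (rule lin_ext_word) (rule pm.vector_space_axioms)

text \<open>The coproduct is a derivation, and both letters satisfy \<open>\<Delta>(l) = 1 \<otimes> 1\<close>. The first summand
  comes from cutting at \<open>l\<close>; it is the same for \<open>a\<close> and \<open>b\<close>, and so cancels for \<open>a - b\<close>.\<close>

lemma coproduct_prod_letter:
  assumes "Vector_Spaces.linear pm_scale pm_scale h"
  shows "coproduct_prod f h (word [l] * u) = f 1 * h u + coproduct_prod (\<lambda>v. f (word [l] * v)) h u"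
proof (rule linear_eq_on_words[where f = "\<lambda>u. coproduct_prod f h (word [l] * u)"])
  interpret h: Vector_Spaces.linear pm_scale pm_scale h by fact
  interpret s: Vector_Spaces.linear pm_scale pm_scale "coproduct_prod (\<lambda>v. f (word [l] * v)) h" by (rule linear_coproduct_prod)
  show "Vector_Spaces.linear pm_scale pm_scale (\<lambda>u. coproduct_prod f h (word [l] * u))"
    by (rule linear_comp_mult) (rule linear_coproduct_prod)
  show "Vector_Spaces.linear pm_scale pm_scale (\<lambda>u. f 1 * h u + coproduct_prod (\<lambda>v. f (word [l] * v)) h u)"
    by unfold_locales
      (simp_all add: h.add h.scale s.add s.scale distrib_left pm_scale_mult_right pm.scale_right_distrib)
  fix w
  have "word [l] * word v = (word (l # v) :: 'a ncpoly)" for v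
    using word_append[of "[l]" v, where ?'k = 'a] by simp
  then show "coproduct_prod f h (word [l] * word w) = f 1 * h (word w) + coproduct_prod (\<lambda>v. f (word [l] * v)) h (word w)"
    by (simp add: coproduct_prod_word sum.lessThan_Suc_shift word_Nil del: sum.lessThan_Suc)
qed

lemma coproduct_prod_diff:
  "coproduct_prod (\<lambda>v. f v - f' v) h u = coproduct_prod f h u - coproduct_prod f' h u"
  by (simp add: coproduct_prod_def lin_ext_def left_diff_distrib sum_subtractf pm.scale_right_diff_distrib)

lemma coproduct_prod_c_power:
  assumes f: "Vector_Spaces.linear pm_scale pm_scale f" and h: "Vector_Spaces.linear pm_scale pm_scale h"
  shows "coproduct_prod f h ((var_a - var_b) ^ p * u) = coproduct_prod (\<lambda>v. f ((var_a - var_b) ^ p * v)) h u"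
  using f
proof (induction p arbitrary: f)
  case (Suc p)
  interpret f: Vector_Spaces.linear pm_scale pm_scale f by fact
  interpret s: Vector_Spaces.linear pm_scale pm_scale "coproduct_prod f h" by (rule linear_coproduct_prod)
  have "coproduct_prod f h ((var_a - var_b) * v) = coproduct_prod (\<lambda>v. f ((var_a - var_b) * v)) h v" for v
    using coproduct_prod_letter[OF h, of f La v] coproduct_prod_letter[OF h, of f Lb v]
    by (simp add: left_diff_distrib f.diff s.diff coproduct_prod_diff flip: var_a_def var_b_def)
  then show ?case
    using Suc.IH[OF linear_comp_mult[OF Suc.prems, of "var_a - var_b"]] by (simp add: mult.assoc)
qed simp

text \<open>Powers of \<open>a - b\<close> pass through the coproduct, so the only cuts are those at the letters \<open>b\<close>. Each
  of them deconcatenates the composition, and the cut letter becomes the start of the first part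
  of the right piece: hence \<open>ab_monomial\<close> on the right.\<close>

lemma coproduct_prod_ab_basis:
  assumes f: "Vector_Spaces.linear pm_scale pm_scale f" and h: "Vector_Spaces.linear pm_scale pm_scale h"
  shows "coproduct_prod f h (ab_basis p ps) =
    (\<Sum>j<length ps. f (ab_basis p (take j ps)) * h (ab_monomial (drop j ps)))"
  using f
proof (induction ps arbitrary: f p)
  case Nil
  have "coproduct_prod f h ((var_a - var_b) ^ p * word []) = 0"
    by (subst coproduct_prod_c_power[OF Nil h], subst coproduct_prod_word) simp
  then show ?case by (simp add: ab_basis_simps word_Nil)
next
  case (Cons q qs)
  let ?c = "var_a - var_b :: 'a ncpoly"
  let ?f = "\<lambda>v. f (?c ^ p * (var_b * v))"
  have lin: "Vector_Spaces.linear pm_scale pm_scale ?f"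
    using linear_comp_mult[OF Cons.prems, of "?c ^ p * var_b"] by (simp add: mult.assoc)
  have "coproduct_prod f h (ab_basis p (q # qs)) = coproduct_prod (\<lambda>v. f (?c ^ p * v)) h (var_b * ab_basis (q - 1) qs)"
    unfolding ab_basis_simps mult.assoc by (rule coproduct_prod_c_power[OF Cons.prems h])
  also have "\<dots> = f (?c ^ p) * h (ab_basis (q - 1) qs) + coproduct_prod ?f h (ab_basis (q - 1) qs)"
    using coproduct_prod_letter[OF h, of "\<lambda>v. f (?c ^ p * v)" Lb] by (simp add: var_b_def)
  finally show ?case
    by (simp add: sum.lessThan_Suc_shift Cons.IH[OF lin] ab_basis_simps mult.assoc ab_monomial_def del: sum.lessThan_Suc)
qed

section \<open>Recursion for the chain map\<close>

lemma linear_deg_twist: "Vector_Spaces.linear pm_scale pm_scale (deg_twist L)"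
  unfolding deg_twist_def by (rule lin_ext_linear) (rule pm.vector_space_axioms)

text \<open>The contribution \<open>b \<cdot> ghat(u\<^sub>1) \<cdot> b \<cdots> b \<cdot> ghat(u\<^sub>k)\<close> of the tensor factors after the first
  one in \<open>chain_product\<close>.\<close>

definition tail_prod :: "('k::field ncpoly \<Rightarrow> 'k) \<Rightarrow> 'k tensor \<Rightarrow> 'k ncpoly"
  where "tail_prod G = lin_ext pm_scale (\<lambda>ws. \<Prod>w\<leftarrow>ws. var_b * ghat G (word w))"

lemma linear_tail_prod: "Vector_Spaces.linear pm_scale pm_scale (tail_prod G)"
  unfolding tail_prod_def by (rule lin_ext_linear) (rule pm.vector_space_axioms)

lemma linear_chain_product: "Vector_Spaces.linear pm_scale pm_scale (chain_product G)"
  unfolding chain_product_def by (rule lin_ext_linear) (rule pm.vector_space_axioms)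

lemma chain_product_Cons:
  "tail_prod G (word [v] * t) = var_b * ghat G (word v) * tail_prod G t"
  "chain_product G (word [v] * t) = kappa (word v) * tail_prod G t"
proof -
  interpret t: Vector_Spaces.linear pm_scale pm_scale "tail_prod G" by (rule linear_tail_prod)
  interpret c: Vector_Spaces.linear pm_scale pm_scale "chain_product G" by (rule linear_chain_product)
  have w: "tail_prod G (word ws) = (\<Prod>w\<leftarrow>ws. var_b * ghat G (word w))"
    "chain_product G (word ws) = kappa (word (hd ws)) * (\<Prod>w\<leftarrow>tl ws. var_b * ghat G (word w))" for ws
    by (simp_all add: tail_prod_def chain_product_def lin_ext_word[OF pm.vector_space_axioms])
  have m: "word [v] * pm_scale c (word ws) = pm_scale c (word (v # ws) :: 'a tensor)" for c ws
    by (simp add: word_def pm_scale_def map_single mult_single plus_list_def)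
  show "tail_prod G (word [v] * t) = var_b * ghat G (word v) * tail_prod G t"
    by (subst (1 2) pm_expand[of t])
      (simp add: sum_distrib_left t.sum t.scale m w pm_scale_mult_right mult.assoc)
  show "chain_product G (word [v] * t) = kappa (word v) * tail_prod G t"
    by (subst (1 2) pm_expand[of t])
      (simp add: sum_distrib_left t.sum t.scale c.sum c.scale m w pm_scale_mult_right)
qed

lemma iter_coproduct_Suc_word:
  "iter_coproduct (Suc n) (word w) =
    (\<Sum>i<length w. word [take i w] * iter_coproduct n (word (drop (Suc i) w)) :: 'k::field tensor)"
proof -
  interpret l: Vector_Spaces.linear pm_scale pm_scale "id_tensor (iter_coproduct n) :: 'k tensor \<Rightarrow> _"
    unfolding id_tensor_def by (rule lin_ext_linear) (rule pm.vector_space_axioms)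
  show ?thesis
    by (simp add: coproduct_def lin_ext_word[OF pm.vector_space_axioms] l.sum)
      (simp add: id_tensor_def lin_ext_word[OF pm.vector_space_axioms])
qed

lemma linear_tail_prod_iter: "Vector_Spaces.linear pm_scale pm_scale (\<lambda>u. tail_prod G (iter_coproduct n u))"
  using Vector_Spaces.linear_compose[OF iter_coproduct_linear linear_tail_prod] by (simp add: o_def)

lemma linear_chain_product_iter:
  "Vector_Spaces.linear pm_scale pm_scale (\<lambda>u. chain_product G (iter_coproduct n u))"
  using Vector_Spaces.linear_compose[OF iter_coproduct_linear linear_chain_product] by (simp add: o_def)

lemma iter_coproduct_0_word: "iter_coproduct 0 (word w) = (word [w] :: 'k::field tensor)"
  by (simp add: one_tensor_def lin_ext_word[OF pm.vector_space_axioms])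

lemma linear_b_ghat: "Vector_Spaces.linear pm_scale pm_scale (\<lambda>u. var_b * ghat G u)"
  using Vector_Spaces.linear_compose[OF linear_deg_twist linear_mult] by (simp add: o_def ghat_def)

lemma tail_prod_iter:
  "tail_prod G (iter_coproduct 0 u) = var_b * ghat G u"
  "tail_prod G (iter_coproduct (Suc n) u) = coproduct_prod (\<lambda>u. var_b * ghat G u) (\<lambda>u. tail_prod G (iter_coproduct n u)) u"
proof -
  show "tail_prod G (iter_coproduct 0 u) = var_b * ghat G u"
    by (rule linear_eq_on_words[OF linear_tail_prod_iter linear_b_ghat])
      (simp only: iter_coproduct_0_word, simp add: tail_prod_def lin_ext_word[OF pm.vector_space_axioms])
  show "tail_prod G (iter_coproduct (Suc n) u) = coproduct_prod (\<lambda>u. var_b * ghat G u) (\<lambda>u. tail_prod G (iter_coproduct n u)) u"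
  proof (rule linear_eq_on_words[OF linear_tail_prod_iter linear_coproduct_prod])
    interpret t: Vector_Spaces.linear pm_scale pm_scale "tail_prod G" by (rule linear_tail_prod)
    show "tail_prod G (iter_coproduct (Suc n) (word w)) =
        coproduct_prod (\<lambda>u. var_b * ghat G u) (\<lambda>u. tail_prod G (iter_coproduct n u)) (word w)" for w
      unfolding iter_coproduct_Suc_word coproduct_prod_word t.sum chain_product_Cons by (rule refl)
  qed
qed

lemma chain_product_iter:
  "chain_product G (iter_coproduct 0 u) = kappa u"
  "chain_product G (iter_coproduct (Suc n) u) = coproduct_prod kappa (\<lambda>u. tail_prod G (iter_coproduct n u)) u"
proof -
  have k: "Vector_Spaces.linear pm_scale pm_scale (kappa :: 'a ncpoly \<Rightarrow> _)"
    unfolding kappa_def by (rule linear_deg_twist)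
  show "chain_product G (iter_coproduct 0 u) = kappa u"
    by (rule linear_eq_on_words[OF linear_chain_product_iter k])
      (simp only: iter_coproduct_0_word, simp add: chain_product_def lin_ext_word[OF pm.vector_space_axioms])
  show "chain_product G (iter_coproduct (Suc n) u) = coproduct_prod kappa (\<lambda>u. tail_prod G (iter_coproduct n u)) u"
  proof (rule linear_eq_on_words[OF linear_chain_product_iter linear_coproduct_prod])
    interpret t: Vector_Spaces.linear pm_scale pm_scale "chain_product G" by (rule linear_chain_product)
    show "chain_product G (iter_coproduct (Suc n) (word w)) =
        coproduct_prod kappa (\<lambda>u. tail_prod G (iter_coproduct n u)) (word w)" for w
      unfolding iter_coproduct_Suc_word coproduct_prod_word t.sum chain_product_Cons by (rule refl)
  qed
qed

section \<open>The chain map on monomials\<close>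

lemma vector_space_field: "vector_space ((*) :: 'k::field \<Rightarrow> 'k \<Rightarrow> 'k)"
  by unfold_locales (simp_all add: algebra_simps)

lemma linear_aug: "Vector_Spaces.linear pm_scale (*) (aug :: 'k::field ncpoly \<Rightarrow> 'k)"
  unfolding aug_def by (rule lin_ext_linear) (rule vector_space_field)

lemma aug_letter: "aug (word [l] * u) = (case l of La \<Rightarrow> 1 | Lb \<Rightarrow> 0) * (aug u :: 'k::field)"
proof (rule linear_eq_on_words[where f = "\<lambda>u. aug (word [l] * u)"])
  interpret a: Vector_Spaces.linear pm_scale "(*)" "aug :: 'k ncpoly \<Rightarrow> 'k" by (rule linear_aug)
  show "Vector_Spaces.linear pm_scale (*) (\<lambda>u. aug (word [l] * u) :: 'k)"
    by (rule linear_comp_mult) (rule linear_aug)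
  show "Vector_Spaces.linear pm_scale (*) (\<lambda>u. (case l of La \<Rightarrow> 1 | Lb \<Rightarrow> 0) * (aug u :: 'k))"
    by unfold_locales (simp_all add: a.add a.scale distrib_left mult.left_commute)
  fix w
  have "word [l] * word w = (word (l # w) :: 'k ncpoly)"
    using word_append[of "[l]" w, where ?'k = 'k] by simp
  then show "aug (word [l] * word w) = (case l of La \<Rightarrow> 1 | Lb \<Rightarrow> 0) * (aug (word w) :: 'k)"
    by (simp add: aug_def lin_ext_word[OF vector_space_field])
qed

lemma aug_ab_basis: "aug (ab_basis p ps) = (if ps = [] then 1 else (0 :: 'k::field))"
proof -
  interpret a: Vector_Spaces.linear pm_scale "(*)" "aug :: 'k ncpoly \<Rightarrow> 'k" by (rule linear_aug)
  have ab: "aug (var_a * u) = aug u" "aug (var_b * u) = 0" for u :: "'k ncpoly"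
    by (simp_all add: var_a_def var_b_def aug_letter)
  have c: "aug ((var_a - var_b) ^ p * u) = aug u" for u :: "'k ncpoly" and p
    by (induction p) (simp_all add: mult.assoc left_diff_distrib a.diff ab)
  have "aug (1 :: 'k ncpoly) = 1"
    unfolding word_Nil[symmetric] aug_def lin_ext_word[OF vector_space_field] by simp
  then show ?thesis
    using c[of p 1] by (cases ps) (simp_all add: ab_basis_simps mult.assoc c ab)
qed

lemma kappa_ab_basis:
  assumes "pos_list ps"
  shows "kappa (ab_basis p ps) = (if ps = [] then (var_a - var_b) ^ p else (0 :: 'k::field ncpoly))"
  unfolding kappa_def
  by (subst deg_twist_homogeneous[OF linear_aug, where n = "p + sum_list ps"])
    (use homogeneous_ab_basis[OF assms, of p, where 'a = 'k] in \<open>auto simp: homogeneous_def aug_ab_basis\<close>)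

lemma b_ghat_ab_monomial:
  assumes "Vector_Spaces.linear pm_scale (*) G" "pos_list ps" "ps \<noteq> []"
  shows "var_b * ghat G (ab_monomial ps) = pm_scale (monomial_value G ps) (ab_basis 0 [sum_list ps])"
  unfolding ghat_def
  by (subst deg_twist_homogeneous[OF assms(1), where n = "sum_list ps - 1"])
    (use homogeneous_ab_monomial[OF assms(2,3)] assms(3) in
      \<open>auto simp: homogeneous_def monomial_value_def pm_scale_mult_right ab_basis_simps\<close>)

text \<open>For a monomial function the block peeled off is a prefix of its composition.\<close>

lemma peel_monomial_coeffs:
  assumes "pos_list ps"
  shows "peel G q (monomial_coeffs ps) rs =
    (\<Sum>j\<le>length ps. (if sum_list (take j ps) = q then monomial_value G (take j ps) else 0) * monomial_coeffs (drop j ps) rs)"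
proof -
  have "monomial_coeffs ps (qs @ rs) = (\<Sum>j\<le>length ps. if take j ps = qs then monomial_coeffs (drop j ps) rs else (0 :: 'a))"
    if "pos_list qs" for qs
  proof -
    have "(\<Sum>j\<le>length ps. if take j ps = qs then monomial_coeffs (drop j ps) rs else (0 :: 'a)) =
        (\<Sum>j\<le>length ps. if j = length qs then (if take j ps = qs then monomial_coeffs (drop j ps) rs else 0) else 0)"
      by (intro sum.cong refl) auto
    also have "\<dots> = monomial_coeffs ps (qs @ rs)"
    proof -
      have "length qs \<le> length ps" if "take (length qs) ps = qs"
        using arg_cong[OF that, of length] by simp
      then show ?thesis
        using drop_zeros_pos[OF that] by (auto simp: monomial_coeffs_def append_eq_conv_conj)
    qed
    finally show ?thesis ..
  qed
  then have "peel G q (monomial_coeffs ps) rs =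
      (\<Sum>qs\<in>compositions q. \<Sum>j\<le>length ps. monomial_value G qs * (if take j ps = qs then monomial_coeffs (drop j ps) rs else 0))"
    by (simp add: peel_def graded_value_def compositions_def sum_distrib_left)
  also have "\<dots> = (\<Sum>j\<le>length ps. \<Sum>qs\<in>compositions q. monomial_value G qs * (if take j ps = qs then monomial_coeffs (drop j ps) rs else 0))"
    by (rule sum.swap)
  also have "\<dots> = (\<Sum>j\<le>length ps. (if sum_list (take j ps) = q then monomial_value G (take j ps) else 0) * monomial_coeffs (drop j ps) rs)"
  proof (intro sum.cong refl)
    fix j
    have "(\<Sum>qs\<in>compositions q. monomial_value G qs * (if take j ps = qs then monomial_coeffs (drop j ps) rs else 0)) =
        (\<Sum>qs\<in>compositions q. if qs = take j ps then monomial_value G qs * monomial_coeffs (drop j ps) rs else 0)"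
      by (intro sum.cong refl) auto
    moreover have "take j ps \<in> compositions q \<longleftrightarrow> sum_list (take j ps) = q"
      using pos_list_take[OF assms] by (simp add: compositions_def)
    ultimately show "(\<Sum>qs\<in>compositions q. monomial_value G qs * (if take j ps = qs then monomial_coeffs (drop j ps) rs else 0)) =
        (if sum_list (take j ps) = q then monomial_value G (take j ps) else 0) * monomial_coeffs (drop j ps) rs"
      by simp
  qed
  finally show ?thesis .
qed

lemma block_sum_monomial_coeffs:
  assumes "pos_list ps"
  shows "block_sum G (q # qs) (monomial_coeffs ps) = (\<Sum>j\<le>length ps.
    (if sum_list (take j ps) = q then monomial_value G (take j ps) else 0) * block_sum G qs (monomial_coeffs (drop j ps)))"
proof -
  have "peel G q (monomial_coeffs ps) = (\<lambda>rs. \<Sum>j\<le>length ps.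
      (if sum_list (take j ps) = q then monomial_value G (take j ps) else 0) * monomial_coeffs (drop j ps) rs)"
    using peel_monomial_coeffs[OF assms] by blast
  then show ?thesis by (simp only: block_sum.simps block_sum_sum block_sum_scale)
qed

lemma block_sum_monomial_coeffs_eq_0:
  assumes "pos_list ps" "sum_list qs \<noteq> sum_list ps"
  shows "block_sum G qs (monomial_coeffs ps) = 0"
  using assms
proof (induction qs arbitrary: ps)
  case Nil
  then show ?case by (auto simp: monomial_coeffs_def)
next
  case (Cons q qs)
  have "(if sum_list (take j ps) = q then monomial_value G (take j ps) else 0) * block_sum G qs (monomial_coeffs (drop j ps)) = 0" for j
  proof (cases "sum_list (take j ps) = q")
    case True
    have "sum_list (take j ps) + sum_list (drop j ps) = sum_list ps"
      by (metis append_take_drop_id sum_list_append)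
    then have "block_sum G qs (monomial_coeffs (drop j ps)) = 0"
      using Cons.prems True by (intro Cons.IH pos_list_drop) auto
    then show ?thesis by simp
  qed simp
  then show ?case by (simp only: block_sum_monomial_coeffs[OF Cons.prems(1)]) simp
qed

lemma block_sum_monomial_coeffs_Nil: "0 < sum_list qs \<Longrightarrow> block_sum G qs (monomial_coeffs []) = 0"
  by (rule block_sum_monomial_coeffs_eq_0) (auto simp del: sum_list_eq_0_iff)

text \<open>The compositions with \<open>n\<close> parts of size at most \<open>N\<close>: a finite index set that decomposes as a
  product. Any \<open>N\<close> that is at least the degree in question will do, as the remaining \<open>block_sum\<close> values
  vanish.\<close>

definition bounded_words :: "nat \<Rightarrow> nat \<Rightarrow> nat list set"
  where "bounded_words N n = {qs. set qs \<subseteq> {1..N} \<and> length qs = n}"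

lemma bounded_words_simps: "bounded_words N 0 = {[]}"
  "bounded_words N (Suc n) = (\<lambda>(q, qs). q # qs) ` ({1..N} \<times> bounded_words N n)"
  by (auto simp: bounded_words_def length_Suc_conv image_iff)

lemma finite_bounded_words: "finite (bounded_words N n)"
  by (induction n) (simp_all add: bounded_words_simps)

lemma sum_bounded_words_Suc:
  "(\<Sum>qs\<in>bounded_words N (Suc n). F qs) = (\<Sum>qs\<in>bounded_words N n. \<Sum>q=1..N. F (q # qs))"
proof -
  have "(\<Sum>qs\<in>bounded_words N (Suc n). F qs) = (\<Sum>(q, qs)\<in>{1..N} \<times> bounded_words N n. F (q # qs))"
    unfolding bounded_words_simps by (subst sum.reindex) (auto simp: inj_on_def case_prod_unfold)
  also have "\<dots> = (\<Sum>q=1..N. \<Sum>qs\<in>bounded_words N n. F (q # qs))"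
    by (rule sum.cartesian_product[symmetric])
  finally show ?thesis by (simp only: sum.swap[of _ "{1..N}"])
qed

lemma bounded_wordsD: "qs \<in> bounded_words N n \<Longrightarrow> pos_list qs" "qs \<in> bounded_words N (Suc n) \<Longrightarrow> 0 < sum_list qs"
proof -
  show pos: "pos_list qs" if "qs \<in> bounded_words N n" for n qs
    using that by (auto simp: bounded_words_def pos_list_def)
  show "0 < sum_list qs" if "qs \<in> bounded_words N (Suc n)"
    using length_le_sum_list[OF pos[OF that]] that by (simp add: bounded_words_def)
qed

text \<open>Summing over all sizes \<open>q\<close> of the first block is summing over all positions \<open>j\<close> of its end. The
  position \<open>j = 0\<close> would give an empty block, which the range \<open>q \<ge> 1\<close> excludes.\<close>

lemma sum_block_sum_Cons:
  fixes G :: "'k::field ncpoly \<Rightarrow> 'k"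
  assumes ps: "pos_list ps" "sum_list ps \<le> N"
  shows "(\<Sum>q=1..N. pm_scale (block_sum G (q # qs) (monomial_coeffs ps)) (ab_basis 0 (q # qs))) =
    (\<Sum>j\<in>{1..length ps}. pm_scale (monomial_value G (take j ps) * block_sum G qs (monomial_coeffs (drop j ps)))
       (ab_basis 0 (sum_list (take j ps) # qs)))"
proof -
  let ?v = "\<lambda>j. monomial_value G (take j ps) * block_sum G qs (monomial_coeffs (drop j ps))"
  have "(\<Sum>q=1..N. pm_scale (block_sum G (q # qs) (monomial_coeffs ps)) (ab_basis 0 (q # qs))) =
      (\<Sum>q=1..N. \<Sum>j\<le>length ps. if q = sum_list (take j ps) then pm_scale (?v j) (ab_basis 0 (q # qs)) else 0)"
    unfolding block_sum_monomial_coeffs[OF ps(1)] pm.scale_sum_left by (intro sum.cong refl) auto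
  also have "\<dots> = (\<Sum>j\<le>length ps. \<Sum>q=1..N. if q = sum_list (take j ps) then pm_scale (?v j) (ab_basis 0 (q # qs)) else 0)"
    by (rule sum.swap)
  also have "\<dots> = (\<Sum>j\<le>length ps. if 1 \<le> j then pm_scale (?v j) (ab_basis 0 (sum_list (take j ps) # qs)) else 0)"
  proof (intro sum.cong refl)
    fix j assume "j \<in> {..length ps}"
    then have "min (length ps) j \<le> sum_list (take j ps)"
      using length_le_sum_list[OF pos_list_take[OF ps(1)], of j] by simp
    moreover have "sum_list (take j ps) \<le> N"
      using ps(2) append_take_drop_id[of j ps] by (metis le_add1 order_trans sum_list_append)
    ultimately have "sum_list (take j ps) \<in> {1..N} \<longleftrightarrow> 1 \<le> j"
      using \<open>j \<in> {..length ps}\<close> by (cases "j = 0") auto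
    then show "(\<Sum>q=1..N. if q = sum_list (take j ps) then pm_scale (?v j) (ab_basis 0 (q # qs)) else 0) =
        (if 1 \<le> j then pm_scale (?v j) (ab_basis 0 (sum_list (take j ps) # qs)) else 0)"
      by simp
  qed
  also have "\<dots> = (\<Sum>j\<in>{1..length ps}. pm_scale (?v j) (ab_basis 0 (sum_list (take j ps) # qs)))"
    by (rule sum.mono_neutral_cong_right) auto
  finally show ?thesis .
qed

text \<open>Induction on the number of cuts: the first cut splits off a block, whose value under \<open>ghat\<close>
  is the power of \<open>a - b\<close> belonging to its sum, and the remaining cuts are made in the rest of the
  composition.\<close>

lemma tail_prod_ab_monomial:
  fixes G :: "'k::field ncpoly \<Rightarrow> 'k"
  assumes G: "Vector_Spaces.linear pm_scale (*) G" and "pos_list ps" "ps \<noteq> []" "sum_list ps \<le> N"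
  shows "tail_prod G (iter_coproduct n (ab_monomial ps)) =
    (\<Sum>qs\<in>bounded_words N (Suc n). pm_scale (block_sum G qs (monomial_coeffs ps)) (ab_basis 0 qs))"
  using assms(2-4)
proof (induction n arbitrary: ps)
  case 0
  have "{1..length ps} = insert (length ps) {1..<length ps}" using 0 by (cases ps) auto
  moreover have "block_sum G [] (monomial_coeffs (drop j ps)) = 0" if "j \<in> {1..<length ps}" for j
    using that by (simp add: monomial_coeffs_def)
  ultimately show ?case
    by (simp only: tail_prod_iter b_ghat_ab_monomial[OF G 0(1,2)] sum_bounded_words_Suc bounded_words_simps(1)
        sum_block_sum_Cons[OF 0(1,3)])
      (simp add: monomial_coeffs_def)
next
  case (Suc n)
  let ?F = "\<lambda>j qs. pm_scale (monomial_value G (take j ps) * block_sum G qs (monomial_coeffs (drop j ps)))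
       (ab_basis 0 (sum_list (take j ps) # qs))"
  obtain p ps' where ps: "ps = p # ps'" using Suc.prems by (cases ps) auto
  have "tail_prod G (iter_coproduct (Suc n) (ab_monomial ps)) = (\<Sum>j<length ps'.
      var_b * ghat G (ab_basis (p - 1) (take j ps')) * tail_prod G (iter_coproduct n (ab_monomial (drop j ps'))))"
    unfolding tail_prod_iter
    using coproduct_prod_ab_basis[OF linear_b_ghat linear_tail_prod_iter, of G G n "p - 1" ps']
    by (simp add: ab_monomial_def ps)
  also have "\<dots> = (\<Sum>j<length ps'. \<Sum>qs\<in>bounded_words N (Suc n). ?F (Suc j) qs)"
  proof (intro sum.cong refl)
    fix j assume j: "j \<in> {..<length ps'}"
    let ?l = "take (Suc j) ps" and ?r = "drop (Suc j) ps"
    have "sum_list ?r \<le> N"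
      using Suc.prems(3) append_take_drop_id[of "Suc j" ps] by (metis le_add2 order_trans sum_list_append)
    then have r: "tail_prod G (iter_coproduct n (ab_monomial ?r)) =
        (\<Sum>qs\<in>bounded_words N (Suc n). pm_scale (block_sum G qs (monomial_coeffs ?r)) (ab_basis 0 qs))"
      using Suc.prems j by (intro Suc.IH pos_list_drop) (simp_all add: ps)
    have l: "var_b * ghat G (ab_monomial ?l) = pm_scale (monomial_value G ?l) (ab_basis 0 [sum_list ?l])"
      by (rule b_ghat_ab_monomial[OF G pos_list_take]) (use Suc.prems in \<open>simp_all add: ps\<close>)
    have m: "ab_basis 0 [q] * ab_basis 0 qs = (ab_basis 0 (q # qs) :: 'k ncpoly)" for q qs
      by (simp add: ab_basis_def)
    have "var_b * ghat G (ab_monomial ?l) * tail_prod G (iter_coproduct n (ab_monomial ?r)) =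
        (\<Sum>qs\<in>bounded_words N (Suc n). ?F (Suc j) qs)"
      unfolding l r
      by (simp add: sum_distrib_left pm_scale_mult_left pm_scale_mult_right m mult.commute del: take_Suc_Cons drop_Suc_Cons)
    then show "var_b * ghat G (ab_basis (p - 1) (take j ps')) * tail_prod G (iter_coproduct n (ab_monomial (drop j ps'))) =
        (\<Sum>qs\<in>bounded_words N (Suc n). ?F (Suc j) qs)"
      by (simp add: ab_monomial_def ps)
  qed
  also have "\<dots> = (\<Sum>qs\<in>bounded_words N (Suc n). \<Sum>j<length ps'. ?F (Suc j) qs)"
    by (rule sum.swap)
  also have "\<dots> = (\<Sum>qs\<in>bounded_words N (Suc n). \<Sum>j\<in>{1..length ps}. ?F j qs)"
  proof (rule sum.cong)
    fix qs assume qs: "qs \<in> bounded_words N (Suc n)"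
    \<comment> \<open>A cut behind the last part would leave an empty rest.\<close>
    have "block_sum G qs (monomial_coeffs []) = 0"
      using bounded_wordsD(2)[OF qs] by (rule block_sum_monomial_coeffs_Nil)
    then have "?F (Suc (length ps')) qs = 0" by (simp add: ps)
    moreover have "(\<Sum>j\<in>{1..length ps}. ?F j qs) = (\<Sum>j<Suc (length ps'). ?F (Suc j) qs)"
      by (rule sum.reindex_bij_witness[where i = Suc and j = "\<lambda>j. j - 1"]) (auto simp: ps)
    ultimately show "(\<Sum>j<length ps'. ?F (Suc j) qs) = (\<Sum>j\<in>{1..length ps}. ?F j qs)"
      by (simp only: sum.lessThan_Suc) simp
  qed simp
  also have "\<dots> = (\<Sum>qs\<in>bounded_words N (Suc (Suc n)). pm_scale (block_sum G qs (monomial_coeffs ps)) (ab_basis 0 qs))"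
    unfolding sum_bounded_words_Suc[of _ N "Suc n"] sum_block_sum_Cons[OF Suc.prems(1,3)] by (rule refl)
  finally show ?case .
qed

text \<open>Since \<open>kappa\<close> vanishes on every basis element containing a letter \<open>b\<close>, the first cut is at the
  first \<open>b\<close>, and the exponent \<open>p\<close> is preserved.\<close>

lemma chain_product_ab_basis:
  fixes G :: "'k::field ncpoly \<Rightarrow> 'k"
  assumes G: "Vector_Spaces.linear pm_scale (*) G" and ps: "pos_list ps" "sum_list ps \<le> N"
  shows "chain_product G (iter_coproduct n (ab_basis p ps)) =
    (\<Sum>qs\<in>bounded_words N n. pm_scale (block_sum G qs (monomial_coeffs ps)) (ab_basis p qs))"
proof (cases n)
  case 0
  show ?thesis
    unfolding 0 chain_product_iter using ps(1) by (simp add: kappa_ab_basis bounded_words_simps monomial_coeffs_def ab_basis_simps)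
next
  case (Suc m)
  have k: "Vector_Spaces.linear pm_scale pm_scale (kappa :: 'k ncpoly \<Rightarrow> _)"
    unfolding kappa_def by (rule linear_deg_twist)
  have "chain_product G (iter_coproduct n (ab_basis p ps)) = (\<Sum>j<length ps.
      kappa (ab_basis p (take j ps)) * tail_prod G (iter_coproduct m (ab_monomial (drop j ps))))"
    unfolding Suc chain_product_iter by (rule coproduct_prod_ab_basis[OF k linear_tail_prod_iter])
  also have "\<dots> = (\<Sum>j<length ps. if j = 0 then
      (var_a - var_b) ^ p * tail_prod G (iter_coproduct m (ab_monomial ps)) else 0)"
    by (intro sum.cong refl) (auto simp: kappa_ab_basis[OF pos_list_take[OF ps(1)]])
  also have "\<dots> = (\<Sum>qs\<in>bounded_words N n. pm_scale (block_sum G qs (monomial_coeffs ps)) (ab_basis p qs))"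
  proof (cases "ps = []")
    case True
    then show ?thesis
      by (auto simp: Suc block_sum_monomial_coeffs_Nil[OF bounded_wordsD(2)] intro!: sum.neutral[symmetric])
  next
    case False
    have "(var_a - var_b) ^ p * ab_basis 0 qs = (ab_basis p qs :: 'k ncpoly)" for qs
      by (simp add: ab_basis_def)
    with False show ?thesis
      by (simp add: Suc tail_prod_ab_monomial[OF G ps(1) _ ps(2)] sum_distrib_left pm_scale_mult_right)
  qed
  finally show ?thesis .
qed

lemma chain_map_eq_sum:
  assumes "\<And>w. w \<in> Poly_Mapping.keys u \<Longrightarrow> length w \<le> N"
  shows "chain_map G u = (\<Sum>n\<le>N. chain_product G (iter_coproduct n u))"
  unfolding chain_map_def
proof (rule Sum_any.expand_superset)
  interpret c: Vector_Spaces.linear pm_scale pm_scale "chain_product G" by (rule linear_chain_product)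
  have "chain_product G (iter_coproduct n u) = 0" if "N < n" for n
  proof -
    have "iter_coproduct n u = 0"
      by (rule iter_coproduct_eq_0) (use assms that in \<open>blast intro: le_less_trans\<close>)
    then show ?thesis by (simp add: c.zero)
  qed
  then show "{n. chain_product G (iter_coproduct n u) \<noteq> 0} \<subseteq> {..N}"
    by (auto simp: not_less[symmetric])
qed simp

lemma linear_chain_map: "Vector_Spaces.linear pm_scale pm_scale (chain_map G)"
proof -
  interpret c: Vector_Spaces.linear pm_scale pm_scale "\<lambda>u. chain_product G (iter_coproduct n u)" for n
    by (rule linear_chain_product_iter)
  define N where "N u = Max (length ` Poly_Mapping.keys u)" for u :: "'a ncpoly"
  have N: "length w \<le> N u" if "w \<in> Poly_Mapping.keys u" for u :: "'a ncpoly" and w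
    unfolding N_def using that by (intro Max_ge) auto
  show ?thesis
  proof unfold_locales
    fix u v :: "'a ncpoly"
    have le: "length w \<le> max (N u) (N v)" if "w \<in> Poly_Mapping.keys (u + v) \<union> Poly_Mapping.keys u \<union> Poly_Mapping.keys v" for w
      using that Poly_Mapping.keys_add[of u v] N[of w u] N[of w v] by (auto simp: le_max_iff_disj)
    show "chain_map G (u + v) = chain_map G u + chain_map G v"
      using le by (simp add: chain_map_eq_sum[where N = "max (N u) (N v)"] c.add sum.distrib)
  next
    fix k and u :: "'a ncpoly"
    have "length w \<le> N u" if "w \<in> Poly_Mapping.keys (pm_scale k u)" for w
      using that by (intro N) (auto simp: in_keys_iff)
    then show "chain_map G (pm_scale k u) = pm_scale k (chain_map G u)"
      using N[of _ u] by (simp add: chain_map_eq_sum[where N = "N u"] c.scale pm.scale_sum_right)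
  qed
qed

section \<open>The chain map on type B quasisymmetric functions\<close>

lemma linear_gamma_B: "Vector_Spaces.linear pm_scale bq_scale gamma_B"
  using is_gamma_B_gamma_B unfolding is_gamma_B_def by (rule conjunct1)

lemma gamma_B_ab_basis:
  assumes "pos_list ps"
  shows "gamma_B (ab_basis p ps) = (s_qmonomial p ps :: 'k::field bqsym)"
  using is_gamma_B_gamma_B[where ?'a = 'k] assms unfolding is_gamma_B_def by blast

lemma gamma_B_inv: "gamma_B (inv gamma_B f) = (f :: 'k::field bqsym)"
  by (rule surj_f_inv_f[OF bij_is_surj[OF bij_gamma_B]])

lemma linear_qcoeffs_coeff: "Vector_Spaces.linear bq_scale (*) (\<lambda>f. qcoeffs (coeff f p) qs)"
  by unfold_locales (simp_all add: bq_scale_def qcoeffs_def qcoeff_qconst_mult algebra_simps)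

lemma qcoeffs_coeff_ab_basis:
  assumes "pos_list ps"
  shows "qcoeffs (coeff (gamma_B (ab_basis p' ps :: 'k::field ncpoly)) p) qs = (if p = p' then monomial_coeffs ps qs else 0)"
proof -
  have "qcoeffs 0 qs = (0 :: 'k)" by (simp add: qcoeffs_def)
  then show ?thesis
    using assms by (simp add: gamma_B_ab_basis s_qmonomial_def qcoeffs_qmonomial)
qed

lemma qcoeffs_coeff_chain_map_ab_basis:
  fixes G :: "'k::field ncpoly \<Rightarrow> 'k"
  assumes G: "Vector_Spaces.linear pm_scale (*) G" and "pos_list ps" "pos_list qs"
  shows "qcoeffs (coeff (gamma_B (chain_map G (ab_basis p' ps))) p) qs =
    (if p = p' then block_sum G qs (monomial_coeffs ps) else 0)"
proof -
  define L where "L u = qcoeffs (coeff (gamma_B u) p) qs" for u :: "'k ncpoly"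
  have "Vector_Spaces.linear pm_scale (*) L"
    using Vector_Spaces.linear_compose[OF linear_gamma_B linear_qcoeffs_coeff] by (simp add: o_def L_def[abs_def])
  then interpret L: Vector_Spaces.linear pm_scale "(*)" L .
  \<comment> \<open>All words in \<open>ab_basis p' ps\<close> have length \<open>N\<close>, and \<open>N\<close> bounds the sum of \<open>ps\<close>. So one bound
  serves for the number of coproducts and for the size of the parts.\<close>
  define N where "N = p' + sum_list ps"
  have N: "length w \<le> N" if "w \<in> Poly_Mapping.keys (ab_basis p' ps :: 'k ncpoly)" for w
    using homogeneous_ab_basis[OF assms(2), of p', where 'a = 'k] that by (auto simp: homogeneous_def N_def)
  let ?t = "if p = p' then block_sum G qs (monomial_coeffs ps) else 0"
  have "L (chain_map G (ab_basis p' ps)) =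
      (\<Sum>n\<le>N. \<Sum>rs\<in>bounded_words N n. block_sum G rs (monomial_coeffs ps) * L (ab_basis p' rs))"
    using chain_product_ab_basis[OF G assms(2), of N _ p']
    by (simp add: chain_map_eq_sum[OF N] L.sum L.scale N_def)
  also have "\<dots> = (\<Sum>n\<le>N. \<Sum>rs\<in>bounded_words N n. if rs = qs then ?t else 0)"
    using drop_zeros_pos[OF assms(3)]
    by (intro sum.cong refl) (auto simp: L_def qcoeffs_coeff_ab_basis bounded_wordsD(1) monomial_coeffs_def)
  also have "\<dots> = (\<Sum>n\<le>N. if n = length qs then (if qs \<in> bounded_words N n then ?t else 0) else 0)"
    by (intro sum.cong refl) (auto simp: finite_bounded_words, auto simp: bounded_words_def)
  also have "\<dots> = ?t"
  proof (cases "sum_list qs = sum_list ps")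
    case True
    have "q \<le> N" if "q \<in> set qs" for q
      using member_le_sum_list[OF that] True by (simp add: N_def)
    moreover have "length qs \<le> N" using length_le_sum_list[OF assms(3)] True by (simp add: N_def)
    ultimately show ?thesis
      using assms(3) by (auto simp: bounded_words_def pos_list_def)
  next
    case False
    then show ?thesis by (simp add: block_sum_monomial_coeffs_eq_0[OF assms(2)] cong: if_cong)
  qed
  finally show ?thesis by (simp add: L_def)
qed

text \<open>The chain map acts on each coefficient with respect to \<open>s\<close> separately, by \<open>block_sum\<close>. Both
  sides are linear, so it suffices to compare them on the basis.\<close>

lemma qcoeffs_coeff_bq_chain_map:
  fixes G :: "'k::field ncpoly \<Rightarrow> 'k"
  assumes G: "Vector_Spaces.linear pm_scale (*) G" and "pos_list qs"
  shows "qcoeffs (coeff (bq_chain_map G f) p) qs = block_sum G qs (qcoeffs (coeff f p))"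
proof -
  have "qcoeffs (coeff (gamma_B (chain_map G u)) p) qs = block_sum G qs (qcoeffs (coeff (gamma_B u) p))" for u
  proof (rule linear_eq_on_ab_basis[where f = "\<lambda>u. qcoeffs (coeff (gamma_B (chain_map G u)) p) qs"])
    show "Vector_Spaces.linear pm_scale (*) (\<lambda>u. qcoeffs (coeff (gamma_B (chain_map G u)) p) qs)"
      using Vector_Spaces.linear_compose[OF linear_chain_map
          Vector_Spaces.linear_compose[OF linear_gamma_B linear_qcoeffs_coeff]]
      by (simp add: o_def)
    interpret l: Vector_Spaces.linear pm_scale "(*)" "\<lambda>u :: 'k ncpoly. qcoeffs (coeff (gamma_B u) p) rs" for rs
      using Vector_Spaces.linear_compose[OF linear_gamma_B linear_qcoeffs_coeff] by (simp add: o_def)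
    \<comment> \<open>A sum over two indices brings additivity into the form of \<open>block_sum_sum\<close>.\<close>
    have add: "qcoeffs (coeff (gamma_B (u + v)) p) = (\<lambda>rs. \<Sum>i\<in>{True, False}. qcoeffs (coeff (gamma_B (if i then u else v)) p) rs)"
      and scale: "qcoeffs (coeff (gamma_B (pm_scale c u)) p) = (\<lambda>rs. c * qcoeffs (coeff (gamma_B u) p) rs)"
      for u v :: "'k ncpoly" and c
      by (simp_all add: fun_eq_iff l.add l.scale)
    show "Vector_Spaces.linear pm_scale (*) (\<lambda>u. block_sum G qs (qcoeffs (coeff (gamma_B u) p)))"
      by unfold_locales (simp_all only: add scale block_sum_sum block_sum_scale, simp_all add: algebra_simps)
    fix p' ps assume ps: "pos_list ps"
    have "qcoeffs (coeff (gamma_B (ab_basis p' ps)) p) = (\<lambda>rs. (if p = p' then 1 else 0 :: 'k) * monomial_coeffs ps rs)"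
      by (simp add: fun_eq_iff qcoeffs_coeff_ab_basis[OF ps])
    then show "qcoeffs (coeff (gamma_B (chain_map G (ab_basis p' ps))) p) qs =
        block_sum G qs (qcoeffs (coeff (gamma_B (ab_basis p' ps)) p))"
      by (simp add: block_sum_scale qcoeffs_coeff_chain_map_ab_basis[OF G ps assms(2)])
  qed
  from this[of "inv gamma_B f"] show ?thesis
    by (simp add: bq_chain_map_def gamma_B_inv)
qed

text \<open>Two elements of \<open>BQSym\<close> agree if all their coefficients agree, so multiplicativity reduces to
  \<open>block_sum_conv\<close> applied to the products of the \<open>s\<close>-coefficients.\<close>

theorem theorem13p5:
  fixes G :: "'k::field ncpoly \<Rightarrow> 'k"
  assumes "is_character G"
  shows "algebra_hom bq_scale bq_scale (bq_chain_map G)"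
  unfolding algebra_hom_def
proof (intro conjI allI)
  have G: "Vector_Spaces.linear pm_scale (*) G" using assms by (rule linear_character)
  note qcoeffs_g = qcoeffs_coeff_bq_chain_map[OF G]
  interpret g: Vector_Spaces.linear pm_scale bq_scale gamma_B by (rule linear_gamma_B)
  have "Vector_Spaces.linear bq_scale pm_scale (inv gamma_B :: 'k bqsym \<Rightarrow> _)"
  proof (intro Vector_Spaces.linear.intro module_hom.intro pm.vector_space_axioms bq.vector_space_axioms
      module_hom_axioms.intro pm.module_axioms bq.module_axioms)
    have inv: "inv gamma_B f = u \<longleftrightarrow> f = gamma_B u" for f :: "'k bqsym" and u
      using bij_gamma_B by (metis bij_inv_eq_iff)
    show "inv gamma_B (f + h) = inv gamma_B f + inv gamma_B h" for f h :: "'k bqsym"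
      by (simp add: inv g.add gamma_B_inv)
    show "inv gamma_B (bq_scale c f) = pm_scale c (inv gamma_B f)" for f :: "'k bqsym" and c
      by (simp add: inv g.scale gamma_B_inv)
  qed
  from Vector_Spaces.linear_compose[OF this Vector_Spaces.linear_compose[OF linear_chain_map linear_gamma_B]]
  show "Vector_Spaces.linear bq_scale bq_scale (bq_chain_map G)"
    by (simp add: o_def bq_chain_map_def[abs_def])
  have "kappa 1 = (1 :: 'k ncpoly)"
    using kappa_ab_basis[of "[]" 0, where ?'k = 'k] by (simp add: ab_basis_simps)
  moreover have gamma_1: "gamma_B 1 = (1 :: 'k bqsym)"
    using gamma_B_ab_basis[of "[]" 0, where ?'k = 'k]
    by (simp add: ab_basis_simps s_qmonomial_def qmonomial_Nil)
  moreover have "inv gamma_B 1 = (1 :: 'k ncpoly)"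
    using inv_f_f[OF bij_is_inj[OF bij_gamma_B], of "1 :: 'k ncpoly"] by (simp add: gamma_1)
  moreover have "chain_map G 1 = chain_product G (iter_coproduct 0 1)"
    by (subst chain_map_eq_sum[where N = 0]) (auto simp: zero_list_def)
  ultimately show "bq_chain_map G 1 = 1"
    by (simp only: bq_chain_map_def chain_product_iter)
  fix x y
  show "bq_chain_map G (x * y) = bq_chain_map G x * bq_chain_map G y"
  proof (rule poly_eqI, rule qcoeffs_eqI)
    fix p qs assume qs: "pos_list qs"
    have g_all: "qcoeffs (coeff (bq_chain_map G f) i) rs = block_sum G rs (qcoeffs (coeff f i))" for f i rs
    proof -
      \<comment> \<open>Splittings produce lists with zeros, to which the identity for positive lists extends.\<close>
      have "zero_invariant (\<lambda>qs. block_sum G qs (qcoeffs (coeff f i)))" by (intro zero_invariant_block_sum zero_invariant_qcoeffs)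
      from zero_invariantD[OF this, of rs] zero_invariantD[OF zero_invariant_qcoeffs, of "coeff (bq_chain_map G f) i" rs]
      show ?thesis using qcoeffs_g[of "drop_zeros rs" f i] by simp
    qed
    have "qcoeffs (coeff (x * y) p) = (\<lambda>rs. \<Sum>i\<le>p. conv (qcoeffs (coeff x i)) (qcoeffs (coeff y (p - i))) rs)"
      by (simp add: fun_eq_iff coeff_mult qcoeffs_sum qcoeffs_mult)
    then have "qcoeffs (coeff (bq_chain_map G (x * y)) p) qs =
        (\<Sum>i\<le>p. block_sum G qs (conv (qcoeffs (coeff x i)) (qcoeffs (coeff y (p - i)))))"
      by (simp add: g_all block_sum_sum)
    also have "\<dots> = (\<Sum>i\<le>p. conv (qcoeffs (coeff (bq_chain_map G x) i)) (qcoeffs (coeff (bq_chain_map G y) (p - i))) qs)"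
      by (simp add: block_sum_conv[OF assms zero_invariant_qcoeffs zero_invariant_qcoeffs] g_all[abs_def] conv_def)
    finally show "qcoeffs (coeff (bq_chain_map G (x * y)) p) qs = qcoeffs (coeff (bq_chain_map G x * bq_chain_map G y) p) qs"
      by (simp add: coeff_mult qcoeffs_sum qcoeffs_mult)
  qed
qed

end
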